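(* Let $k$ be an algebraically closed field and let $n>9$ be an integer. Consider $n$ general points $p_1,\ldots,p_n\in\mathbf{P}^2$ over $k$. (a) Suppose $n$ is not a square. Then there are infinitely many integers $m>0$ such that $I(m;n)$ is rank minimal whenever $I(m;n)$ and $I(m;n)'$ are unhindered. (b) Suppose $n$ is an odd square. Then for all integers $m\ge (n-9)/8$, $I(m;n)$ is rank minimal whenever $I(m;n)$ and $I(m;n)'$ are unhindered. (c) Suppose $n=r^2$ is an even square (with $r>0$). Then for all integers $m\ge (r-2)/4$, $I(m;n)$ is rank minimal whenever $I(m;n)$ is unhindered.
   Context: $k$ is an algebraically closed field of arbitrary characteristic and $R=k[x,y,z]$ is the homogeneous coordinate ring of $\mathbf{P}^2$. For points $p_1,\ldots,p_n\in\mathbf{P}^2$, $P_j\subset R$ is the homogeneous ideal of $p_j$. For an $n$-tuple $\mathbf{m}=(m_1,\ldots,m_n)$ of nonnegative integers, $I(\mathbf{m};n)=P_1^{m_1}\cap\cdots\cap P_n^{m_n}$. A statement about general points means that it holds for all $(p_1,\ldots,p_n)$ in some nonempty Zariski-open subset of $(\mathbf{P}^2)^n$ (which may depend on the multiplicities considered). Notation: $I(m;n)=I((m,\ldots,m);n)$, and $I(m;n)'=I((m+1,m,\ldots,m);n)$ (first multiplicity raised by $1$, same points). For a homogeneous ideal $I$, $h_I(t)=\dim_k I_t$ is its Hilbert function. $I(\mathbf{m};n)$ is unhindered if $h_{I(\mathbf{m};n)}(t)=\max\{0,\ ((t+1)(t+2)-\sum_{i=1}^n m_i(m_i+1))/2\}$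 for all $t\ge 0$. Let $\alpha(\mathbf{m};n)$ be the least degree $t$ with $I(\mathbf{m};n)_t\neq 0$ and let $h(\mathbf{m};n)=h_{I(\mathbf{m};n)}(\alpha(\mathbf{m};n))$. $I(\mathbf{m};n)$ is rank minimal if it is unhindered and, in its minimal graded free resolution $0\to F_1\to F_0\to I(\mathbf{m};n)\to 0$ over $R$, the rank of $F_0$ is $\max\{h(\mathbf{m};n),\ \alpha(\mathbf{m};n)+2-h(\mathbf{m};n)\}$. *)

theory Defs
  imports
    Complex_Main
    "HOL-Library.Poly_Mapping"
    "HOL-Library.Numeral_Type"
    "HOL-Library.FuncSet"
    "HOL-Computational_Algebra.Polynomial"
    "HOL-Computational_Algebra.Nth_Powers"
    "Jordan_Normal_Form.Matrix"
begin

text \<open>Polynomials with coefficients in \<open>'k\<close> and variables indexed by \<open>'v\<close> are finitely supported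
  maps from exponent vectors to coefficients. In particular \<open>'k ternary\<close> is \<open>k[x,y,z]\<close>.\<close>

type_synonym ('v, 'k) mpoly = "('v \<Rightarrow>\<^sub>0 nat) \<Rightarrow>\<^sub>0 'k"
type_synonym 'k ternary = "(3, 'k) mpoly"

definition eval_mpoly :: "('v \<Rightarrow> 'k) \<Rightarrow> ('v, 'k::comm_ring_1) mpoly \<Rightarrow> 'k" where
  "eval_mpoly v F =
     (\<Sum>e\<in>Poly_Mapping.keys F. Poly_Mapping.lookup F e *
        (\<Prod>x\<in>Poly_Mapping.keys e. v x ^ Poly_Mapping.lookup e x))"

definition exp_degree :: "('v::finite \<Rightarrow>\<^sub>0 nat) \<Rightarrow> nat" where
  "exp_degree e = (\<Sum>x\<in>UNIV. Poly_Mapping.lookup e x)"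

definition homogeneous :: "nat \<Rightarrow> ('v::finite, 'k::zero) mpoly \<Rightarrow> bool" where
  "homogeneous d F \<longleftrightarrow> (\<forall>e\<in>Poly_Mapping.keys F. exp_degree e = d)"

definition scale_mpoly :: "'k::comm_ring_1 \<Rightarrow> ('v, 'k) mpoly \<Rightarrow> ('v, 'k) mpoly" where
  "scale_mpoly c F = Poly_Mapping.single 0 c * F"

global_interpretation mpoly_space:
  Vector_Spaces.vector_space "scale_mpoly :: 'k::field \<Rightarrow> ('v, 'k) mpoly \<Rightarrow> ('v, 'k) mpoly"
proof unfold_locales
  fix a b :: 'k and F G :: "('v, 'k) mpoly"
  show "scale_mpoly a (F + G) = scale_mpoly a F + scale_mpoly a G"
    by (simp add: scale_mpoly_def distrib_left)
  show "scale_mpoly (a + b) F = scale_mpoly a F + scale_mpoly b F"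
    by (simp add: scale_mpoly_def single_add distrib_right)
  show "scale_mpoly a (scale_mpoly b F) = scale_mpoly (a * b) F"
    by (simp add: scale_mpoly_def mult_single flip: mult.assoc)
  show "scale_mpoly 1 F = F"
    by (simp add: scale_mpoly_def)
qed

text \<open>A commutative ring as a module over itself: \<open>subspace\<close> means ideal, \<open>span\<close> means
  generated ideal.\<close>

global_interpretation ring_ideal:
  Modules.module "(*) :: 'a::comm_ring_1 \<Rightarrow> 'a \<Rightarrow> 'a"
  by unfold_locales (simp_all only: distrib_left distrib_right mult.assoc mult_1_left)

definition ideal_mult :: "'a::comm_ring_1 set \<Rightarrow> 'a set \<Rightarrow> 'a set" where
  "ideal_mult I J = ring_ideal.span {a * b | a b. a \<in> I \<and> b \<in> J}"

primrec ideal_power :: "'a::comm_ring_1 set \<Rightarrow> nat \<Rightarrow> 'a set" where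
  "ideal_power I 0 = UNIV"
| "ideal_power I (Suc m) = ideal_mult I (ideal_power I m)"


section \<open>Points of the projective plane\<close>

definition proportional :: "(3 \<Rightarrow> 'k::field) \<Rightarrow> (3 \<Rightarrow> 'k) \<Rightarrow> bool" where
  "proportional v w \<longleftrightarrow> v \<noteq> (\<lambda>_. 0) \<and> w \<noteq> (\<lambda>_. 0) \<and> (\<exists>c. c \<noteq> 0 \<and> w = (\<lambda>i. c * v i))"

lemma part_equivp_proportional: "part_equivp (proportional :: (3 \<Rightarrow> 'k::field) \<Rightarrow> _)"
proof (rule part_equivpI)
  have "(\<lambda>_. 1) \<noteq> (\<lambda>_::3. 0 :: 'k)"
    by (metis zero_neq_one)
  then have "proportional (\<lambda>_. 1) (\<lambda>_. 1 :: 'k)"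
    unfolding proportional_def by (intro conjI exI[of _ 1]) simp_all
  then show "\<exists>v :: 3 \<Rightarrow> 'k. proportional v v" by blast
  show "symp (proportional :: (3 \<Rightarrow> 'k) \<Rightarrow> _)"
  proof (rule sympI)
    fix v w :: "3 \<Rightarrow> 'k"
    assume "proportional v w"
    then obtain c where vw: "v \<noteq> (\<lambda>_. 0)" "w \<noteq> (\<lambda>_. 0)" and c: "c \<noteq> 0" and w: "w = (\<lambda>i. c * v i)"
      unfolding proportional_def by blast
    have "v = (\<lambda>i. inverse c * w i)"
      by (rule ext) (simp add: w c flip: mult.assoc)
    moreover have "inverse c \<noteq> 0" using c by simp
    ultimately show "proportional w v"
      unfolding proportional_def using vw by blast
  qed
  show "transp (proportional :: (3 \<Rightarrow> 'k) \<Rightarrow> _)"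
  proof (rule transpI)
    fix u v w :: "3 \<Rightarrow> 'k"
    assume "proportional u v" "proportional v w"
    then obtain c d where uw: "u \<noteq> (\<lambda>_. 0)" "w \<noteq> (\<lambda>_. 0)" and cd: "c \<noteq> 0" "d \<noteq> 0"
      and v: "v = (\<lambda>i. c * u i)" and w: "w = (\<lambda>i. d * v i)"
      unfolding proportional_def by blast
    have "w = (\<lambda>i. (d * c) * u i)"
      by (rule ext) (simp only: v w mult.assoc)
    moreover have "d * c \<noteq> 0" using cd by simp
    ultimately show "proportional u w"
      unfolding proportional_def using uw by blast
  qed
qed

quotient_type (overloaded) 'k proj_plane = "3 \<Rightarrow> 'k::field" / partial: proportional
  by (rule part_equivp_proportional)

text \<open>\<open>rep_proj_plane p\<close> is some choice of homogeneous coordinates of \<open>p\<close>. It is only used to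
  say that a (multi)homogeneous polynomial vanishes at \<open>p\<close>, which does not depend on the choice.\<close>

definition point_ideal :: "'k::field proj_plane \<Rightarrow> 'k ternary set" where
  "point_ideal p =
     ring_ideal.span {F. (\<exists>d. homogeneous d F) \<and> eval_mpoly (rep_proj_plane p) F = 0}"


section \<open>General points\<close>

definition point_tuples :: "nat \<Rightarrow> (nat \<Rightarrow> 'k::field proj_plane) set" where
  "point_tuples n = {..<n} \<rightarrow>\<^sub>E UNIV"

text \<open>The multihomogeneous coordinate ring of \<open>(P\<^sup>2)\<^sup>n\<close> has variables indexed by pairs \<open>(i, j)\<close> with
  \<open>i < n\<close>, the three variables \<open>(i, _)\<close> being the coordinates on the \<open>i\<close>-th factor. Variables with
  \<open>i \<ge> n\<close> do not occur.\<close>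

definition multihomogeneous :: "nat \<Rightarrow> (nat \<times> 3, 'k::zero) mpoly \<Rightarrow> bool" where
  "multihomogeneous n F \<longleftrightarrow>
     (\<exists>d. (\<forall>i\<ge>n. d i = 0) \<and>
          (\<forall>e\<in>Poly_Mapping.keys F. \<forall>i. (\<Sum>j\<in>UNIV. Poly_Mapping.lookup e (i, j)) = d i))"

definition eval_at_points ::
    "(nat \<Rightarrow> 'k::field proj_plane) \<Rightarrow> (nat \<times> 3, 'k) mpoly \<Rightarrow> 'k" where
  "eval_at_points p F = eval_mpoly (\<lambda>(i, j). rep_proj_plane (p i) j) F"

definition zariski_closed :: "nat \<Rightarrow> (nat \<Rightarrow> 'k::field proj_plane) set \<Rightarrow> bool" where
  "zariski_closed n Z \<longleftrightarrow>
     (\<exists>S. (\<forall>F\<in>S. multihomogeneous n F) \<and>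
          Z = {p \<in> point_tuples n. \<forall>F\<in>S. eval_at_points p F = 0})"

definition zariski_open :: "nat \<Rightarrow> (nat \<Rightarrow> 'k::field proj_plane) set \<Rightarrow> bool" where
  "zariski_open n U \<longleftrightarrow> U \<subseteq> point_tuples n \<and> zariski_closed n (point_tuples n - U)"

definition for_general_points :: "nat \<Rightarrow> ((nat \<Rightarrow> 'k::field proj_plane) \<Rightarrow> bool) \<Rightarrow> bool" where
  "for_general_points n Q \<longleftrightarrow> (\<exists>U. zariski_open n U \<and> U \<noteq> {} \<and> (\<forall>p\<in>U. Q p))"


section \<open>Ideals of fat points\<close>

text \<open>Points and multiplicities are indexed by \<open>0, \<dots>, n - 1\<close>.\<close>

definition fat_ideal ::
    "nat \<Rightarrow> (nat \<Rightarrow> nat) \<Rightarrow> (nat \<Rightarrow> 'k::field proj_plane) \<Rightarrow> 'k ternary set" where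
  "fat_ideal n m p = (\<Inter>i<n. ideal_power (point_ideal (p i)) (m i))"

definition graded_part :: "'k::field ternary set \<Rightarrow> nat \<Rightarrow> 'k ternary set" where
  "graded_part I t = {F \<in> I. homogeneous t F}"

definition hilbert :: "'k::field ternary set \<Rightarrow> nat \<Rightarrow> nat" where
  "hilbert I t = mpoly_space.dim (graded_part I t)"

definition unhindered ::
    "nat \<Rightarrow> (nat \<Rightarrow> nat) \<Rightarrow> (nat \<Rightarrow> 'k::field proj_plane) \<Rightarrow> bool" where
  "unhindered n m p \<longleftrightarrow>
     (\<forall>t. real (hilbert (fat_ideal n m p) t) =
        max 0 ((real ((t + 1) * (t + 2)) - (\<Sum>i<n. real (m i * (m i + 1)))) / 2))"

definition initial_degree :: "'k::field ternary set \<Rightarrow> nat" where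
  "initial_degree I = (LEAST t. graded_part I t \<noteq> {0})"

text \<open>A minimal graded free resolution \<open>0 \<rightarrow> F\<^sub>1 \<rightarrow> F\<^sub>0 \<rightarrow> I \<rightarrow> 0\<close> with \<open>F\<^sub>0 = \<Oplus>\<^sub>i\<^sub><\<^sub>r R(-a\<^sub>i)\<close> and
  \<open>F\<^sub>1 = \<Oplus>\<^sub>j\<^sub><\<^sub>s R(-b\<^sub>j)\<close>. The map \<open>F\<^sub>0 \<rightarrow> I\<close> is \<open>u \<mapsto> g \<bullet> u\<close> and the map \<open>F\<^sub>1 \<rightarrow> F\<^sub>0\<close> is the matrix \<open>M\<close>. The
  maps preserve degrees iff \<open>g\<^sub>i\<close> is homogeneous of degree \<open>a\<^sub>i\<close> and \<open>M\<^sub>i\<^sub>j\<close> is homogeneous of degree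
  \<open>b\<^sub>j - a\<^sub>i\<close> (so zero if \<open>b\<^sub>j < a\<^sub>i\<close>). Minimality means that the image of \<open>F\<^sub>1\<close> lies in
  \<open>(x,y,z) F\<^sub>0\<close>, where \<open>(x,y,z)\<close> consists of the polynomials without constant term.\<close>

definition min_graded_free_resolution ::
    "'k::field ternary set \<Rightarrow> nat \<Rightarrow> (nat \<Rightarrow> nat) \<Rightarrow> nat \<Rightarrow> (nat \<Rightarrow> nat) \<Rightarrow>
     'k ternary vec \<Rightarrow> 'k ternary mat \<Rightarrow> bool" where
  "min_graded_free_resolution I r a s b g M \<longleftrightarrow>
     g \<in> carrier_vec r \<and> M \<in> carrier_mat r s \<and>
     (\<forall>i<r. homogeneous (a i) (g $ i)) \<and>
     (\<forall>i<r. \<forall>j<s. \<forall>e\<in>Poly_Mapping.keys (M $$ (i, j)). exp_degree e + a i = b j) \<and>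
     (\<lambda>u. g \<bullet> u) ` carrier_vec r = I \<and>
     {u \<in> carrier_vec r. g \<bullet> u = 0} = (\<lambda>w. M *\<^sub>v w) ` carrier_vec s \<and>
     inj_on (\<lambda>w. M *\<^sub>v w) (carrier_vec s) \<and>
     (\<forall>w\<in>carrier_vec s. \<forall>i<r. Poly_Mapping.lookup ((M *\<^sub>v w) $ i) 0 = 0)"

definition rank_minimal ::
    "nat \<Rightarrow> (nat \<Rightarrow> nat) \<Rightarrow> (nat \<Rightarrow> 'k::field proj_plane) \<Rightarrow> bool" where
  "rank_minimal n m p \<longleftrightarrow>
     unhindered n m p \<and>
     (let I = fat_ideal n m p; \<alpha> = initial_degree I; h = hilbert I \<alpha> in
      \<exists>r a s b g M. min_graded_free_resolution I r a s b g M \<and>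
        int r = max (int h) (int \<alpha> + 2 - int h))"

definition uniform_mult :: "nat \<Rightarrow> nat \<Rightarrow> nat" where
  "uniform_mult m = (\<lambda>_. m)"

definition raised_mult :: "nat \<Rightarrow> nat \<Rightarrow> nat" where
  "raised_mult m = (\<lambda>_. m)(0 := m + 1)"

end

theory Submission
  imports "HOL-Analysis.Kronecker_Approximation_Theorem" Defs
begin

text \<open>Let \<open>I = I(m;n)\<close> be unhindered with initial degree \<open>\<alpha>\<close>. Then \<open>I\<close> is generated in degrees \<open>\<alpha>\<close> and \<open>\<alpha> + 1\<close>, so
  it is rank minimal iff the multiplication map \<open>\<mu> : I\<^sub>\<alpha> \<otimes> R\<^sub>1 \<rightarrow> I\<^sub>\<alpha>\<^sub>+\<^sub>1\<close> has maximal rank.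

  In (a) and (b), \<open>m\<close> is chosen such that \<open>dim I\<^sub>\<alpha> \<le> m + 1\<close>, hence \<open>I'\<^sub>\<alpha> = 0\<close>, also when another point \<open>v\<close> has the raised
  multiplicity. If \<open>x A + y B + z C = 0\<close> with \<open>A, B, C \<in> I\<^sub>\<alpha>\<close>, then \<open>v \<bullet> (A, B, C)\<close> vanishes to order \<open>m + 1\<close> at
  \<open>v\<close>, so it is zero. Two points \<open>v\<close> together with the syzygy itself give three independent linear
  equations for \<open>(A, B, C)\<close>. Hence \<open>\<mu>\<close> is injective.

  In (c), \<open>n = 4 q\<^sup>2\<close> and \<open>\<alpha> = q (2 m + 1) - 1\<close>, and \<open>\<mu>\<close> is surjective iff \<open>dim ker \<mu> \<le> q\<^sup>2 - 1\<close>. By semicontinuity it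
  suffices to find one configuration with this bound. Put \<open>2 q\<close> points on each of \<open>2 q\<close> lines with union
  \<open>C\<close>. The restriction of \<open>I\<^sub>\<alpha>\<close> to \<open>C\<close> consists of the sections of a sheaf of degree \<open>q - 1\<close> on each line. Letting
  suitable points tend to the nodes of \<open>C\<close>, this sheaf degenerates to the direct sum of the structure sheaves
  of \<open>q\<close> pairs of lines, on which linear syzygies are trivial. So \<open>C\<close> divides every syzygy, and by induction
  on \<open>m\<close> the syzygies are \<open>C\<^sup>m\<close> times the Koszul syzygies of degree \<open>q - 1\<close>, a space of dimension \<open>q\<^sup>2 - 1\<close>.\<close>

(* Otherwise the default simp set rewrites a * (b * x) to a * b * x and loops with mult.assoc. *)
declare ring_ideal.scale_scale [simp del]

text \<open>The obstacle to semicontinuity is that I_\<alpha> itself may jump at special points, so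
  ranks of \<mu> are not directly comparable between configurations. What is transported is a system
  with fixed unknowns, the coefficients of all triples of forms of degree \<alpha>: vanishing at the
  points, the syzygy equation, and q^2 - 1 functionals that do not involve the points. Having only
  the zero solution is an open condition on the points. The number q^2 - 1 is 3 dim I_\<alpha> - dim
  I_(\<alpha>+1), and also the dimension of the space of syzygies of x, y, z with entries of degree
  q - 1. The multiplicities come from completing squares: 4 ((t+1)(t+2) - n m (m+1)) = (2t+3)^2 - n
  (2m+1)^2 + n - 1 has to be positive and at most 8 (m+1). In (a), irrationality of sqrt n lets 2t+3
  exceed sqrt n (2m+1) by less than 1 / sqrt n for infinitely many m. In (b), 2t+3 = sqrt n (2m+1)
  exactly, and n - 1 \<le> 8 (m+1) is the stated bound. In (c) the bound says q \<le> 2m+1, which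
  fixes the least degree.\<close>

section \<open>Polynomials\<close>

lemma UNIV_3: "(UNIV :: 3 set) = {0, 1, 2}"
proof -
  have "card ({0, 1, 2} :: 3 set) = CARD(3)" by simp
  then show ?thesis by (metis card_subset_eq finite subset_UNIV)
qed

lemma forall_3: "(\<forall>i::3. P i) \<longleftrightarrow> P 0 \<and> P 1 \<and> P 2"
  by (metis UNIV_3 UNIV_I empty_iff insert_iff)

lemma three_neq [simp]: "(0::3) \<noteq> 1" "(0::3) \<noteq> 2" "(1::3) \<noteq> 2" "(1::3) \<noteq> 0" "(2::3) \<noteq> 0" "(2::3) \<noteq> 1"
  by simp_all

lemma sum_UNIV_3: "(\<Sum>i\<in>UNIV. f (i::3)) = f 0 + f 1 + f 2"
proof -
  have "f 0 + (f 1 + f 2) = f 0 + f 1 + f 2" by (simp add: add.assoc)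
  moreover have "sum f {0, 1, 2} = f 0 + (f 1 + f 2)"
    by (subst sum.insert; simp)+
  ultimately show ?thesis by (simp only: UNIV_3)
qed

lemma prod_UNIV_3: "(\<Prod>i\<in>UNIV. f (i::3)) = f 0 * f 1 * f 2"
proof -
  have "f 0 * (f 1 * f 2) = f 0 * f 1 * f 2" by (simp add: mult.assoc)
  moreover have "prod f {0, 1, 2} = f 0 * (f 1 * f 2)"
    by (subst prod.insert; simp)+
  ultimately show ?thesis by (simp only: UNIV_3)
qed

lemma keys_eq_empty_iff: "Poly_Mapping.keys F = {} \<longleftrightarrow> F = 0"
  by (metis keys_zero in_keys_iff empty_iff lookup_zero poly_mapping_eqI)

lemma poly_mapping_sum_single: "F = (\<Sum>e\<in>Poly_Mapping.keys F. Poly_Mapping.single e (Poly_Mapping.lookup F e))"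
proof (rule poly_mapping_eqI)
  fix k
  have "(\<Sum>e\<in>Poly_Mapping.keys F. (Poly_Mapping.lookup F e when e = k))
      = (\<Sum>e\<in>Poly_Mapping.keys F. if e = k then Poly_Mapping.lookup F e else 0)"
    by (simp add: when_def)
  then show "Poly_Mapping.lookup F k =
      Poly_Mapping.lookup (\<Sum>e\<in>Poly_Mapping.keys F. Poly_Mapping.single e (Poly_Mapping.lookup F e)) k"
    by (auto simp: lookup_sum lookup_single in_keys_iff sum.delta when_def)
qed

section \<open>Monomials and substitution homomorphisms\<close>

definition mon_val :: "('v \<Rightarrow> 'a::comm_semiring_1) \<Rightarrow> ('v \<Rightarrow>\<^sub>0 nat) \<Rightarrow> 'a" where
  "mon_val v e = (\<Prod>x\<in>Poly_Mapping.keys e. v x ^ Poly_Mapping.lookup e x)"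

lemma mon_val_superset:
  "finite S \<Longrightarrow> Poly_Mapping.keys e \<subseteq> S \<Longrightarrow> mon_val v e = (\<Prod>x\<in>S. v x ^ Poly_Mapping.lookup e x)"
  unfolding mon_val_def by (rule prod.mono_neutral_left) (auto simp: in_keys_iff)

lemma mon_val_0 [simp]: "mon_val v 0 = 1"
  by (simp add: mon_val_def)

lemma mon_val_single [simp]: "mon_val v (Poly_Mapping.single x k) = v x ^ k"
  by (subst mon_val_superset[of "{x}"]) auto

lemma mon_val_add: "mon_val v (e + f) = mon_val v e * mon_val v f"
proof -
  let ?S = "Poly_Mapping.keys e \<union> Poly_Mapping.keys f"
  have "mon_val v (e + f) = (\<Prod>x\<in>?S. v x ^ Poly_Mapping.lookup (e + f) x)"
    by (rule mon_val_superset) (simp_all add: keys_add)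
  also have "\<dots> = (\<Prod>x\<in>?S. v x ^ Poly_Mapping.lookup e x) * (\<Prod>x\<in>?S. v x ^ Poly_Mapping.lookup f x)"
    by (simp add: lookup_add power_add prod.distrib)
  also have "\<dots> = mon_val v e * mon_val v f"
    by (simp add: mon_val_superset[of ?S])
  finally show ?thesis .
qed

text \<open>The coefficient map is a parameter so that one development serves both evaluation in the
  field (identity map) and restriction to a parametrized line (coefficients become constant
  polynomials in the line parameter).\<close>

definition subst :: "('k::zero \<Rightarrow> 'a::comm_semiring_1) \<Rightarrow> ('v \<Rightarrow> 'a) \<Rightarrow> ('v, 'k) mpoly \<Rightarrow> 'a" where
  "subst \<phi> v F = (\<Sum>e\<in>Poly_Mapping.keys F. \<phi> (Poly_Mapping.lookup F e) * mon_val v e)"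

lemma eval_mpoly_eq_subst: "eval_mpoly v F = subst (\<lambda>c. c) v F"
  by (simp add: eval_mpoly_def subst_def mon_val_def)

definition coeff_hom :: "('k::comm_ring_1 \<Rightarrow> 'a::comm_ring_1) \<Rightarrow> bool" where
  "coeff_hom \<phi> \<longleftrightarrow> \<phi> 1 = 1 \<and> (\<forall>a b. \<phi> (a + b) = \<phi> a + \<phi> b) \<and> (\<forall>a b. \<phi> (a * b) = \<phi> a * \<phi> b)"

lemma coeff_homD:
  assumes "coeff_hom \<phi>"
  shows "\<phi> 0 = 0" "\<phi> 1 = 1" "\<phi> (a + b) = \<phi> a + \<phi> b" "\<phi> (a * b) = \<phi> a * \<phi> b"
  using assms unfolding coeff_hom_def by (auto, metis add_cancel_right_left)

lemma coeff_hom_id [simp]: "coeff_hom (\<lambda>c. c)"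
  by (simp add: coeff_hom_def)

lemma coeff_hom_pconst [simp]: "coeff_hom (\<lambda>c. [:c:])"
  by (simp add: coeff_hom_def)

lemma subst_superset:
  assumes "coeff_hom \<phi>" "finite S" "Poly_Mapping.keys F \<subseteq> S"
  shows "subst \<phi> v F = (\<Sum>e\<in>S. \<phi> (Poly_Mapping.lookup F e) * mon_val v e)"
  unfolding subst_def by (rule sum.mono_neutral_left) (use assms in \<open>auto simp: in_keys_iff coeff_homD\<close>)

lemma subst_0 [simp]: "subst \<phi> v 0 = 0"
  by (simp add: subst_def)

lemma subst_single: "coeff_hom \<phi> \<Longrightarrow> subst \<phi> v (Poly_Mapping.single e c) = \<phi> c * mon_val v e"
  by (subst subst_superset[of _ "{e}"]) auto

lemma subst_add: 
  assumes "coeff_hom \<phi>" shows "subst \<phi> v (F + G) = subst \<phi> v F + subst \<phi> v G"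
proof -
  let ?S = "Poly_Mapping.keys F \<union> Poly_Mapping.keys G"
  have "subst \<phi> v (F + G) = (\<Sum>e\<in>?S. \<phi> (Poly_Mapping.lookup (F + G) e) * mon_val v e)"
    by (rule subst_superset) (simp_all add: keys_add assms)
  also have "\<dots> = subst \<phi> v F + subst \<phi> v G"
    by (simp add: subst_superset[OF assms, of ?S] lookup_add coeff_homD[OF assms] distrib_right sum.distrib)
  finally show ?thesis .
qed

lemma subst_sum: 
  assumes "coeff_hom \<phi>" shows "subst \<phi> v (\<Sum>i\<in>A. f i) = (\<Sum>i\<in>A. subst \<phi> v (f i))"
  by (induction A rule: infinite_finite_induct) (simp_all add: subst_add[OF assms])

lemma subst_mult: 
  assumes "coeff_hom \<phi>" shows "subst \<phi> v (F * G) = subst \<phi> v F * subst \<phi> v G"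
proof -
  have "F * G = (\<Sum>e\<in>Poly_Mapping.keys F. \<Sum>f\<in>Poly_Mapping.keys G.
      Poly_Mapping.single (e + f) (Poly_Mapping.lookup F e * Poly_Mapping.lookup G f))"
  proof -
    have "F * G = (\<Sum>e\<in>Poly_Mapping.keys F. Poly_Mapping.single e (Poly_Mapping.lookup F e)) *
        (\<Sum>e\<in>Poly_Mapping.keys G. Poly_Mapping.single e (Poly_Mapping.lookup G e))"
      by (simp flip: poly_mapping_sum_single)
    then show ?thesis by (simp only: sum_product mult_single)
  qed
  then have "subst \<phi> v (F * G) = (\<Sum>e\<in>Poly_Mapping.keys F. \<Sum>f\<in>Poly_Mapping.keys G.
      (\<phi> (Poly_Mapping.lookup F e) * mon_val v e) * (\<phi> (Poly_Mapping.lookup G f) * mon_val v f))"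
    by (simp only: subst_sum[OF assms] subst_single[OF assms] coeff_homD(4)[OF assms] mon_val_add)
      (intro sum.cong refl, simp only: mult_ac)
  then show ?thesis by (simp add: subst_def sum_product)
qed

lemma subst_1: "coeff_hom \<phi> \<Longrightarrow> subst \<phi> v 1 = 1"
  by (simp add: subst_single coeff_homD flip: single_one)

lemma subst_uminus: 
  assumes "coeff_hom \<phi>" shows "subst \<phi> v (- F) = - subst \<phi> v F"
  using subst_add[OF assms, of v F "- F"] by (simp add: eq_neg_iff_add_eq_0 add.commute)

lemma subst_diff: 
  assumes "coeff_hom \<phi>" shows "subst \<phi> v (F - G) = subst \<phi> v F - subst \<phi> v G"
  using subst_add[OF assms, of v F "- G"] by (simp add: subst_uminus[OF assms])

lemma subst_power: "coeff_hom \<phi> \<Longrightarrow> subst \<phi> v (F ^ k) = subst \<phi> v F ^ k"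
  by (induction k) (simp_all add: subst_1 subst_mult)

lemma subst_prod: "coeff_hom \<phi> \<Longrightarrow> subst \<phi> v (\<Prod>i\<in>A. f i) = (\<Prod>i\<in>A. subst \<phi> v (f i))"
  by (induction A rule: infinite_finite_induct) (simp_all add: subst_1 subst_mult)

section \<open>Constants and variables\<close>

definition const :: "'k::zero \<Rightarrow> ('v, 'k) mpoly" where
  "const c = Poly_Mapping.single 0 c"

definition Var :: "'v \<Rightarrow> ('v, 'k::zero_neq_one) mpoly" where
  "Var i = Poly_Mapping.single (Poly_Mapping.single i 1) 1"

lemma scale_mpoly_const: "scale_mpoly c F = const c * F"
  by (simp add: scale_mpoly_def const_def)

lemma const_simps [simp]: 
  "const 0 = (0 :: ('v, 'k::comm_ring_1) mpoly)" "const 1 = (1 :: ('v, 'k) mpoly)"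
  by (simp_all add: const_def)

lemma const_hom:
  "const (a + b) = (const a + const b :: ('v, 'k::comm_ring_1) mpoly)"
  "const (a * b) = (const a * const b :: ('v, 'k) mpoly)"
  "const (a - b) = (const a - const b :: ('v, 'k) mpoly)"
  "const (- a) = (- const a :: ('v, 'k) mpoly)"
  by (simp_all add: const_def single_add mult_single single_diff single_uminus)

lemma subst_const: "coeff_hom \<phi> \<Longrightarrow> subst \<phi> v (const c) = \<phi> c"
  by (simp add: const_def subst_single)

lemma subst_Var: "coeff_hom \<phi> \<Longrightarrow> subst \<phi> v (Var i) = v i"
  by (simp add: Var_def subst_single coeff_homD)

lemma lookup_const_mult: "Poly_Mapping.lookup (const c * F) e = c * Poly_Mapping.lookup F e"
  for F :: "('v, 'k::comm_ring_1) mpoly"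
proof -
  have "const c * F = Poly_Mapping.map ((*) c) F"
    by (simp add: const_def mult_map_scale_conv_mult)
  then show ?thesis by (simp add: map.rep_eq when_def)
qed

lemma lookup_single_mult_add:
  "Poly_Mapping.lookup (Poly_Mapping.single f c * F) (f + e) = c * Poly_Mapping.lookup F e"
  for F :: "('v, 'k::comm_ring_1) mpoly"
proof -
  have "Poly_Mapping.single f c * F = (\<Sum>e\<in>Poly_Mapping.keys F. Poly_Mapping.single (f + e) (c * Poly_Mapping.lookup F e))"
    by (subst (1) poly_mapping_sum_single[of F]) (simp add: sum_distrib_left mult_single)
  then have "Poly_Mapping.lookup (Poly_Mapping.single f c * F) (f + e) =
      (\<Sum>e'\<in>Poly_Mapping.keys F. if e' = e then c * Poly_Mapping.lookup F e' else 0)"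
    by (simp add: lookup_sum lookup_single when_def)
  then show ?thesis by (auto simp: in_keys_iff)
qed

subsection \<open>Homogeneous polynomials\<close>

lemma exp_degree_add: "exp_degree (e + f) = exp_degree e + exp_degree f"
  by (simp add: exp_degree_def lookup_add sum.distrib)

lemma exp_degree_0 [simp]: "exp_degree 0 = 0"
  by (simp add: exp_degree_def)

lemma exp_degree_single [simp]: "exp_degree (Poly_Mapping.single i k) = k"
  by (simp add: exp_degree_def lookup_single when_def)

lemma exp_degree_eq_0: "exp_degree e = 0 \<longleftrightarrow> e = 0"
  by (auto simp: exp_degree_def intro: poly_mapping_eqI)

lemma homogeneous_0 [simp]: "homogeneous d 0"
  by (simp add: homogeneous_def)

lemma homogeneous_lookup: "homogeneous d F \<Longrightarrow> exp_degree e \<noteq> d \<Longrightarrow> Poly_Mapping.lookup F e = 0"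
  by (meson homogeneous_def in_keys_iff)

lemma homogeneousI: "(\<And>e. exp_degree e \<noteq> d \<Longrightarrow> Poly_Mapping.lookup F e = 0) \<Longrightarrow> homogeneous d F"
  by (metis homogeneous_def in_keys_iff)

lemma homogeneous_add: "homogeneous d F \<Longrightarrow> homogeneous d G \<Longrightarrow> homogeneous d (F + G)"
  by (rule homogeneousI) (simp add: lookup_add homogeneous_lookup)

lemma homogeneous_diff:
  "homogeneous d F \<Longrightarrow> homogeneous d G \<Longrightarrow> homogeneous d (F - G :: ('v::finite, 'k::comm_ring_1) mpoly)"
  by (rule homogeneousI) (simp add: lookup_minus homogeneous_lookup)

lemma homogeneous_sum: "(\<And>i. i \<in> A \<Longrightarrow> homogeneous d (f i)) \<Longrightarrow> homogeneous d (\<Sum>i\<in>A. f i)"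
  by (induction A rule: infinite_finite_induct) (auto intro: homogeneous_add)

lemma homogeneous_mult: 
  "homogeneous a F \<Longrightarrow> homogeneous b G \<Longrightarrow> homogeneous (a + b) (F * G :: ('v::finite, 'k::comm_ring_1) mpoly)"
  unfolding homogeneous_def
proof
  fix e assume *: "\<forall>e\<in>Poly_Mapping.keys F. exp_degree e = a" "\<forall>e\<in>Poly_Mapping.keys G. exp_degree e = b"
    and "e \<in> Poly_Mapping.keys (F * G)"
  then obtain f g where "e = f + g" "f \<in> Poly_Mapping.keys F" "g \<in> Poly_Mapping.keys G"
    using keys_mult by blast
  with * show "exp_degree e = a + b" by (simp add: exp_degree_add)
qed

lemma homogeneous_const [simp]: "homogeneous 0 (const c)"
  by (simp add: homogeneous_def const_def)

lemma homogeneous_const_mult: "homogeneous d F \<Longrightarrow> homogeneous d (const c * F :: ('v::finite, 'k::comm_ring_1) mpoly)"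
  using homogeneous_mult[OF homogeneous_const] by fastforce

lemma homogeneous_Var [simp]: "homogeneous 1 (Var i)" "homogeneous (Suc 0) (Var i)"
  by (simp_all add: homogeneous_def Var_def)

lemma homogeneous_Var_mult:
  "homogeneous d F \<Longrightarrow> homogeneous (Suc d) (Var i * F :: ('v::finite, 'k::comm_ring_1) mpoly)"
  using homogeneous_mult[of 1 "Var i" d F] by simp

lemma homogeneous_1 [simp]: "homogeneous 0 (1 :: ('v::finite, 'k::comm_ring_1) mpoly)"
  by (metis const_simps(2) homogeneous_const)

lemma homogeneous_power: 
  "homogeneous a F \<Longrightarrow> homogeneous (k * a) (F ^ k :: ('v::finite, 'k::comm_ring_1) mpoly)"
  by (induction k) (auto intro: homogeneous_mult)

lemma homogeneous_0_const: "homogeneous 0 F \<Longrightarrow> F = const (Poly_Mapping.lookup F 0)"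
  by (rule poly_mapping_eqI)
    (auto simp: const_def lookup_single when_def homogeneous_lookup exp_degree_eq_0)

section \<open>Homogeneous components\<close>

definition hcomp :: "nat \<Rightarrow> ('v::finite, 'k::comm_ring_1) mpoly \<Rightarrow> ('v, 'k) mpoly" where
  "hcomp d F = (\<Sum>e\<in>{e \<in> Poly_Mapping.keys F. exp_degree e = d}. Poly_Mapping.single e (Poly_Mapping.lookup F e))"

lemma lookup_hcomp: "Poly_Mapping.lookup (hcomp d F) e = (if exp_degree e = d then Poly_Mapping.lookup F e else 0)"
proof -
  have "Poly_Mapping.lookup (hcomp d F) e =
    (\<Sum>e'\<in>{e \<in> Poly_Mapping.keys F. exp_degree e = d}. if e' = e then Poly_Mapping.lookup F e' else 0)"
    by (simp add: hcomp_def lookup_sum lookup_single when_def)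
  also have "\<dots> = (if exp_degree e = d then Poly_Mapping.lookup F e else 0)"
    by (subst sum.delta) (auto simp: in_keys_iff)
  finally show ?thesis .
qed

lemma homogeneous_hcomp [simp]: "homogeneous d (hcomp d F)"
  by (rule homogeneousI) (simp add: lookup_hcomp)

lemma hcomp_add: "hcomp d (F + G) = hcomp d F + hcomp d G"
  by (rule poly_mapping_eqI) (simp add: lookup_hcomp lookup_add)

lemma hcomp_0 [simp]: "hcomp d 0 = 0"
  by (rule poly_mapping_eqI) (simp add: lookup_hcomp)

lemma hcomp_sum: "hcomp d (\<Sum>i\<in>A. f i) = (\<Sum>i\<in>A. hcomp d (f i))"
  by (induction A rule: infinite_finite_induct) (simp_all add: hcomp_add)

lemma hcomp_homogeneous: "homogeneous d F \<Longrightarrow> hcomp e F = (if e = d then F else 0)"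
  by (auto intro!: poly_mapping_eqI simp: lookup_hcomp homogeneous_lookup)

lemma hcomp_sum_le:
  assumes "\<And>e. e \<in> Poly_Mapping.keys F \<Longrightarrow> exp_degree e \<le> N"
  shows "F = (\<Sum>d\<le>N. hcomp d F)"
proof (rule poly_mapping_eqI)
  fix e
  show "Poly_Mapping.lookup F e = Poly_Mapping.lookup (\<Sum>d\<le>N. hcomp d F) e"
    using assms by (auto simp: lookup_sum lookup_hcomp in_keys_iff)
qed

lemma hcomp_bound: obtains N where "F = (\<Sum>d\<le>N. hcomp d F)" 
proof -
  have "F = (\<Sum>d\<le>Max (insert 0 (exp_degree ` Poly_Mapping.keys F)). hcomp d F)"
    by (rule hcomp_sum_le) auto
  then show ?thesis using that by blast
qed

lemma hcomp_mult_homogeneous: 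
  assumes "homogeneous a F"
  shows "hcomp d (F * G) = (if a \<le> d then F * hcomp (d - a) G else 0)"
proof -
  obtain N where N: "G = (\<Sum>b\<le>N. hcomp b G)" by (rule hcomp_bound)
  have "hcomp d (F * G) = (\<Sum>b\<le>N. hcomp d (F * hcomp b G))"
    by (subst N) (simp add: sum_distrib_left hcomp_sum)
  also have "\<dots> = (\<Sum>b\<le>N. if b = d - a \<and> a \<le> d then F * hcomp b G else 0)"
    by (rule sum.cong[OF refl], subst hcomp_homogeneous[OF homogeneous_mult[OF assms homogeneous_hcomp]]) auto
  also have "\<dots> = (if a \<le> d \<and> d - a \<le> N then F * hcomp (d - a) G else 0)"
    by (auto simp: sum.delta)
  also have "\<dots> = (if a \<le> d then F * hcomp (d - a) G else 0)"
  proof (cases "d - a \<le> N")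
    case False
    have "hcomp (d - a) G = (\<Sum>b\<le>N. hcomp (d - a) (hcomp b G))"
      by (subst N) (simp add: hcomp_sum)
    also have "\<dots> = 0"
      by (rule sum.neutral) (use False in \<open>auto simp: hcomp_homogeneous[OF homogeneous_hcomp]\<close>)
    finally show ?thesis using False by simp
  qed simp
  finally show ?thesis .
qed

lemma exponent_induct [case_names zero add]:
  assumes "P 0" "\<And>e i. P e \<Longrightarrow> P (Poly_Mapping.single i 1 + e)"
  shows "P (e :: 'v::finite \<Rightarrow>\<^sub>0 nat)"
proof (induction "exp_degree e" arbitrary: e)
  case 0
  then show ?case using assms(1) exp_degree_eq_0 by metis
next
  case (Suc d)
  then obtain i where i: "Poly_Mapping.lookup e i > 0"
    by (metis exp_degree_def sum.neutral gr0I nat.distinct(1))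
  define e' where "e' = e - Poly_Mapping.single i 1"
  have e: "e = Poly_Mapping.single i 1 + e'"
    by (rule poly_mapping_eqI) (use i in \<open>auto simp: e'_def lookup_add lookup_minus lookup_single when_def\<close>)
  then have "exp_degree e' = d" using Suc.hyps(2) exp_degree_add[of "Poly_Mapping.single i 1" e'] by simp
  then show ?case using Suc.hyps(1) e assms(2) by metis
qed

lemma single_Var_step:
  "Poly_Mapping.single (Poly_Mapping.single i 1 + e) 1 = (Var i * Poly_Mapping.single e 1 :: ('v, 'k::comm_ring_1) mpoly)"
  by (simp add: Var_def mult_single)

section \<open>Spans and linear changes of coordinates\<close>

lemma span_finite_family:
  assumes "finite T" "x \<in> mpoly_space.span (f ` T)"
  shows "\<exists>c. x = (\<Sum>t\<in>T. const (c t) * f t)"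
  using assms(2)
proof (induction rule: mpoly_space.span_induct_alt)
  case base
  show ?case by (rule exI[of _ "\<lambda>_. 0"]) simp
next
  case (step c x y)
  then obtain t d where t: "t \<in> T" "x = f t" and y: "y = (\<Sum>t\<in>T. const (d t) * f t)" by auto
  have "(\<Sum>s\<in>T. const (if s = t then c else 0) * f s) = (\<Sum>s\<in>T. if s = t then const c * f s else 0)"
    by (rule sum.cong) auto
  also have "\<dots> = const c * x" using t assms(1) by simp
  finally have "scale_mpoly c x + y = (\<Sum>s\<in>T. const ((if s = t then c else 0) + d s) * f s)"
    by (simp add: y scale_mpoly_const const_hom(1) distrib_right sum.distrib)
  then show ?case by (rule exI[of _ "\<lambda>s. (if s = t then c else 0) + d s"])
qed

lemma subspace_const_mult: "mpoly_space.subspace S \<Longrightarrow> F \<in> S \<Longrightarrow> const c * F \<in> S"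
  using mpoly_space.subspace_scale by (metis scale_mpoly_const)

lemma span_const_mult: "F \<in> mpoly_space.span S \<Longrightarrow> const c * F \<in> mpoly_space.span S"
  using mpoly_space.span_scale by (metis scale_mpoly_const)

lemma subspace_homogeneous: "mpoly_space.subspace {F :: ('v::finite, 'k::field) mpoly. homogeneous d F}"
  by (rule mpoly_space.subspaceI) (auto intro: homogeneous_add homogeneous_const_mult simp: scale_mpoly_const)

lemma span_mult_closed:
  assumes "F \<in> mpoly_space.span S" "\<And>G. G \<in> S \<Longrightarrow> A * G \<in> mpoly_space.span S'"
  shows "A * F \<in> mpoly_space.span S'"
  using assms(1)
proof (induction rule: mpoly_space.span_induct_alt)
  case base
  show ?case by (simp add: mpoly_space.span_zero)
next
  case (step c x y)
  have "A * (scale_mpoly c x + y) = const c * (A * x) + A * y"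
    by (simp add: distrib_left scale_mpoly_const mult.left_commute)
  then show ?case
    using mpoly_space.span_add[OF span_const_mult[OF assms(2)[OF step(1)]] step(2)] by simp
qed

text \<open>This replaces a linear change of coordinates. Multiplication by \<open>A\<close>,
  \<open>B\<close> and \<open>D\<close>, hence by every variable, sends the span of the degree d
  monomials in them to that of degree d + 1, so induction on exponents reaches every monomial. It is
  applied with coordinates adapted to a point and with coordinates adapted to a line.\<close>

lemma homogeneous_linear_basis:
  fixes F A B D :: "'k::field ternary"
  assumes lin: "\<And>i. \<exists>a b c. Var i = const a * A + const b * B + const c * D"
    and F: "homogeneous d F"
  shows "\<exists>q. F = (\<Sum>(i,j)\<in>{(i,j). i + j \<le> d}. const (q i j) * (A ^ i * B ^ j * D ^ (d - i - j)))"
proof -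
  define T where "T d = {A ^ i * B ^ j * D ^ k | i j k. i + j + k = d}" for d
  have T_I: "A ^ i * B ^ j * D ^ k \<in> T d" if "i + j + k = d" for i j k d
    unfolding T_def using that by blast
  have ABD: "A * F \<in> mpoly_space.span (T (Suc d))" "B * F \<in> mpoly_space.span (T (Suc d))" 
    "D * F \<in> mpoly_space.span (T (Suc d))" if "F \<in> mpoly_space.span (T d)" for F d
  proof -
    have *: "A * G \<in> T (Suc d)" "B * G \<in> T (Suc d)" "D * G \<in> T (Suc d)" if G: "G \<in> T d" for G
    proof -
      obtain i j k where "G = A ^ i * B ^ j * D ^ k" "i + j + k = d" using G by (auto simp: T_def)
      then have eqs: "A * G = A ^ Suc i * B ^ j * D ^ k" "B * G = A ^ i * B ^ Suc j * D ^ k" 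
        "D * G = A ^ i * B ^ j * D ^ Suc k" and "i + j + k = d"
        by (simp_all only: power_Suc mult_ac)
      then show "A * G \<in> T (Suc d)" "B * G \<in> T (Suc d)" "D * G \<in> T (Suc d)"
        unfolding eqs by (intro T_I; simp)+
    qed
    then show "A * F \<in> mpoly_space.span (T (Suc d))" "B * F \<in> mpoly_space.span (T (Suc d))" 
      "D * F \<in> mpoly_space.span (T (Suc d))"
      by - (rule span_mult_closed[OF that], rule mpoly_space.span_base, erule *)+
  qed
  have Var: "Var i * F \<in> mpoly_space.span (T (Suc d))" if "F \<in> mpoly_space.span (T d)" for F d i
  proof -
    obtain a b c where "Var i = const a * A + const b * B + const c * D" using lin by metis
    then have eq: "Var i * F = const a * (A * F) + const b * (B * F) + const c * (D * F)"
      by (simp only: distrib_right mult.assoc)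
    show ?thesis unfolding eq by (intro mpoly_space.span_add span_const_mult ABD that)
  qed
  have mono: "Poly_Mapping.single e 1 \<in> mpoly_space.span (T (exp_degree e))" for e :: "3 \<Rightarrow>\<^sub>0 nat"
  proof (induction e rule: exponent_induct)
    case zero
    have "(1 :: 'k ternary) \<in> T 0" by (simp add: T_def)
    then show ?case by (simp add: mpoly_space.span_base)
  next
    case (add e i)
    have "exp_degree (Poly_Mapping.single i 1 + e) = Suc (exp_degree e)" by (simp add: exp_degree_add)
    then show ?case using Var[OF add, of i] by (simp only: single_Var_step)
  qed
  have "F \<in> mpoly_space.span (T d)"
  proof (subst poly_mapping_sum_single[of F], rule mpoly_space.span_sum)
    fix e assume "e \<in> Poly_Mapping.keys F"
    then have "exp_degree e = d" using F by (simp add: homogeneous_def)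
    moreover have "Poly_Mapping.single e (Poly_Mapping.lookup F e) = const (Poly_Mapping.lookup F e) * Poly_Mapping.single e 1"
      by (simp add: const_def mult_single)
    ultimately show "Poly_Mapping.single e (Poly_Mapping.lookup F e) \<in> mpoly_space.span (T d)"
      using mono[of e] by (simp add: span_const_mult)
  qed
  moreover have "T d \<subseteq> (\<lambda>(i,j). A ^ i * B ^ j * D ^ (d - i - j)) ` {(i,j). i + j \<le> d}"
  proof
    fix G assume "G \<in> T d"
    then obtain i j k where "G = A ^ i * B ^ j * D ^ k" "i + j + k = d" unfolding T_def by blast
    then show "G \<in> (\<lambda>(i,j). A ^ i * B ^ j * D ^ (d - i - j)) ` {(i,j). i + j \<le> d}"
      by (intro image_eqI[of _ _ "(i, j)"]) auto
  qed
  ultimately have "F \<in> mpoly_space.span ((\<lambda>(i,j). A ^ i * B ^ j * D ^ (d - i - j)) ` {(i,j). i + j \<le> d})"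
    using mpoly_space.span_mono by blast
  moreover have "finite {(i,j). i + j \<le> d}"
    by (rule finite_subset[of _ "{..d} \<times> {..d}"]) auto
  ultimately obtain c where "F = (\<Sum>t\<in>{(i,j). i + j \<le> d}. const (c t) * (case t of (i,j) \<Rightarrow> A ^ i * B ^ j * D ^ (d - i - j)))"
    using span_finite_family by blast
  then show ?thesis
    by (intro exI[of _ "\<lambda>i j. c (i, j)"]) (simp add: case_prod_unfold)
qed

section \<open>Order of vanishing\<close>

text \<open>Over a finite field, 1 plus the product of all X - a would have no root.\<close>

lemma infinite_UNIV_alg_closed: "infinite (UNIV :: 'k::alg_closed_field set)"
proof
  assume fin: "finite (UNIV :: 'k set)"
  define p where "p = 1 + (\<Prod>a\<in>(UNIV :: 'k set). [:- a, 1:])"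
  have "degree (\<Prod>a\<in>(UNIV :: 'k set). [:- a, 1:]) = card (UNIV :: 'k set)"
    by (subst degree_prod_eq_sum_degree) auto
  then have "degree p > 0"
    unfolding p_def using fin by (subst degree_add_eq_right) (auto simp: card_gt_0_iff)
  then obtain x where "poly p x = 0" using alg_closed_imp_poly_has_root by blast
  moreover have "poly (\<Prod>a\<in>(UNIV :: 'k set). [:- a, 1:]) x = 0"
    by (simp add: poly_prod fin prod_zero_iff)
  ultimately show False by (simp add: p_def)
qed

lemma poly_eq_0_cofinite:
  assumes "finite B" "\<And>x. x \<notin> B \<Longrightarrow> poly p x = 0"
  shows "p = (0 :: 'k::alg_closed_field poly)"
proof (rule ccontr)
  assume "p \<noteq> 0"
  then have "finite {x. poly p x = 0}" by (rule poly_roots_finite)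
  moreover have "UNIV \<subseteq> {x. poly p x = 0} \<union> B" using assms by auto
  ultimately show False using assms infinite_UNIV_alg_closed by (meson finite_Un finite_subset)
qed

lemma hom_mon_val: 
  assumes "coeff_hom \<psi>" shows "\<psi> (mon_val v e) = mon_val (\<lambda>x. \<psi> (v x)) e"
proof -
  have pow: "\<psi> (a ^ k) = \<psi> a ^ k" for a k by (induction k) (simp_all add: coeff_homD[OF assms])
  have "\<psi> (\<Prod>x\<in>S. v x ^ Poly_Mapping.lookup e x) = (\<Prod>x\<in>S. \<psi> (v x) ^ Poly_Mapping.lookup e x)" for S
    by (induction S rule: infinite_finite_induct) (simp_all add: coeff_homD[OF assms] pow)
  then show ?thesis by (simp add: mon_val_def)
qed

lemma hom_subst: 
  fixes v :: "'v \<Rightarrow> 'b::comm_ring_1" and \<psi> :: "'b \<Rightarrow> 'c::comm_ring_1" and F :: "('v, 'k::zero) mpoly"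
  assumes "coeff_hom \<psi>" 
  shows "\<psi> (subst \<phi> v F) = subst (\<lambda>c. \<psi> (\<phi> c)) (\<lambda>x. \<psi> (v x)) F"
proof -
  have "\<psi> (\<Sum>e\<in>S. f e) = (\<Sum>e\<in>S. \<psi> (f e))" for f :: "('v \<Rightarrow>\<^sub>0 nat) \<Rightarrow> 'b" and S
    by (induction S rule: infinite_finite_induct) (simp_all add: coeff_homD[OF assms])
  then show ?thesis by (simp add: subst_def coeff_homD[OF assms] hom_mon_val[OF assms])
qed

lemma coeff_hom_poly: "coeff_hom (\<lambda>p. poly p t)"
  by (simp add: coeff_hom_def)

lemma mon_val_scale: "mon_val (\<lambda>x. c * v x) e = c ^ exp_degree e * mon_val v (e :: 'v::finite \<Rightarrow>\<^sub>0 nat)"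
  by (simp add: mon_val_superset[of UNIV] power_mult_distrib prod.distrib exp_degree_def power_sum)

lemma subst_scale_homogeneous:
  fixes F :: "('v::finite, 'k::comm_ring_1) mpoly"
  assumes "homogeneous d F"
  shows "subst \<phi> (\<lambda>x. c * v x) F = c ^ d * subst \<phi> v F"
  using assms unfolding subst_def homogeneous_def
  by (auto simp: mon_val_scale sum_distrib_left mult_ac intro!: sum.cong)

text \<open>The polynomial F(v + t w) in t: its coefficients play the role of Taylor coefficients at
  v and make sense in every characteristic.\<close>

definition line_val :: "(3 \<Rightarrow> 'k::comm_ring_1) \<Rightarrow> (3 \<Rightarrow> 'k) \<Rightarrow> 'k ternary \<Rightarrow> 'k poly" where
  "line_val v w = subst (\<lambda>c. [:c:]) (\<lambda>i. [:v i, w i:])"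

lemmas line_val_simps =
  subst_0 subst_add[OF coeff_hom_pconst] subst_sum[OF coeff_hom_pconst] subst_mult[OF coeff_hom_pconst] 
  subst_1[OF coeff_hom_pconst] subst_uminus[OF coeff_hom_pconst] subst_diff[OF coeff_hom_pconst] 
  subst_power[OF coeff_hom_pconst] subst_prod[OF coeff_hom_pconst] subst_const[OF coeff_hom_pconst]
  subst_Var[OF coeff_hom_pconst]

lemma line_val_sum: "line_val v w (\<Sum>i\<in>A. f i) = (\<Sum>i\<in>A. line_val v w (f i))"
  by (simp add: line_val_def line_val_simps)

lemma poly_line_val: "poly (line_val v w F) t = eval_mpoly (\<lambda>i. v i + t * w i) F"
  unfolding line_val_def eval_mpoly_eq_subst
  by (subst hom_subst[OF coeff_hom_poly]) (simp add: mult.commute)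

lemma line_val_scale:
  assumes "homogeneous d F" 
  shows "line_val (\<lambda>i. c * v i) (\<lambda>i. c * w i) F = [:c ^ d:] * line_val v w F"
proof -
  have "line_val (\<lambda>i. c * v i) (\<lambda>i. c * w i) F = subst (\<lambda>c. [:c:]) (\<lambda>i. [:c:] * [:v i, w i:]) F"
    by (simp add: line_val_def mult.commute)
  also have "\<dots> = [:c:] ^ d * line_val v w F"
    unfolding line_val_def by (rule subst_scale_homogeneous[OF assms])
  finally show ?thesis by (simp add: poly_const_pow)
qed

text \<open>Order of vanishing without derivatives: F(v + t w) is divisible by t^m in every
  direction w. For a fixed v this is a family of linear conditions on the coefficients of F whose
  entries are polynomials in v, which is the form that genericity arguments need.\<close>

definition vanishes :: "nat \<Rightarrow> (3 \<Rightarrow> 'k::comm_ring_1) \<Rightarrow> 'k ternary \<Rightarrow> bool" where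
  "vanishes m v F \<longleftrightarrow> (\<forall>w. monom 1 m dvd line_val v w F)"

lemma vanishes_iff: "vanishes m v F \<longleftrightarrow> (\<forall>w. \<forall>k<m. coeff (line_val v w F) k = 0)"
  by (simp add: vanishes_def monom_1_dvd_iff')

lemma vanishes_0 [simp]: "vanishes m v 0"
  by (simp add: vanishes_def line_val_def)

lemma vanishes_order_0 [simp]: "vanishes 0 v F"
  by (simp add: vanishes_iff)

lemma vanishes_add: "vanishes m v F \<Longrightarrow> vanishes m v G \<Longrightarrow> vanishes m v (F + G)"
  by (simp add: vanishes_def line_val_def line_val_simps)

lemma vanishes_uminus: "vanishes m v F \<Longrightarrow> vanishes m v (- F)"
  by (simp add: vanishes_def line_val_def line_val_simps)

lemma vanishes_mult: "vanishes a v F \<Longrightarrow> vanishes b v G \<Longrightarrow> vanishes (a + b) v (F * G)"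
  unfolding vanishes_def line_val_def line_val_simps
  by (auto intro: mult_dvd_mono[of "monom 1 a" _ "monom 1 b", unfolded mult_monom mult_1])

lemma vanishes_mult_left: "vanishes a v F \<Longrightarrow> vanishes a v (G * F)"
  by (simp add: vanishes_def line_val_def line_val_simps)

text \<open>Along each line the restriction of G has nonzero constant term, so it is a unit modulo
  every power of t. The coefficients of the restriction of F are therefore zero one after the
  other.\<close>

lemma vanishes_cancel_nonzero:
  fixes F G :: "'k::field ternary"
  assumes "eval_mpoly v G \<noteq> 0" "vanishes m v (G * F)"
  shows "vanishes m v F"
  unfolding vanishes_def
proof
  fix w
  let ?g = "line_val v w G" and ?f = "line_val v w F"
  have g: "coeff ?g 0 \<noteq> 0" using assms(1) by (simp add: poly_line_val flip: poly_0_coeff_0)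
  have dvd: "monom 1 m dvd ?g * ?f"
    using assms(2) by (simp add: vanishes_def line_val_def line_val_simps)
  have "coeff ?f k = 0" if "k < m" for k
    using that
  proof (induction k rule: less_induct)
    case (less k)
    have "0 = coeff (?g * ?f) k" using dvd less.prems by (simp add: monom_1_dvd_iff')
    also have "\<dots> = (\<Sum>i\<le>k. if i = 0 then coeff ?g 0 * coeff ?f k else 0)"
      unfolding coeff_mult by (rule sum.cong) (use less in auto)
    finally show ?case using g by simp
  qed
  then show "monom 1 m dvd ?f" by (simp add: monom_1_dvd_iff')
qed

lemma eval_Var: "eval_mpoly v (Var i) = v i"
  by (simp add: eval_mpoly_eq_subst subst_Var)

subsection \<open>Powers of the ideal of a point\<close>

lemma subspace_ideal_power: "ring_ideal.subspace (ideal_power I m)"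
  by (cases m) (simp_all add: ideal_mult_def)

lemma ideal_power_mult_left: "F \<in> ideal_power I m \<Longrightarrow> G * F \<in> ideal_power I m"
  using subspace_ideal_power ring_ideal.subspace_scale by blast

lemma ideal_power_Suc_mult: "F \<in> I \<Longrightarrow> G \<in> ideal_power I m \<Longrightarrow> F * G \<in> ideal_power I (Suc m)"
  unfolding ideal_power.simps ideal_mult_def by (rule ring_ideal.span_base) blast

lemma ideal_power_Suc_subset: "ideal_power I (Suc m) \<subseteq> ideal_power I m"
  unfolding ideal_power.simps ideal_mult_def
  by (rule ring_ideal.span_minimal) (auto simp: subspace_ideal_power ideal_power_mult_left)

lemma ideal_power_antimono: "m \<le> m' \<Longrightarrow> ideal_power I m' \<subseteq> ideal_power I m"
  by (induction rule: dec_induct) (use ideal_power_Suc_subset in blast)+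

lemma power_mem_ideal_power: 
  "F \<in> I \<Longrightarrow> G \<in> ideal_power I m \<Longrightarrow> F ^ k * G \<in> ideal_power I (k + m)"
proof (induction k)
  case (Suc k)
  have "F ^ Suc k * G = F * (F ^ k * G)" by (simp only: power_Suc mult.assoc)
  then show ?case using ideal_power_Suc_mult Suc by (metis add_Suc)
qed simp

text \<open>F may be inhomogeneous here. The factor \<open>s\<close> records vanishing along the
  whole line spanned by the representative, from which the vanishing of each homogeneous component
  is recovered later.\<close>

lemma vanishes_ideal_power:
  fixes p :: "'k::field proj_plane"
  assumes "F \<in> ideal_power (point_ideal p) m"
  shows "vanishes m (\<lambda>i. s * rep_proj_plane p i) F"
proof -
  let ?v = "\<lambda>i. s * rep_proj_plane p i"
  have sub: "ring_ideal.subspace {F. vanishes m ?v F}" for m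
    by (rule ring_ideal.subspaceI) (auto intro: vanishes_add vanishes_mult_left)
  have "point_ideal p \<subseteq> {F. vanishes 1 ?v F}"
    unfolding point_ideal_def
  proof (rule ring_ideal.span_minimal[OF _ sub], rule subsetI)
    fix F assume "F \<in> {F. (\<exists>d. homogeneous d F) \<and> eval_mpoly (rep_proj_plane p) F = 0}"
    then obtain d where "homogeneous d F" "eval_mpoly (rep_proj_plane p) F = 0" by auto
    then have "eval_mpoly ?v F = 0"
      by (simp add: eval_mpoly_eq_subst subst_scale_homogeneous)
    then have "poly (line_val ?v w F) 0 = 0" for w by (simp add: poly_line_val)
    then show "F \<in> {F. vanishes 1 ?v F}" by (simp add: vanishes_iff poly_0_coeff_0)
  qed
  then have P: "vanishes 1 ?v F" if "F \<in> point_ideal p" for F using that by blast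
  have "F \<in> {F. vanishes m ?v F}"
    using assms
  proof (induction m arbitrary: F)
    case (Suc m)
    have "ideal_power (point_ideal p) (Suc m) \<subseteq> {F. vanishes (Suc m) ?v F}"
      unfolding ideal_power.simps ideal_mult_def
    proof (rule ring_ideal.span_minimal[OF _ sub], rule subsetI)
      fix F assume "F \<in> {a * b |a b. a \<in> point_ideal p \<and> b \<in> ideal_power (point_ideal p) m}"
      then obtain a b where "F = a * b" "vanishes 1 ?v a" "vanishes m ?v b"
        using P Suc.IH by blast
      then show "F \<in> {F. vanishes (Suc m) ?v F}" using vanishes_mult[of 1 ?v a m b] by simp
    qed
    then show ?case using Suc.prems by blast
  qed simp
  then show ?thesis by simp
qed

lemma UNIV_3_cyc: "i = l \<or> i = l + 1 \<or> i = l + (2 :: 3)"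
proof -
  have "\<forall>i l. i = l \<or> i = l + 1 \<or> i = l + (2 :: 3)" unfolding forall_3 by simp
  then show ?thesis by blast
qed

lemma rep_proj_plane_nonzero: "rep_proj_plane p \<noteq> (\<lambda>_. 0)"
  using Quotient3_rep_reflp[OF Quotient3_proj_plane, of p] by (auto simp: proportional_def)

text \<open>Expand F in two linear forms \<open>A\<close>, \<open>B\<close> through the point and a
  variable that is nonzero there. Along a suitable line the coefficient of t^k is, up to a unit, the
  part of the expansion of degree k in \<open>A\<close>, \<open>B\<close>, evaluated at (1, y). As y
  varies over an infinite field, this part is zero for k < m, and the remaining monomials lie in the
  m-th power of the ideal.\<close>

lemma ideal_powerI_vanishes:
  fixes p :: "'k::alg_closed_field proj_plane"
  assumes F: "homogeneous d F" and van: "vanishes m (rep_proj_plane p) F"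
  shows "F \<in> ideal_power (point_ideal p) m"
proof -
  define v where "v = rep_proj_plane p"
  obtain l where l: "v l \<noteq> 0" using rep_proj_plane_nonzero unfolding v_def by blast
  \<comment> \<open>Addition in the index type is modulo 3, so these are the two indices other than
    \<open>l\<close>.\<close>
  define a b where "a = l + 1" and "b = l + 2"
  have abl: "a \<noteq> l" "b \<noteq> l" "a \<noteq> b" by (simp_all add: a_def b_def)
  define A B where "A = const (v l) * Var a - const (v a) * Var l" 
    and "B = const (v l) * Var b - const (v b) * Var l"
  have hom: "homogeneous 1 A" "homogeneous 1 B"
    unfolding A_def B_def by (auto intro!: homogeneous_diff homogeneous_const_mult)
  have "eval_mpoly v A = 0" "eval_mpoly v B = 0"
    by (simp_all add: eval_mpoly_eq_subst A_def B_def subst_diff subst_mult subst_const subst_Var)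
  then have P: "A \<in> point_ideal p" "B \<in> point_ideal p"
    unfolding point_ideal_def v_def using hom by (auto intro!: ring_ideal.span_base)
  have inv: "const (inverse (v l)) * (const (v l) * G) = G" for G :: "'k ternary"
    
    unfolding mult.assoc[symmetric] const_hom(2)[symmetric] using l by simp
  have "\<exists>r s t. Var i = const r * A + const s * B + const t * Var l" for i
  proof -
    have "Var a = const (inverse (v l)) * A + const 0 * B + const (inverse (v l) * v a) * Var l"
      unfolding A_def right_diff_distrib inv const_hom(2) mult.assoc by simp
    moreover have "Var b = const 0 * A + const (inverse (v l)) * B + const (inverse (v l) * v b) * Var l"
      unfolding B_def right_diff_distrib inv const_hom(2) mult.assoc by simp
    moreover have "Var l = const 0 * A + const 0 * B + const 1 * (Var l :: 'k ternary)" by simp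
    ultimately show ?thesis using UNIV_3_cyc[of i l] unfolding a_def b_def by blast
  qed
  from homogeneous_linear_basis[OF this F] obtain q where
    q: "F = (\<Sum>(i,j)\<in>{(i,j). i + j \<le> d}. const (q i j) * (A ^ i * B ^ j * Var l ^ (d - i - j)))" by blast
  have fin: "finite {(i,j). i + j \<le> d}" by (rule finite_subset[of _ "{..d} \<times> {..d}"]) auto
  have q0: "q i j = 0" if ij: "i + j < m" "i + j \<le> d" for i j
  proof -
    define k where "k = i + j"
    define Q where "Q = (\<Sum>j\<le>k. monom (q (k - j) j) j)"
    have "poly Q y = 0" for y
    proof -
      \<comment> \<open>In this direction \<open>A\<close> restricts to t, \<open>B\<close> to y t,
        and \<open>Var l\<close> to the nonzero constant \<open>v l\<close>.\<close>
      define w where "w = (\<lambda>i. if i = a then inverse (v l) else if i = b then y * inverse (v l) else 0)"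
      have lA: "line_val v w A = monom 1 1" "line_val v w B = monom y 1"
        and ll: "line_val v w (Var l) = [:v l:]"
        using l abl by (simp_all add: line_val_def line_val_simps A_def B_def w_def monom_altdef)
      have *: "line_val v w (const c * (A ^ i * B ^ j * Var l ^ e)) = monom (c * y ^ j * v l ^ e) (i + j)" for c i j e
      proof -
        have "line_val v w (const c * (A ^ i * B ^ j * Var l ^ e)) = [:c:] * (monom 1 1 ^ i * monom y 1 ^ j * [:v l:] ^ e)"
          unfolding lA[symmetric] ll[symmetric] unfolding line_val_def line_val_simps ..
        also have "\<dots> = monom c 0 * (monom 1 i * monom (y ^ j) j * monom (v l ^ e) 0)"
          by (simp add: monom_power poly_const_pow monom_0)
        also have "\<dots> = monom (c * y ^ j * v l ^ e) (i + j)"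
          by (simp only: mult_monom) (simp add: mult.assoc)
        finally show ?thesis .
      qed
      have "line_val v w F = (\<Sum>(i,j)\<in>{(i,j). i + j \<le> d}. monom (q i j * y ^ j * v l ^ (d - i - j)) (i + j))"
        unfolding q line_val_sum by (rule sum.cong) (auto simp: *)
      then have "coeff (line_val v w F) k = 
          (\<Sum>(i,j)\<in>{(i,j). i + j \<le> d}. if i + j = k then q i j * y ^ j * v l ^ (d - k) else 0)"
        by (auto simp: coeff_sum case_prod_unfold intro!: sum.cong)
      also have "\<dots> = (\<Sum>(i,j)\<in>{(i,j). i + j = k}. q i j * y ^ j * v l ^ (d - k))"
        using ij(2) by (intro sum.mono_neutral_cong_right fin) (auto simp: k_def split: if_splits)
      also have "\<dots> = (\<Sum>j\<le>k. q (k - j) j * y ^ j * v l ^ (d - k))"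
        by (rule sum.reindex_bij_witness[of _ "\<lambda>j. (k - j, j)" snd]) auto
      also have "\<dots> = v l ^ (d - k) * poly Q y"
        by (simp add: Q_def poly_sum poly_monom sum_distrib_left mult_ac)
      finally have "coeff (line_val v w F) k = v l ^ (d - k) * poly Q y" .
      moreover have "coeff (line_val v w F) k = 0"
        using van ij(1) by (auto simp: vanishes_iff v_def k_def)
      ultimately show ?thesis using l by simp
    qed
    then have "Q = 0" using poly_eq_0_cofinite[of "{}"] by blast
    then have "coeff Q j = 0" by simp
    then show ?thesis by (simp add: Q_def coeff_sum k_def)
  qed
  have "const (q i j) * (A ^ i * B ^ j * Var l ^ (d - i - j)) \<in> ideal_power (point_ideal p) m" 
    if "i + j \<le> d" for i j
  proof (cases "i + j < m")
    case True
    then show ?thesis using q0[OF True that] by (simp add: ring_ideal.subspace_0[OF subspace_ideal_power])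
  next
    case False
    have "A ^ i * (B ^ j * 1) \<in> ideal_power (point_ideal p) (i + (j + 0))"
      by (intro power_mem_ideal_power P) simp
    then have "A ^ i * (B ^ j * 1) \<in> ideal_power (point_ideal p) m"
      using False ideal_power_antimono[of m "i + j" "point_ideal p"] by auto
    from ideal_power_mult_left[OF this, of "const (q i j) * Var l ^ (d - i - j)"]
    show ?thesis by (simp add: mult_ac)
  qed
  then show ?thesis unfolding q
    by (intro ring_ideal.subspace_sum[OF subspace_ideal_power]) auto
qed

text \<open>If both base point and direction are scaled by s, the component of degree d is scaled by
  s^d. A fixed coefficient of t^k is thus a polynomial in s whose coefficients belong to the
  components, and it is zero for infinitely many s.\<close>

lemma hcomp_vanishes:
  fixes v :: "3 \<Rightarrow> 'k::alg_closed_field"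
  assumes "\<And>s. vanishes m (\<lambda>i. s * v i) F"
  shows "vanishes m v (hcomp d F)"
  unfolding vanishes_iff
proof (intro allI impI)
  fix w k assume k: "k < m"
  obtain N where N: "F = (\<Sum>d\<le>N. hcomp d F)" by (rule hcomp_bound)
  define Q where "Q = (\<Sum>d\<le>N. monom (coeff (line_val v w (hcomp d F)) k) d)"
  have "poly Q s = 0" for s
  proof -
    have "line_val (\<lambda>i. s * v i) (\<lambda>i. s * w i) F = (\<Sum>d\<le>N. line_val (\<lambda>i. s * v i) (\<lambda>i. s * w i) (hcomp d F))"
      by (subst N) (simp add: line_val_def line_val_simps)
    also have "\<dots> = (\<Sum>d\<le>N. [:s ^ d:] * line_val v w (hcomp d F))"
      by (intro sum.cong refl line_val_scale) simp
    finally have "coeff (line_val (\<lambda>i. s * v i) (\<lambda>i. s * w i) F) k = poly Q s"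
      by (simp add: coeff_sum Q_def poly_sum poly_monom mult_ac)
    then show ?thesis using assms[of s] k by (simp add: vanishes_iff)
  qed
  then have Q: "Q = 0" using poly_eq_0_cofinite[of "{}"] by blast
  show "coeff (line_val v w (hcomp d F)) k = 0"
  proof (cases "d \<le> N")
    case True
    have "coeff Q d = coeff (line_val v w (hcomp d F)) k" using True by (simp add: Q_def coeff_sum)
    then show ?thesis using Q by simp
  next
    case False
    have "hcomp d F = (\<Sum>e\<le>N. hcomp d (hcomp e F))" by (subst N) (simp add: hcomp_sum)
    also have "\<dots> = 0"
      by (rule sum.neutral) (use False in \<open>auto simp: hcomp_homogeneous[OF homogeneous_hcomp]\<close>)
    finally show ?thesis by (simp add: line_val_def)
  qed
qed

text \<open>From here on, ideal powers enter only through linear vanishing conditions on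
  forms.\<close>

lemma ideal_power_point_iff:
  fixes p :: "'k::alg_closed_field proj_plane"
  shows "F \<in> ideal_power (point_ideal p) m \<longleftrightarrow> (\<forall>d. vanishes m (rep_proj_plane p) (hcomp d F))"
proof
  assume "F \<in> ideal_power (point_ideal p) m"
  then show "\<forall>d. vanishes m (rep_proj_plane p) (hcomp d F)"
    using vanishes_ideal_power hcomp_vanishes by blast
next
  assume *: "\<forall>d. vanishes m (rep_proj_plane p) (hcomp d F)"
  obtain N where N: "F = (\<Sum>d\<le>N. hcomp d F)" by (rule hcomp_bound)
  have "(\<Sum>d\<le>N. hcomp d F) \<in> ideal_power (point_ideal p) m"
    using * by (intro ring_ideal.subspace_sum[OF subspace_ideal_power])
      (auto intro: ideal_powerI_vanishes[OF homogeneous_hcomp])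
  then show "F \<in> ideal_power (point_ideal p) m" using N by simp
qed

lemma fat_ideal_homogeneous_iff:
  fixes p :: "nat \<Rightarrow> 'k::alg_closed_field proj_plane"
  assumes "homogeneous d F"
  shows "F \<in> fat_ideal n m p \<longleftrightarrow> (\<forall>i<n. vanishes (m i) (rep_proj_plane (p i)) F)"
  unfolding fat_ideal_def by (auto simp: ideal_power_point_iff hcomp_homogeneous[OF assms])

lemma fat_ideal_hcomp:
  fixes p :: "nat \<Rightarrow> 'k::alg_closed_field proj_plane"
  assumes "F \<in> fat_ideal n m p"
  shows "hcomp d F \<in> fat_ideal n m p"
  using assms by (subst fat_ideal_homogeneous_iff[OF homogeneous_hcomp]) 
    (auto simp: fat_ideal_def ideal_power_point_iff)

lemma subspace_fat_ideal: "ring_ideal.subspace (fat_ideal n m p)"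
  unfolding fat_ideal_def by (rule ring_ideal.subspace_Inter) (auto simp: subspace_ideal_power)

section \<open>Linear algebra\<close>

text \<open>The closure properties that elimination uses, kept abstract because two classes occur:
  multihomogeneous functions of the coordinates of the points, where the degree matters, and
  polynomials in the single parameter \<epsilon>, where it is ignored.\<close>

locale graded_functions =
  fixes P :: "(nat \<Rightarrow> nat) \<Rightarrow> ('v \<Rightarrow> 'k::field) \<Rightarrow> bool"
  assumes P_one: "P (\<lambda>_. 0) (\<lambda>_. 1)"
    and P_mult: "P d f \<Longrightarrow> P e g \<Longrightarrow> P (\<lambda>i. d i + e i) (\<lambda>v. f v * g v)"
    and P_diff: "P d f \<Longrightarrow> P d g \<Longrightarrow> P d (\<lambda>v. f v - g v)"
begin

text \<open>Gaussian elimination keeps the entries bihomogeneous, because the cross-multiplied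
  entries \<open>A r j\<^sub>0 * A s j - A s j\<^sub>0 * A r j\<close> are again bihomogeneous.\<close>

lemma generic_injective:
  assumes "finite J"
    and "\<And>r j. r \<in> R \<Longrightarrow> j \<in> J \<Longrightarrow> P (\<lambda>i. \<delta> r i + \<epsilon> j i) (A r j)"
    and "\<And>x. (\<forall>r\<in>R. (\<Sum>j\<in>J. A r j v\<^sub>0 * x j) = 0) \<Longrightarrow> \<forall>j\<in>J. x j = 0"
  shows "\<exists>F d. P d F \<and> F v\<^sub>0 \<noteq> 0 \<and>
    (\<forall>v. F v \<noteq> 0 \<longrightarrow> (\<forall>x. (\<forall>r\<in>R. (\<Sum>j\<in>J. A r j v * x j) = 0) \<longrightarrow> (\<forall>j\<in>J. x j = 0)))"
  using assms
proof (induction J arbitrary: A \<delta> rule: finite_induct)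
  case empty
  show ?case by (rule exI[of _ "\<lambda>_. 1"], rule exI[of _ "\<lambda>_. 0"]) (simp add: P_one)
next
  case (insert j0 J A \<delta>)
  have "\<exists>r\<in>R. A r j0 v\<^sub>0 \<noteq> 0"
  proof (rule ccontr)
    assume "\<not> ?thesis"
    then have "\<forall>r\<in>R. (\<Sum>j\<in>insert j0 J. A r j v\<^sub>0 * (if j = j0 then 1 else 0)) = 0"
      using insert.hyps by (auto intro!: sum.neutral)
    from insert.prems(2)[OF this] show False by simp
  qed
  then obtain r where r: "r \<in> R" "A r j0 v\<^sub>0 \<noteq> 0" by blast
  define A' where "A' s j v = A r j0 v * A s j v - A s j0 v * A r j v" for s j v
  define \<delta>' where "\<delta>' s i = \<delta> s i + (\<delta> r i + \<epsilon> j0 i)" for s i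
  have A'_sum: "(\<Sum>j\<in>J. A' s j v * x j) = 
      A r j0 v * (\<Sum>j\<in>insert j0 J. A s j v * x j) - A s j0 v * (\<Sum>j\<in>insert j0 J. A r j v * x j)" for s v x
    using insert.hyps by (simp add: A'_def sum_distrib_left sum_subtractf algebra_simps)
  have "P (\<lambda>i. \<delta>' s i + \<epsilon> j i) (A' s j)" if "s \<in> R" "j \<in> J" for s j
  proof -
    have "P (\<lambda>i. \<delta>' s i + \<epsilon> j i) (\<lambda>v. A r j0 v * A s j v)"
      using P_mult[OF insert.prems(1)[OF r(1), of j0] insert.prems(1)[OF that(1), of j]] that
      by (simp add: \<delta>'_def add_ac)
    moreover have "P (\<lambda>i. \<delta>' s i + \<epsilon> j i) (\<lambda>v. A s j0 v * A r j v)"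
      using P_mult[OF insert.prems(1)[OF that(1), of j0] insert.prems(1)[OF r(1), of j]] that
      by (simp add: \<delta>'_def add_ac)
    ultimately show ?thesis using P_diff unfolding A'_def by blast
  qed
  moreover have "\<forall>j\<in>J. x j = 0" if x: "\<forall>s\<in>R. (\<Sum>j\<in>J. A' s j v\<^sub>0 * x j) = 0" for x
  proof -
    define y where "y = x(j0 := - (\<Sum>j\<in>J. A r j v\<^sub>0 * x j) / A r j0 v\<^sub>0)"
    have y: "(\<Sum>j\<in>J. f j * y j) = (\<Sum>j\<in>J. f j * x j)" for f
      by (rule sum.cong) (use insert.hyps in \<open>auto simp: y_def\<close>)
    have "A r j0 v\<^sub>0 * y j0 = - (\<Sum>j\<in>J. A r j v\<^sub>0 * x j)"
      using r(2) by (simp add: y_def)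
    then have r0: "(\<Sum>j\<in>insert j0 J. A r j v\<^sub>0 * y j) = 0"
      using insert.hyps by (simp add: y)
    have "(\<Sum>j\<in>insert j0 J. A s j v\<^sub>0 * y j) = 0" if "s \<in> R" for s
    proof -
      have "(\<Sum>j\<in>J. A' s j v\<^sub>0 * y j) = 0" using x that by (simp add: y)
      then show ?thesis using A'_sum[of s v\<^sub>0 y] r0 r(2) by simp
    qed
    then have "\<forall>j\<in>insert j0 J. y j = 0" using insert.prems(2) by blast
    then show ?thesis using insert.hyps by (auto simp: y_def split: if_splits)
  qed
  ultimately obtain F d where F: "P d F" "F v\<^sub>0 \<noteq> 0" 
    "\<And>v x. F v \<noteq> 0 \<Longrightarrow> (\<forall>s\<in>R. (\<Sum>j\<in>J. A' s j v * x j) = 0) \<Longrightarrow> (\<forall>j\<in>J. x j = 0)"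
    using insert.IH[of \<delta>' A'] by blast
  have "\<forall>j\<in>insert j0 J. x j = 0" 
    if v: "A r j0 v * F v \<noteq> 0" and x: "\<forall>s\<in>R. (\<Sum>j\<in>insert j0 J. A s j v * x j) = 0" for v x
  proof -
    have *: "\<forall>j\<in>J. x j = 0" using F(3)[of v x] v x r(1) by (simp add: A'_sum)
    moreover have "(\<Sum>j\<in>insert j0 J. A r j v * x j) = A r j0 v * x j0"
      using insert.hyps * by simp
    ultimately show ?thesis using x r(1) v by auto
  qed
  moreover have "P (\<lambda>i. (\<delta> r i + \<epsilon> j0 i) + d i) (\<lambda>v. A r j0 v * F v)"
    using P_mult[OF insert.prems(1)[OF r(1), of j0] F(1)] by simp
  ultimately show ?case using r(2) F(2)
    by (intro exI[of _ "\<lambda>v. A r j0 v * F v"] exI[of _ "\<lambda>i. (\<delta> r i + \<epsilon> j0 i) + d i"]) auto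
qed

end

lemma nontrivial_solution:
  fixes A :: "'r \<Rightarrow> 'j \<Rightarrow> 'k::field"
  assumes "finite R" "finite J" "card R < card J"
  shows "\<exists>x. (\<exists>j\<in>J. x j \<noteq> 0) \<and> (\<forall>r\<in>R. (\<Sum>j\<in>J. A r j * x j) = 0)"
  using assms
proof (induction R arbitrary: J A rule: finite_induct)
  case empty
  then have "J \<noteq> {}" by auto
  then show ?case by (intro exI[of _ "\<lambda>_. 1"]) auto
next
  case (insert r R J A)
  show ?case
  proof (cases "\<exists>j\<in>J. A r j \<noteq> 0")
    case False
    have "card R < card J" using insert by simp
    then obtain x where "\<exists>j\<in>J. x j \<noteq> 0" "\<forall>r\<in>R. (\<Sum>j\<in>J. A r j * x j) = 0"
      using insert.IH[OF insert.prems(1)] by blast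
    then show ?thesis using False by (intro exI[of _ x]) auto
  next
    case True
    then obtain j0 where j0: "j0 \<in> J" "A r j0 \<noteq> 0" by blast
    define J' where "J' = J - {j0}"
    have J': "finite J'" "J = insert j0 J'" "j0 \<notin> J'" using insert.prems j0 by (auto simp: J'_def)
    then have "card R < card J'" using insert by simp
    then obtain x where x: "\<exists>j\<in>J'. x j \<noteq> 0" 
      "\<forall>s\<in>R. (\<Sum>j\<in>J'. (A s j - A s j0 * A r j / A r j0) * x j) = 0"
      using insert.IH[OF J'(1), of "\<lambda>s j. A s j - A s j0 * A r j / A r j0"] by blast
    define y where "y = x(j0 := - (\<Sum>j\<in>J'. A r j * x j) / A r j0)"
    have y: "(\<Sum>j\<in>J'. f j * y j) = (\<Sum>j\<in>J'. f j * x j)" for f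
      by (rule sum.cong) (use J' in \<open>auto simp: y_def\<close>)
    have "A r j0 * y j0 = - (\<Sum>j\<in>J'. A r j * x j)" using j0 by (simp add: y_def)
    then have "(\<Sum>j\<in>J. A r j * y j) = 0" using J' by (simp add: y)
    moreover have "(\<Sum>j\<in>J. A s j * y j) = 0" if "s \<in> R" for s
    proof -
      have "(\<Sum>j\<in>J'. (A s j - A s j0 * A r j / A r j0) * x j) = 
         (\<Sum>j\<in>J'. A s j * x j) - A s j0 / A r j0 * (\<Sum>j\<in>J'. A r j * x j)"
        by (simp add: sum_distrib_left sum_subtractf left_diff_distrib mult.assoc)
      then have "(\<Sum>j\<in>J'. A s j * x j) = A s j0 / A r j0 * (\<Sum>j\<in>J'. A r j * x j)"
        using x(2) that by simp
      moreover have "y j0 = - (\<Sum>j\<in>J'. A r j * x j) / A r j0" by (simp add: y_def)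
      ultimately show ?thesis using J' by (simp add: y)
    qed
    ultimately show ?thesis using x(1) J' by (intro exI[of _ y]) (auto simp: y_def)
  qed
qed

subsection \<open>Bases of spaces of forms\<close>

text \<open>Indexing by initial segments lets bases be extended, cut and concatenated by index
  arithmetic, for instance a basis of I_(\<alpha>+1) that starts with the products of a basis of
  I_\<alpha> with the variables.\<close>

definition lin_indep :: "nat \<Rightarrow> (nat \<Rightarrow> ('v, 'k::comm_ring_1) mpoly) \<Rightarrow> bool" where
  "lin_indep N f \<longleftrightarrow> (\<forall>c. (\<Sum>i<N. const (c i) * f i) = 0 \<longrightarrow> (\<forall>i<N. c i = 0))"

definition basis_of :: "nat \<Rightarrow> (nat \<Rightarrow> ('v, 'k::comm_ring_1) mpoly) \<Rightarrow> ('v, 'k) mpoly set \<Rightarrow> bool" where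
  "basis_of N f S \<longleftrightarrow> lin_indep N f \<and> (\<forall>i<N. f i \<in> S) \<and> (\<forall>F\<in>S. \<exists>c. F = (\<Sum>i<N. const (c i) * f i))"

lemma finite_exponents: "finite {e :: 'v::finite \<Rightarrow>\<^sub>0 nat. exp_degree e \<le> d}"
proof (rule inj_on_finite)
  show "inj_on Poly_Mapping.lookup {e :: 'v \<Rightarrow>\<^sub>0 nat. exp_degree e \<le> d}"
    by (rule inj_onI) (rule poly_mapping_eq_iff[THEN iffD2])
  show "Poly_Mapping.lookup ` {e. exp_degree e \<le> d} \<subseteq> {f. \<forall>x :: 'v. f x \<in> {..d}}"
  proof clarsimp
    fix e :: "'v \<Rightarrow>\<^sub>0 nat" and x assume "exp_degree e \<le> d"
    moreover have "Poly_Mapping.lookup e x \<le> exp_degree e"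
      unfolding exp_degree_def by (rule member_le_sum) auto
    ultimately show "Poly_Mapping.lookup e x \<le> d" by simp
  qed
  show "finite {f. \<forall>x :: 'v. f x \<in> {..d}}"
    using finite_PiE[of "UNIV :: 'v set" "\<lambda>_. {..d}"] by (simp add: PiE_def Pi_def extensional_def)
qed

lemma finite_exponents_eq: "finite {e :: 'v::finite \<Rightarrow>\<^sub>0 nat. exp_degree e = d}"
  by (rule finite_subset[OF _ finite_exponents[of d]]) auto

lemma homogeneous_span:
  fixes F :: "('v::finite, 'k::field) mpoly"
  assumes "homogeneous d F"
  shows "F \<in> mpoly_space.span ((\<lambda>e. Poly_Mapping.single e 1) ` {e. exp_degree e = d})"
proof (subst poly_mapping_sum_single[of F], rule mpoly_space.span_sum)
  fix e assume "e \<in> Poly_Mapping.keys F"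
  then have "Poly_Mapping.single e 1 \<in> (\<lambda>e. Poly_Mapping.single e (1 :: 'k)) ` {e. exp_degree e = d}" 
    using assms by (simp add: homogeneous_def)
  moreover have "Poly_Mapping.single e (Poly_Mapping.lookup F e) = const (Poly_Mapping.lookup F e) * Poly_Mapping.single e 1"
    by (simp add: const_def mult_single)
  ultimately show "Poly_Mapping.single e (Poly_Mapping.lookup F e) \<in> 
      mpoly_space.span ((\<lambda>e. Poly_Mapping.single e 1) ` {e. exp_degree e = d})"
    using span_const_mult mpoly_space.span_base by metis
qed

lemma independent_homogeneous_finite:
  fixes B :: "('v::finite, 'k::field) mpoly set"
  assumes "mpoly_space.independent B" "B \<subseteq> {F. homogeneous d F}"
  shows "finite B"
  using mpoly_space.independent_span_bound[OF finite_imageI[OF finite_exponents_eq] assms(1)] 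
    assms(2) homogeneous_span by blast

lemma lin_indep_bij:
  fixes B :: "('v, 'k::field) mpoly set"
  assumes "mpoly_space.independent B" "bij_betw f {..<N} B"
  shows "lin_indep N f"
  unfolding lin_indep_def
proof (intro allI impI)
  fix c i assume *: "(\<Sum>i<N. const (c i) * f i) = 0" "i < N"
  define g where "g = inv_into {..<N} f"
  have g: "g (f i) = i" if "i < N" for i
    using assms(2) that unfolding g_def bij_betw_def by (simp add: inv_into_f_f)
  have fin: "finite B" using assms(2) bij_betw_finite by blast
  have "(\<Sum>b\<in>B. scale_mpoly (c (g b)) b) = (\<Sum>i<N. scale_mpoly (c (g (f i))) (f i))"
    by (rule sum.reindex_bij_betw[OF assms(2), symmetric])
  also have "\<dots> = (\<Sum>i<N. const (c i) * f i)"
    by (rule sum.cong) (simp_all add: g scale_mpoly_const)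
  finally have "(\<Sum>b\<in>B. scale_mpoly (c (g b)) b) = 0" using * by simp
  moreover have "f i \<in> B" using assms(2) *(2) bij_betwE by blast
  ultimately have "c (g (f i)) = 0"
    using mpoly_space.independentD[OF assms(1) fin order_refl, of "\<lambda>b. c (g b)" "f i"] by simp
  then show "c i = 0" using g *(2) by simp
qed

lemma lin_indep_inj_on:
  assumes "lin_indep N f" shows "inj_on f {..<N}"
proof (rule inj_onI)
  fix i j assume *: "i \<in> {..<N}" "j \<in> {..<N}" "f i = f j"
  show "i = j"
  proof (rule ccontr)
    assume "i \<noteq> j"
    define c where "c k = (if k = i then 1 else if k = j then - 1 else 0 :: 'b)" for k
    have "(\<Sum>k<N. const (c k) * f k) = (\<Sum>k<N. (if k = i then f i else 0) + (if k = j then - f j else 0))"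
      by (rule sum.cong) (use \<open>i \<noteq> j\<close> in \<open>auto simp: c_def const_hom\<close>)
    also have "\<dots> = 0" using * by (simp add: sum.distrib)
    finally have "c i = 0" using assms * unfolding lin_indep_def by blast
    then show False by (simp add: c_def)
  qed
qed

lemma lin_indep_independent:
  fixes f :: "nat \<Rightarrow> ('v, 'k::field) mpoly"
  assumes "lin_indep N f" shows "mpoly_space.independent (f ` {..<N})"
proof (rule mpoly_space.independent_if_scalars_zero)
  fix c x assume *: "(\<Sum>x\<in>f ` {..<N}. scale_mpoly (c x) x) = 0" "x \<in> f ` {..<N}"
  have "(\<Sum>i<N. const (c (f i)) * f i) = 0"
    using *(1) by (simp add: sum.reindex[OF lin_indep_inj_on[OF assms]] scale_mpoly_const)
  then have "\<forall>i<N. c (f i) = 0" using assms[unfolded lin_indep_def, THEN spec, of "\<lambda>i. c (f i)"] by simp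
  then show "c x = 0" using *(2) by auto
qed simp

lemma basis_of_extend:
  fixes S :: "('v::finite, 'k::field) mpoly set"
  assumes S: "mpoly_space.subspace S" "S \<subseteq> {F. homogeneous d F}"
    and g: "lin_indep a g" "\<And>i. i < a \<Longrightarrow> g i \<in> S"
  shows "\<exists>f. basis_of (mpoly_space.dim S) f S \<and> a \<le> mpoly_space.dim S \<and> (\<forall>i<a. f i = g i)"
proof -
  define B0 where "B0 = g ` {..<a}"
  have "B0 \<subseteq> S" using g(2) by (auto simp: B0_def)
  moreover have "mpoly_space.independent B0" unfolding B0_def by (rule lin_indep_independent[OF g(1)])
  ultimately obtain B where B: "B0 \<subseteq> B" "B \<subseteq> S" "mpoly_space.independent B" "S \<subseteq> mpoly_space.span B"
    using mpoly_space.maximal_independent_subset_extend by metis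
  have fin: "finite B" using independent_homogeneous_finite[OF B(3)] B(2) S(2) by blast
  have card: "card B = mpoly_space.dim S" by (rule mpoly_space.basis_card_eq_dim[OF B(2,4,3)])
  have card0: "card B0 = a" unfolding B0_def by (simp add: card_image[OF lin_indep_inj_on[OF g(1)]])
  then have le: "a \<le> card B" using card_mono[OF fin B(1)] by simp
  obtain h where h: "bij_betw h {..<card (B - B0)} (B - B0)"
    using ex_bij_betw_nat_finite[of "B - B0"] fin by (auto simp: atLeast0LessThan)
  have cardd: "card (B - B0) = card B - a" using card_Diff_subset[of B0 B] B(1) fin card0 finite_subset by metis
  define f where "f i = (if i < a then g i else h (i - a))" for i
  have "bij_betw f ({..<a} \<union> {a..<card B}) (B0 \<union> (B - B0))"
  proof (rule bij_betw_combine)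
    have "bij_betw g {..<a} B0" using lin_indep_inj_on[OF g(1)] by (simp add: B0_def bij_betw_def)
    moreover have "bij_betw f {..<a} B0 = bij_betw g {..<a} B0" by (rule bij_betw_cong) (simp add: f_def)
    ultimately show "bij_betw f {..<a} B0" by simp
    have "bij_betw (\<lambda>i. i - a) {a..<card B} {..<card B - a}"
      by (rule bij_betw_byWitness[of _ "\<lambda>i. i + a"]) auto
    from bij_betw_trans[OF this] h cardd
    have "bij_betw (h \<circ> (\<lambda>i. i - a)) {a..<card B} (B - B0)" by auto
    moreover have "bij_betw f {a..<card B} (B - B0) = bij_betw (h \<circ> (\<lambda>i. i - a)) {a..<card B} (B - B0)"
      by (rule bij_betw_cong) (simp add: f_def)
    ultimately show "bij_betw f {a..<card B} (B - B0)" by simp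
  qed simp
  moreover have "{..<a} \<union> {a..<card B} = {..<card B}" using le by auto
  moreover have "B0 \<union> (B - B0) = B" using B(1) by auto
  ultimately have f: "bij_betw f {..<card B} B" by simp
  have "\<exists>c. F = (\<Sum>i<card B. const (c i) * f i)" if "F \<in> S" for F
    using span_finite_family[of "{..<card B}" F f] f that B(4) by (auto simp: bij_betw_def)
  moreover have "f i \<in> S" if "i < card B" for i using f that B(2) by (auto simp: bij_betw_def)
  ultimately have "basis_of (card B) f S"
    unfolding basis_of_def using lin_indep_bij[OF B(3) f] by blast
  then show ?thesis using le unfolding card by (intro exI[of _ f]) (auto simp: f_def)
qed

lemma basis_of_exists:
  fixes S :: "('v::finite, 'k::field) mpoly set"
  assumes S: "mpoly_space.subspace S" "S \<subseteq> {F. homogeneous d F}"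
  shows "\<exists>f. basis_of (mpoly_space.dim S) f S"
  using basis_of_extend[OF S, of 0] by (auto simp: lin_indep_def)

lemma lin_indep_le_dim:
  fixes S :: "('v::finite, 'k::field) mpoly set"
  assumes "mpoly_space.subspace S" "S \<subseteq> {F. homogeneous d F}" "lin_indep a g" "\<And>i. i < a \<Longrightarrow> g i \<in> S"
  shows "a \<le> mpoly_space.dim S"
  using basis_of_extend[OF assms] by blast

lemma lin_indep_dim_basis:
  fixes S :: "('v::finite, 'k::field) mpoly set"
  assumes "mpoly_space.subspace S" "S \<subseteq> {F. homogeneous d F}" "lin_indep a g" "\<And>i. i < a \<Longrightarrow> g i \<in> S"
    "a = mpoly_space.dim S"
  shows "basis_of a g S"
proof -
  obtain f where f: "basis_of a f S" "\<forall>i<a. f i = g i" using basis_of_extend[OF assms(1-4)] assms(5) by blast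
  have "(\<Sum>i<a. const (c i) * f i) = (\<Sum>i<a. const (c i) * g i)" for c
    by (rule sum.cong) (use f in auto)
  then show ?thesis using f(1) assms(3,4) unfolding basis_of_def by simp
qed

lemma dim_eq_0_iff:
  fixes S :: "('v::finite, 'k::field) mpoly set"
  assumes "mpoly_space.subspace S" "S \<subseteq> {F. homogeneous d F}"
  shows "mpoly_space.dim S = 0 \<longleftrightarrow> S = {0}"
proof
  assume "mpoly_space.dim S = 0"
  then obtain f where "basis_of 0 f S" using basis_of_exists[OF assms] by auto
  then show "S = {0}" using mpoly_space.subspace_0[OF assms(1)] by (auto simp: basis_of_def)
next
  assume "S = {0}"
  then show "mpoly_space.dim S = 0" using mpoly_space.dim_le_card[of S "{}"] by simp
qed

section \<open>Counting ternary monomials\<close>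

lemma exp_degree_3: "exp_degree (e :: 3 \<Rightarrow>\<^sub>0 nat) = Poly_Mapping.lookup e 0 + Poly_Mapping.lookup e 1 + Poly_Mapping.lookup e 2"
  by (simp add: exp_degree_def sum_UNIV_3)

definition exp3 :: "nat \<Rightarrow> nat \<Rightarrow> nat \<Rightarrow> (3 \<Rightarrow>\<^sub>0 nat)" where
  "exp3 i j k = Poly_Mapping.single 0 i + Poly_Mapping.single 1 j + Poly_Mapping.single 2 k"

lemma lookup_exp3 [simp]:
  "Poly_Mapping.lookup (exp3 i j k) 0 = i" "Poly_Mapping.lookup (exp3 i j k) 1 = j" 
  "Poly_Mapping.lookup (exp3 i j k) 2 = k"
  by (simp_all add: exp3_def lookup_add lookup_single when_def)

lemma exp_degree_exp3 [simp]: "exp_degree (exp3 i j k) = i + j + k"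
  by (simp add: exp_degree_3)

lemma exp3_lookup: "exp3 (Poly_Mapping.lookup e 0) (Poly_Mapping.lookup e 1) (Poly_Mapping.lookup e 2) = (e :: 3 \<Rightarrow>\<^sub>0 nat)"
proof -
  have "\<forall>x. Poly_Mapping.lookup (exp3 (Poly_Mapping.lookup e 0) (Poly_Mapping.lookup e 1) (Poly_Mapping.lookup e 2)) x
     = Poly_Mapping.lookup e x" unfolding forall_3 by simp
  then show ?thesis by (auto intro: poly_mapping_eqI)
qed

lemma card_pairs_le: "card {(i, j). i + j \<le> (d :: nat)} = (d + 1) * (d + 2) div 2"
proof -
  have "{(i, j). i + j \<le> d} = (SIGMA i:{..d}. {..d - i})" by auto
  then have "card {(i, j). i + j \<le> d} = (\<Sum>i\<le>d. d - i + 1)" by simp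
  also have "\<dots> = (\<Sum>i\<le>d. i + 1)" by (rule sum.reindex_bij_witness[of _ "\<lambda>i. d - i" "\<lambda>i. d - i"]) auto
  also have "\<dots> = (d + 1) * (d + 2) div 2" by (induction d) auto
  finally show ?thesis .
qed

lemma card_exponents: "card {e :: 3 \<Rightarrow>\<^sub>0 nat. exp_degree e = d} = (d + 1) * (d + 2) div 2"
proof -
  have "bij_betw (\<lambda>(i, j). exp3 i j (d - i - j)) {(i, j). i + j \<le> d} {e. exp_degree e = d}"
  proof (rule bij_betw_byWitness[of _ "\<lambda>e. (Poly_Mapping.lookup e 0, Poly_Mapping.lookup e 1)"])
    show "\<forall>e\<in>{e. exp_degree e = d}. (case (Poly_Mapping.lookup e 0, Poly_Mapping.lookup e 1) of (i, j) \<Rightarrow> exp3 i j (d - i - j)) = e"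
    proof
      fix e assume "e \<in> {e :: 3 \<Rightarrow>\<^sub>0 nat. exp_degree e = d}"
      then have "d - Poly_Mapping.lookup e 0 - Poly_Mapping.lookup e 1 = Poly_Mapping.lookup e 2"
        by (auto simp: exp_degree_3)
      then show "(case (Poly_Mapping.lookup e 0, Poly_Mapping.lookup e 1) of (i, j) \<Rightarrow> exp3 i j (d - i - j)) = e"
        using exp3_lookup[of e] by simp
    qed
  qed (auto simp: exp_degree_3)
  from bij_betw_same_card[OF this] show ?thesis by (simp add: card_pairs_le)
qed

lemma dim_homogeneous:
  "mpoly_space.dim {F :: 'k::field ternary. homogeneous d F} = (d + 1) * (d + 2) div 2"
proof -
  let ?M = "(\<lambda>e. Poly_Mapping.single e (1 :: 'k)) ` {e :: 3 \<Rightarrow>\<^sub>0 nat. exp_degree e = d}"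
  have inj: "inj_on (\<lambda>e. Poly_Mapping.single e (1 :: 'k)) {e :: 3 \<Rightarrow>\<^sub>0 nat. exp_degree e = d}"
    by (rule inj_onI) (metis keys_single singleton_inject zero_neq_one)
  have "mpoly_space.independent ?M"
  proof (rule mpoly_space.independent_if_scalars_zero)
    show "finite ?M" by (simp add: finite_exponents_eq)
    fix c x assume *: "(\<Sum>x\<in>?M. scale_mpoly (c x) x) = 0" "x \<in> ?M"
    then obtain e where e: "x = Poly_Mapping.single e 1" "exp_degree e = d" by blast
    have "(\<Sum>x\<in>?M. scale_mpoly (c x) x) = (\<Sum>e\<in>{e. exp_degree e = d}. Poly_Mapping.single e (c (Poly_Mapping.single e 1)))"
      by (simp add: sum.reindex[OF inj] scale_mpoly_def mult_single)
    then have "0 = Poly_Mapping.lookup (\<Sum>e\<in>{e. exp_degree e = d}. Poly_Mapping.single e (c (Poly_Mapping.single e 1))) e"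
      using * by simp
    also have "\<dots> = (\<Sum>e'\<in>{e. exp_degree e = d}. if e' = e then c (Poly_Mapping.single e 1) else 0)"
      unfolding lookup_sum by (rule sum.cong) (auto simp: lookup_single when_def)
    also have "\<dots> = c x" using e by (simp add: finite_exponents_eq)
    finally show "c x = 0" by simp
  qed
  moreover have "?M \<subseteq> {F. homogeneous d F}" by (auto simp: homogeneous_def)
  moreover have "{F. homogeneous d F} \<subseteq> mpoly_space.span ?M" using homogeneous_span by blast
  ultimately have "card ?M = mpoly_space.dim {F :: 'k ternary. homogeneous d F}"
    using mpoly_space.basis_card_eq_dim by blast
  then show ?thesis by (simp add: card_image[OF inj] card_exponents)
qed

section \<open>Free resolutions of saturated ideals\<close>

text \<open>Homogeneity of degree d in the shifted module R(-s). The additive form forces F = 0 when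
  d < s, where the truncated difference d - s would admit constants.\<close>

definition shifted_homogeneous :: "nat \<Rightarrow> nat \<Rightarrow> ('v::finite, 'k::zero) mpoly \<Rightarrow> bool" where
  "shifted_homogeneous s d F \<longleftrightarrow> (\<forall>e\<in>Poly_Mapping.keys F. exp_degree e + s = d)"

lemma shifted_homogeneous_0_iff: "shifted_homogeneous 0 d F \<longleftrightarrow> homogeneous d F"
  by (simp add: shifted_homogeneous_def homogeneous_def)

lemma shifted_homogeneous_iff: "shifted_homogeneous s d F \<longleftrightarrow> (if s \<le> d then homogeneous (d - s) F else F = 0)"
proof (cases "s \<le> d")
  case True
  then show ?thesis by (auto simp: shifted_homogeneous_def homogeneous_def)
next
  case False
  then have "shifted_homogeneous s d F \<longleftrightarrow> Poly_Mapping.keys F = {}" by (auto simp: shifted_homogeneous_def)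
  with False show ?thesis by (simp only: keys_eq_empty_iff if_False)
qed

lemma shifted_homogeneous_zero [simp]: "shifted_homogeneous s d 0"
  by (simp add: shifted_homogeneous_def)

lemma shifted_homogeneous_Suc_iff [simp]: "shifted_homogeneous (Suc s) (Suc d) F \<longleftrightarrow> shifted_homogeneous s d F"
  by (simp add: shifted_homogeneous_def)

lemma shifted_homogeneous_add: 
  "shifted_homogeneous s d F \<Longrightarrow> shifted_homogeneous s d G \<Longrightarrow> shifted_homogeneous s d (F + G)"
  by (auto simp: shifted_homogeneous_iff homogeneous_add split: if_splits)

lemma shifted_homogeneous_diff: 
  "shifted_homogeneous s d F \<Longrightarrow> shifted_homogeneous s d G \<Longrightarrow> 
   shifted_homogeneous s d (F - G :: ('v::finite, 'k::comm_ring_1) mpoly)"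
  by (auto simp: shifted_homogeneous_iff homogeneous_diff split: if_splits)

lemma shifted_homogeneous_sum: 
  "(\<And>i. i \<in> A \<Longrightarrow> shifted_homogeneous s d (f i)) \<Longrightarrow> shifted_homogeneous s d (\<Sum>i\<in>A. f i)"
  by (induction A rule: infinite_finite_induct) (auto intro: shifted_homogeneous_add)

lemma shifted_homogeneous_mult: 
  "shifted_homogeneous b d F \<Longrightarrow> shifted_homogeneous a b G \<Longrightarrow> 
   shifted_homogeneous a d (F * G :: ('v::finite, 'k::comm_ring_1) mpoly)"
  unfolding shifted_homogeneous_def
proof
  fix e assume *: "\<forall>e\<in>Poly_Mapping.keys F. exp_degree e + b = d" "\<forall>e\<in>Poly_Mapping.keys G. exp_degree e + a = b"
    and "e \<in> Poly_Mapping.keys (F * G)"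
  then obtain f g where "e = f + g" "f \<in> Poly_Mapping.keys F" "g \<in> Poly_Mapping.keys G"
    using keys_mult by blast
  with * show "exp_degree e + a = d" by (auto simp: exp_degree_add)
qed

lemma shifted_homogeneous_mult_homogeneous: 
  "homogeneous c F \<Longrightarrow> shifted_homogeneous a b G \<Longrightarrow> 
   shifted_homogeneous a (c + b) (F * G :: ('v::finite, 'k::comm_ring_1) mpoly)"
  by (rule shifted_homogeneous_mult[of b]) (simp_all add: shifted_homogeneous_iff)

lemma shifted_homogeneous_Var_mult: 
  "shifted_homogeneous (Suc a) b G \<Longrightarrow> shifted_homogeneous a b (Var i * G :: ('v::finite, 'k::comm_ring_1) mpoly)"
  using shifted_homogeneous_mult[of "Suc a" b G a "Var i"] 
  by (simp add: shifted_homogeneous_iff mult.commute)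

definition shifted_comp :: "nat \<Rightarrow> nat \<Rightarrow> ('v::finite, 'k::comm_ring_1) mpoly \<Rightarrow> ('v, 'k) mpoly" where
  "shifted_comp s d F = (if s \<le> d then hcomp (d - s) F else 0)"

lemma shifted_homogeneous_comp [simp]: "shifted_homogeneous s d (shifted_comp s d F)"
  by (simp add: shifted_homogeneous_iff shifted_comp_def)

lemma shifted_comp_sum: "shifted_comp s d (\<Sum>i\<in>A. f i) = (\<Sum>i\<in>A. shifted_comp s d (f i))"
  by (simp add: shifted_comp_def hcomp_sum)

lemma shifted_comp_mult:
  assumes "shifted_homogeneous a b G"
  shows "shifted_comp a d (F * G) = shifted_comp b d F * G"
proof (cases "a \<le> b")
  case True
  then have "homogeneous (b - a) G" using assms by (simp add: shifted_homogeneous_iff)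
  from hcomp_mult_homogeneous[OF this, of "d - a" F] True show ?thesis
    by (auto simp: shifted_comp_def mult.commute)
next
  case False
  then have "G = 0" using assms by (simp add: shifted_homogeneous_iff)
  then show ?thesis by (simp add: shifted_comp_def)
qed

text \<open>The decomposition holds for every sufficiently large bound so that finitely many entries
  can share one.\<close>

lemma shifted_comp_decompose: "\<exists>N0. \<forall>N\<ge>N0. F = (\<Sum>d\<le>N. shifted_comp s d F)"
proof (intro exI[of _ "s + Max (insert 0 (exp_degree ` Poly_Mapping.keys F))"] allI impI)
  fix N assume N: "N \<ge> s + Max (insert 0 (exp_degree ` Poly_Mapping.keys F))"
  have "F = (\<Sum>d\<le>N - s. hcomp d F)"
  proof (rule hcomp_sum_le)
    fix e assume "e \<in> Poly_Mapping.keys F"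
    then have "exp_degree e \<le> Max (insert 0 (exp_degree ` Poly_Mapping.keys F))"
      by (intro Max_ge) auto
    then show "exp_degree e \<le> N - s" using N by simp
  qed
  also have "\<dots> = (\<Sum>d\<in>{s..N}. hcomp (d - s) F)"
    by (rule sum.reindex_bij_witness[of _ "\<lambda>d. d - s" "\<lambda>d. d + s"]) (use N in auto)
  also have "\<dots> = (\<Sum>d\<le>N. shifted_comp s d F)"
    by (rule sum.mono_neutral_cong_left) (auto simp: shifted_comp_def)
  finally show "F = (\<Sum>d\<le>N. shifted_comp s d F)" .
qed

lemma shifted_comp_decompose_family:
  assumes "finite A"
  shows "\<exists>N. \<forall>i\<in>A. F i = (\<Sum>d\<le>N. shifted_comp (s i) d (F i))"
proof -
  have "\<forall>i. \<exists>N0. \<forall>N\<ge>N0. F i = (\<Sum>d\<le>N. shifted_comp (s i) d (F i))"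
    using shifted_comp_decompose by blast
  from choice[OF this] obtain N0 where N0: "\<forall>i. \<forall>N\<ge>N0 i. F i = (\<Sum>d\<le>N. shifted_comp (s i) d (F i))" ..
  have "N0 i \<le> Max (N0 ` A)" if "i \<in> A" for i using assms that by simp
  then show ?thesis by (intro exI[of _ "Max (N0 ` A)"] ballI N0[rule_format])
qed

lemma lookup_0_eq_eval: "Poly_Mapping.lookup F 0 = eval_mpoly (\<lambda>_. 0) F"
  for F :: "('v, 'k::comm_ring_1) mpoly"
proof -
  have "mon_val (\<lambda>_. 0 :: 'k) e = (if e = 0 then 1 else 0)" for e :: "'v \<Rightarrow>\<^sub>0 nat"
  proof (cases "e = 0")
    case False
    then obtain x where x: "x \<in> Poly_Mapping.keys e" using keys_eq_empty_iff by blast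
    then have "(\<Prod>x\<in>Poly_Mapping.keys e. (0::'k) ^ Poly_Mapping.lookup e x) = 0"
      by (subst prod.remove[OF finite_keys x]) (simp add: in_keys_iff zero_power)
    then show ?thesis using False by (simp add: mon_val_def)
  qed simp
  then have "subst (\<lambda>c. c) (\<lambda>_. 0) F = (\<Sum>e\<in>Poly_Mapping.keys F. if e = 0 then Poly_Mapping.lookup F e else 0)"
    unfolding subst_def by (intro sum.cong) auto
  then show ?thesis by (auto simp: eval_mpoly_eq_subst in_keys_iff)
qed

text \<open>For a form, \<open>x_coeff\<close> is the coefficient of the pure power of \<open>x\<close>.\<close>

definition x_coeff :: "'k::comm_ring_1 ternary \<Rightarrow> 'k" where
  "x_coeff = subst (\<lambda>c. c) (\<lambda>i. if i = 0 then 1 else 0)"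

lemmas x_coeff_simps =
  subst_0 subst_add[OF coeff_hom_id] subst_sum[OF coeff_hom_id] subst_mult[OF coeff_hom_id] 
  subst_1[OF coeff_hom_id] subst_uminus[OF coeff_hom_id] subst_diff[OF coeff_hom_id] 
  subst_power[OF coeff_hom_id] subst_prod[OF coeff_hom_id] subst_const[OF coeff_hom_id]
  subst_Var[OF coeff_hom_id]

lemma sum_split_exponent:
  fixes F :: "('v, 'k::comm_ring_1) mpoly"
  assumes "\<And>e. e \<in> S \<Longrightarrow> Poly_Mapping.lookup e i > 0"
  shows "(\<Sum>e\<in>S. Poly_Mapping.single e (c e)) = 
     Var i * (\<Sum>e\<in>S. Poly_Mapping.single (e - Poly_Mapping.single i 1) (c e :: 'k))"
proof -
  have e: "Poly_Mapping.single i 1 + (e - Poly_Mapping.single i 1) = e" if "e \<in> S" for e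
    by (rule poly_mapping_eqI) (use assms[OF that] in \<open>auto simp: lookup_add lookup_minus lookup_single when_def\<close>)
  show ?thesis unfolding sum_distrib_left
    by (rule sum.cong[OF refl]) (simp only: Var_def mult_single e mult_1)
qed

lemma exp_degree_minus_single: 
  "Poly_Mapping.lookup e i > 0 \<Longrightarrow> Suc (exp_degree (e - Poly_Mapping.single i 1)) = exp_degree (e :: 'v::finite \<Rightarrow>\<^sub>0 nat)"
proof -
  assume "Poly_Mapping.lookup e i > 0"
  then have "Poly_Mapping.single i 1 + (e - Poly_Mapping.single i 1) = e"
    by (intro poly_mapping_eqI) (auto simp: lookup_add lookup_minus lookup_single when_def)
  then have "exp_degree (Poly_Mapping.single i 1 + (e - Poly_Mapping.single i 1)) = exp_degree e" by simp
  then show ?thesis by (simp only: exp_degree_add exp_degree_single)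
qed

lemma shifted_homogeneous_sum_minus_single:
  assumes "shifted_homogeneous s d F" "S \<subseteq> Poly_Mapping.keys F" "\<And>e. e \<in> S \<Longrightarrow> Poly_Mapping.lookup e i > 0"
  shows "shifted_homogeneous (Suc s) d (\<Sum>e\<in>S. Poly_Mapping.single (e - Poly_Mapping.single i 1) (c e))"
proof (rule shifted_homogeneous_sum)
  fix e assume e: "e \<in> S"
  then have "exp_degree e + s = d" using assms(1,2) by (auto simp: shifted_homogeneous_def)
  then show "shifted_homogeneous (Suc s) d (Poly_Mapping.single (e - Poly_Mapping.single i 1) (c e))"
    using exp_degree_minus_single[OF assms(3)[OF e]] by (simp add: shifted_homogeneous_def)
qed

text \<open>In a single degree the only monomial outside the ideal (y, z) is the pure power of x,
  and its coefficient is \<open>x_coeff F\<close>. Monomials containing y go into P, the others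
  contain z and go into Q.\<close>

lemma shifted_homogeneous_div_yz:
  fixes F :: "'k::comm_ring_1 ternary"
  assumes F: "shifted_homogeneous s d F" and "x_coeff F = 0"
  shows "\<exists>P Q. F = Var 1 * P + Var 2 * Q \<and> shifted_homogeneous (Suc s) d P \<and> shifted_homogeneous (Suc s) d Q"
proof -
  define S1 S2 where "S1 = {e \<in> Poly_Mapping.keys F. Poly_Mapping.lookup e 1 > 0}"
    and "S2 = {e \<in> Poly_Mapping.keys F. Poly_Mapping.lookup e 1 = 0}"
  have S2: "Poly_Mapping.lookup e 2 > 0" if e: "e \<in> S2" for e
  proof (rule ccontr)
    assume "\<not> Poly_Mapping.lookup e 2 > 0"
    then have "exp3 (Poly_Mapping.lookup e 0) 0 0 = e" using exp3_lookup[of e] e by (simp add: S2_def)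
    then obtain n where e0: "e = exp3 n 0 0" by metis
    have eF: "e \<in> Poly_Mapping.keys F" using e by (simp add: S2_def)
    have mv: "mon_val (\<lambda>i. if i = 0 then 1 else 0 :: 'k) e' = (if e' = e then 1 else 0)" if e': "e' \<in> Poly_Mapping.keys F" for e'
    proof -
      have deg: "exp_degree e' = exp_degree e" using e' eF F unfolding shifted_homogeneous_def by (metis add_right_cancel)
      have mv: "mon_val (\<lambda>i. if i = 0 then 1 else 0 :: 'k) e' = 0 ^ Poly_Mapping.lookup e' 1 * 0 ^ Poly_Mapping.lookup e' 2"
        by (simp add: mon_val_superset[of UNIV] prod_UNIV_3)
      show ?thesis
      proof (cases "Poly_Mapping.lookup e' 1 = 0 \<and> Poly_Mapping.lookup e' 2 = 0")
        case True
        then have "Poly_Mapping.lookup e' 0 = n" using deg by (simp add: exp_degree_3 e0)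
        then have "e' = e" using exp3_lookup[of e'] True e0 by simp
        then show ?thesis using mv True by simp
      next
        case False
        then have "e' \<noteq> e" by (auto simp: e0)
        then show ?thesis using mv False by (auto simp: zero_power)
      qed
    qed
    have "x_coeff F = (\<Sum>e'\<in>Poly_Mapping.keys F. if e' = e then Poly_Mapping.lookup F e' else 0)"
      unfolding x_coeff_def subst_def by (rule sum.cong) (auto simp: mv)
    also have "\<dots> = Poly_Mapping.lookup F e" using eF by simp
    finally show False using assms(2) eF by (simp add: in_keys_iff)
  qed
  have "Poly_Mapping.keys F = S1 \<union> S2" "S1 \<inter> S2 = {}" "finite S1" "finite S2" by (auto simp: S1_def S2_def)
  then have "F = (\<Sum>e\<in>S1. Poly_Mapping.single e (Poly_Mapping.lookup F e)) + 
      (\<Sum>e\<in>S2. Poly_Mapping.single e (Poly_Mapping.lookup F e))"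
    using poly_mapping_sum_single[of F] by (simp add: sum.union_disjoint)
  also have "(\<Sum>e\<in>S1. Poly_Mapping.single e (Poly_Mapping.lookup F e)) = 
      Var 1 * (\<Sum>e\<in>S1. Poly_Mapping.single (e - Poly_Mapping.single 1 1) (Poly_Mapping.lookup F e))"
    by (rule sum_split_exponent) (simp add: S1_def)
  also have "(\<Sum>e\<in>S2. Poly_Mapping.single e (Poly_Mapping.lookup F e)) = 
      Var 2 * (\<Sum>e\<in>S2. Poly_Mapping.single (e - Poly_Mapping.single 2 1) (Poly_Mapping.lookup F e))"
    by (rule sum_split_exponent) (rule S2)
  finally have "F = Var 1 * (\<Sum>e\<in>S1. Poly_Mapping.single (e - Poly_Mapping.single 1 1) (Poly_Mapping.lookup F e)) +
      Var 2 * (\<Sum>e\<in>S2. Poly_Mapping.single (e - Poly_Mapping.single 2 1) (Poly_Mapping.lookup F e))" .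
  moreover have "shifted_homogeneous (Suc s) d (\<Sum>e\<in>S1. Poly_Mapping.single (e - Poly_Mapping.single 1 1) (Poly_Mapping.lookup F e))"
    by (rule shifted_homogeneous_sum_minus_single[OF F]) (auto simp: S1_def)
  moreover have "shifted_homogeneous (Suc s) d (\<Sum>e\<in>S2. Poly_Mapping.single (e - Poly_Mapping.single 2 1) (Poly_Mapping.lookup F e))"
    by (rule shifted_homogeneous_sum_minus_single[OF F]) (use S2 S2_def in blast)+
  ultimately show ?thesis by blast
qed

lemma lookup_Var_mult_add: "Poly_Mapping.lookup (Var i * F) (Poly_Mapping.single i 1 + e) = Poly_Mapping.lookup F e"
  for F :: "('v, 'k::comm_ring_1) mpoly"
  unfolding Var_def by (simp only: lookup_single_mult_add mult_1)

lemma keys_Var_mult: "e \<in> Poly_Mapping.keys (Var i * F) \<Longrightarrow> Poly_Mapping.lookup e i > 0"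
  for F :: "('v, 'k::comm_ring_1) mpoly"
  using keys_mult[of "Var i" F] by (auto simp: Var_def lookup_add)

lemma Var_neq_0 [simp]: "Var i \<noteq> (0 :: ('v, 'k::zero_neq_one) mpoly)"
  by (metis Var_def keys_single keys_zero insert_not_empty zero_neq_one)

text \<open>Regularity of y, z, with control of degrees: every monomial of y A occurs in a multiple
  of z, so every monomial of A contains z.\<close>

lemma shifted_homogeneous_koszul:
  fixes A B :: "'k::field ternary"
  assumes A: "shifted_homogeneous s d A" and eq: "Var 1 * A + Var 2 * B = 0"
  shows "\<exists>t. A = Var 2 * t \<and> B = - (Var 1 * t) \<and> shifted_homogeneous (Suc s) d t"
proof -
  have keys: "Poly_Mapping.lookup e 2 > 0" if "e \<in> Poly_Mapping.keys A" for e
  proof -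
    have "Poly_Mapping.lookup (Var 1 * A) (Poly_Mapping.single 1 1 + e) \<noteq> 0"
      using that by (metis lookup_Var_mult_add in_keys_iff)
    moreover have "Var 1 * A = Var 2 * (- B)" using eq by (simp add: eq_neg_iff_add_eq_0)
    ultimately have "Poly_Mapping.single 1 1 + e \<in> Poly_Mapping.keys (Var 2 * (- B))" by (metis in_keys_iff)
    from keys_Var_mult[OF this] show ?thesis by (simp add: lookup_add lookup_single when_def)
  qed
  define t where "t = (\<Sum>e\<in>Poly_Mapping.keys A. Poly_Mapping.single (e - Poly_Mapping.single 2 1) (Poly_Mapping.lookup A e))"
  have At: "A = Var 2 * t"
    unfolding t_def by (subst sum_split_exponent[symmetric]) (use keys poly_mapping_sum_single in auto)
  then have "Var 2 * (Var 1 * t + B) = 0" using eq by (simp add: distrib_left mult.left_commute)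
  then have "Var 1 * t + B = 0" by simp
  then have "B = - (Var 1 * t)" by (simp add: eq_neg_iff_add_eq_0 add.commute)
  moreover have "shifted_homogeneous (Suc s) d t"
    unfolding t_def by (rule shifted_homogeneous_sum_minus_single[OF A]) (use keys in auto)
  ultimately show ?thesis using At by blast
qed

lemma x_coeff_hom [simp]:
  "x_coeff 0 = 0" "x_coeff (F + G) = x_coeff F + x_coeff G" "x_coeff (F * G) = x_coeff F * x_coeff G"
  "x_coeff (F - G) = x_coeff F - x_coeff G" "x_coeff (const c) = c" 
  "x_coeff (Var i) = (if i = 0 then 1 else 0)" "x_coeff (F ^ n) = x_coeff F ^ n"
  by (simp_all add: x_coeff_def x_coeff_simps)

lemma x_coeff_sum: "x_coeff (\<Sum>i\<in>A. f i) = (\<Sum>i\<in>A. x_coeff (f i))"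
  by (simp add: x_coeff_def x_coeff_simps)

lemma sum_yz_distrib:
  "(\<Sum>i\<in>A. (Y * p i + Z * q i) * g i) = Y * (\<Sum>i\<in>A. p i * g i) + Z * (\<Sum>i\<in>A. q i * g i :: 'a::comm_ring_1)"
  by (simp add: sum_distrib_left distrib_right sum.distrib mult.assoc)

lemma sum_diff_distrib:
  "(\<Sum>i\<in>A. (p i - Z * v i) * g i) = (\<Sum>i\<in>A. p i * g i) - Z * (\<Sum>i\<in>A. v i * g i :: 'a::comm_ring_1)"
  by (simp add: sum_distrib_left left_diff_distrib sum_subtractf mult.assoc)

lemma sum_add_distrib:
  "(\<Sum>i\<in>A. (p i + Z * v i) * g i) = (\<Sum>i\<in>A. p i * g i) + Z * (\<Sum>i\<in>A. v i * g i :: 'a::comm_ring_1)"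
  by (simp add: sum_distrib_left distrib_right sum.distrib mult.assoc)

text \<open>Since \<open>z\<close> is a nonzerodivisor modulo \<open>I\<close>, the sequence \<open>y\<close>, \<open>z\<close> is regular on the module of
  syzygies modulo syzygies. So a basis of the syzygies is obtained by lifting a basis of their image
  under \<open>y = z = 0\<close>, which is a graded submodule of a free \<open>k[x]\<close>-module. Such a basis is read off
  from pivots: for every index that occurs as the first nonzero entry of some image, a syzygy of
  least degree with that pivot is chosen.\<close>

locale saturated_generators =
  fixes I :: "'k::field ternary set" and r :: nat and a :: "nat \<Rightarrow> nat" and g :: "nat \<Rightarrow> 'k ternary"
  assumes ideal: "ring_ideal.subspace I"
    and hcomp_mem: "F \<in> I \<Longrightarrow> hcomp d F \<in> I"
    and hom_g: "i < r \<Longrightarrow> homogeneous (a i) (g i)"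
    and g_mem: "i < r \<Longrightarrow> g i \<in> I"
    and gen: "F \<in> I \<Longrightarrow> homogeneous d F \<Longrightarrow>
      \<exists>u. (\<forall>i<r. shifted_homogeneous (a i) d (u i)) \<and> F = (\<Sum>i<r. u i * g i)"
    and sat: "homogeneous d F \<Longrightarrow> Var 2 * F \<in> I \<Longrightarrow> F \<in> I"
    and minimal: "\<forall>i<r. shifted_homogeneous (a i) d (u i) \<Longrightarrow> (\<Sum>i<r. u i * g i) = 0 \<Longrightarrow> i < r \<Longrightarrow>
      Poly_Mapping.lookup (u i) 0 = 0"
begin

definition syz :: "nat \<Rightarrow> (nat \<Rightarrow> 'k ternary) \<Rightarrow> bool" where
  "syz d u \<longleftrightarrow> (\<forall>i<r. shifted_homogeneous (a i) d (u i)) \<and> (\<Sum>i<r. u i * g i) = 0"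

definition has_pivot :: "nat \<Rightarrow> nat \<Rightarrow> (nat \<Rightarrow> 'k ternary) \<Rightarrow> bool" where
  "has_pivot d j u \<longleftrightarrow> syz d u \<and> x_coeff (u j) = 1 \<and> (\<forall>i<j. x_coeff (u i) = 0)"

definition "pivots = {j. j < r \<and> (\<exists>d u. has_pivot d j u)}"

definition "pivot_degree j = (LEAST d. \<exists>u. has_pivot d j u)"

definition "pivot_syz j = (SOME u. has_pivot (pivot_degree j) j u)"

lemma pivot_syz: "j \<in> pivots \<Longrightarrow> has_pivot (pivot_degree j) j (pivot_syz j)"
proof -
  assume "j \<in> pivots"
  then have "\<exists>d u. has_pivot d j u" by (auto simp: pivots_def)
  then have "\<exists>u. has_pivot (pivot_degree j) j u" unfolding pivot_degree_def by (rule LeastI_ex)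
  then show ?thesis unfolding pivot_syz_def by (rule someI_ex)
qed

lemma pivot_degree_le: "has_pivot d j u \<Longrightarrow> pivot_degree j \<le> d"
  unfolding pivot_degree_def by (rule Least_le) blast

lemma pivots_less: "j \<in> pivots \<Longrightarrow> j < r"
  by (simp add: pivots_def)

lemma finite_pivots: "finite pivots"
  by (rule finite_subset[of _ "{..<r}"]) (auto simp: pivots_def)

lemma pivot_syz_homogeneous: 
  "j \<in> pivots \<Longrightarrow> i < r \<Longrightarrow> shifted_homogeneous (a i) (pivot_degree j) (pivot_syz j i)"
  using pivot_syz by (simp add: has_pivot_def syz_def)

text \<open>A syzygy that is zero modulo (y, z) is y p + z q with p, q again syzygies. For a first
  choice put A = sum of p_i g_i and B = sum of q_i g_i. From y A + z B = 0 one gets A = z t, B = - y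
  t, and saturation puts t into I. Expressing t by the generators gives the correction that turns p
  and q into syzygies.\<close>

lemma syz_div_yz:
  assumes u: "syz d u" and x: "\<forall>i<r. x_coeff (u i) = 0"
  shows "\<exists>p q. (\<forall>i<r. u i = Var 1 * p i + Var 2 * q i) \<and> 
    (\<forall>i<r. shifted_homogeneous (Suc (a i)) d (p i)) \<and> (\<forall>i<r. shifted_homogeneous (Suc (a i)) d (q i)) \<and>
    (\<Sum>i<r. p i * g i) = 0 \<and> (\<Sum>i<r. q i * g i) = 0"
proof -
  have "\<forall>i. \<exists>PQ. i < r \<longrightarrow> u i = Var 1 * fst PQ + Var 2 * snd PQ \<and> 
      shifted_homogeneous (Suc (a i)) d (fst PQ) \<and> shifted_homogeneous (Suc (a i)) d (snd PQ)"
  proof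
    fix i
    show "\<exists>PQ. i < r \<longrightarrow> u i = Var 1 * fst PQ + Var 2 * snd PQ \<and> 
      shifted_homogeneous (Suc (a i)) d (fst PQ) \<and> shifted_homogeneous (Suc (a i)) d (snd PQ)"
    proof (cases "i < r")
      case True
      then obtain P Q where "u i = Var 1 * P + Var 2 * Q" 
        "shifted_homogeneous (Suc (a i)) d P" "shifted_homogeneous (Suc (a i)) d Q"
        using shifted_homogeneous_div_yz[of "a i" d "u i"] u x unfolding syz_def by blast
      then show ?thesis by (intro exI[of _ "(P, Q)"]) simp
    qed simp
  qed
  from choice[OF this] obtain PQ where PQ: "\<forall>i<r. u i = Var 1 * fst (PQ i) + Var 2 * snd (PQ i) \<and> 
      shifted_homogeneous (Suc (a i)) d (fst (PQ i)) \<and> shifted_homogeneous (Suc (a i)) d (snd (PQ i))" by blast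
  define p q where "p i = fst (PQ i)" and "q i = snd (PQ i)" for i
  have upq: "u i = Var 1 * p i + Var 2 * q i" and p: "shifted_homogeneous (Suc (a i)) d (p i)"
    and q: "shifted_homogeneous (Suc (a i)) d (q i)" if "i < r" for i
    using PQ that by (auto simp: p_def q_def)
  define A B where "A = (\<Sum>i<r. p i * g i)" and "B = (\<Sum>i<r. q i * g i)"
  have "(\<Sum>i<r. u i * g i) = (\<Sum>i<r. (Var 1 * p i + Var 2 * q i) * g i)"
    by (rule sum.cong) (auto simp: upq)
  then have eq: "Var 1 * A + Var 2 * B = 0" using u by (simp add: A_def B_def sum_yz_distrib syz_def)
  have hA: "shifted_homogeneous 1 d A" unfolding A_def
  proof (rule shifted_homogeneous_sum)
    fix i assume i: "i \<in> {..<r}"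
    show "shifted_homogeneous 1 d (p i * g i)"
      by (rule shifted_homogeneous_mult[OF p]) (use i hom_g in \<open>auto simp: shifted_homogeneous_0_iff\<close>)
  qed
  obtain t where t: "A = Var 2 * t" "B = - (Var 1 * t)" "shifted_homogeneous 2 d t"
    using shifted_homogeneous_koszul[OF hA eq] by (auto simp: numeral_2_eq_2)
  have AI: "A \<in> I" unfolding A_def
    by (rule ring_ideal.subspace_sum[OF ideal], rule ring_ideal.subspace_scale[OF ideal]) (simp add: g_mem)
  \<comment> \<open>As A and B have degree d - 1, the degree of t is d - 2; for smaller d the
    shifted condition already says t = 0.\<close>
  obtain v where v: "\<forall>i<r. shifted_homogeneous (Suc (Suc (a i))) d (v i)" "t = (\<Sum>i<r. v i * g i)"
  proof (cases "d < 2")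
    case True
    then have "t = 0" using t(3) by (simp add: shifted_homogeneous_iff)
    then show thesis using that[of "\<lambda>_. 0"] by simp
  next
    case False
    then obtain d' where d: "d = Suc (Suc d')" by (metis less_2_cases not0_implies_Suc less_Suc0 not_less_eq numeral_2_eq_2)
    have ht: "homogeneous d' t" using t(3) by (simp add: d shifted_homogeneous_iff)
    then have "t \<in> I" using sat[OF ht] AI t(1) by simp
    from gen[OF this ht] that show thesis unfolding d by auto
  qed
  define p' q' where "p' i = p i - Var 2 * v i" and "q' i = q i + Var 1 * v i" for i
  have "shifted_homogeneous (Suc (a i)) d (p' i)" "shifted_homogeneous (Suc (a i)) d (q' i)" if "i < r" for i
    unfolding p'_def q'_def using p[OF that] q[OF that] v(1) that
    by (auto intro: shifted_homogeneous_diff shifted_homogeneous_add shifted_homogeneous_Var_mult)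
  moreover have "u i = Var 1 * p' i + Var 2 * q' i" if "i < r" for i
    unfolding upq[OF that] p'_def q'_def by (simp add: algebra_simps)
  moreover have "(\<Sum>i<r. p' i * g i) = 0" "(\<Sum>i<r. q' i * g i) = 0"
    unfolding p'_def q'_def sum_diff_distrib sum_add_distrib using t(1,2) v(2) by (simp_all add: A_def B_def)
  ultimately show ?thesis by blast
qed

text \<open>The outer induction is on the degree, the inner one runs downwards on the number k of
  leading entries without pure power of x. For k = r the syzygy is y p + z q with syzygies p, q of
  degree d - 1. Otherwise the k-th entry is cleared by a multiple of the pivot syzygy at k.\<close>

lemma syz_generated:
  "syz d u \<Longrightarrow> \<exists>f. (\<forall>j\<in>pivots. shifted_homogeneous (pivot_degree j) d (f j)) \<and> 
     (\<forall>i<r. u i = (\<Sum>j\<in>pivots. f j * pivot_syz j i))"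
proof (induction d arbitrary: u rule: less_induct)
  case (less d)
  have "syz d u \<longrightarrow> (\<forall>i<k. x_coeff (u i) = 0) \<longrightarrow> 
    (\<exists>f. (\<forall>j\<in>pivots. shifted_homogeneous (pivot_degree j) d (f j)) \<and> 
     (\<forall>i<r. u i = (\<Sum>j\<in>pivots. f j * pivot_syz j i)))" if "k \<le> r" for k u
    using that
  proof (induction k arbitrary: u rule: inc_induct)
    case base
    show ?case
    proof (intro impI)
      assume u: "syz d u" and x: "\<forall>i<r. x_coeff (u i) = 0"
      from syz_div_yz[OF u x] obtain p q where 
        upq: "\<And>i. i < r \<Longrightarrow> u i = Var 1 * p i + Var 2 * q i" and
        p: "\<forall>i<r. shifted_homogeneous (Suc (a i)) d (p i)" "(\<Sum>i<r. p i * g i) = 0" and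
        q: "\<forall>i<r. shifted_homogeneous (Suc (a i)) d (q i)" "(\<Sum>i<r. q i * g i) = 0" by blast
      show "\<exists>f. (\<forall>j\<in>pivots. shifted_homogeneous (pivot_degree j) d (f j)) \<and> 
         (\<forall>i<r. u i = (\<Sum>j\<in>pivots. f j * pivot_syz j i))"
      proof (cases d)
        case 0
        then have "u i = 0" if "i < r" for i
          using upq[OF that] p(1) q(1) that by (simp add: shifted_homogeneous_iff)
        then show ?thesis by (intro exI[of _ "\<lambda>_. 0"]) simp
      next
        case (Suc d')
        have "syz d' p" "syz d' q" using p q by (simp_all add: syz_def Suc)
        with less.IH[of d'] Suc have 
          "\<exists>f. (\<forall>j\<in>pivots. shifted_homogeneous (pivot_degree j) d' (f j)) \<and> (\<forall>i<r. p i = (\<Sum>j\<in>pivots. f j * pivot_syz j i))"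
          "\<exists>f. (\<forall>j\<in>pivots. shifted_homogeneous (pivot_degree j) d' (f j)) \<and> (\<forall>i<r. q i = (\<Sum>j\<in>pivots. f j * pivot_syz j i))"
          by simp_all
        then obtain f1 f2 where 
          f1: "\<And>j. j \<in> pivots \<Longrightarrow> shifted_homogeneous (pivot_degree j) d' (f1 j)" 
            "\<And>i. i < r \<Longrightarrow> p i = (\<Sum>j\<in>pivots. f1 j * pivot_syz j i)" and
          f2: "\<And>j. j \<in> pivots \<Longrightarrow> shifted_homogeneous (pivot_degree j) d' (f2 j)" 
            "\<And>i. i < r \<Longrightarrow> q i = (\<Sum>j\<in>pivots. f2 j * pivot_syz j i)" by blast
        have "shifted_homogeneous (pivot_degree j) d (Var 1 * f1 j + Var 2 * f2 j)" if "j \<in> pivots" for j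
          using shifted_homogeneous_mult_homogeneous[OF homogeneous_Var(1) f1(1)[OF that], of 1]
            shifted_homogeneous_mult_homogeneous[OF homogeneous_Var(1) f2(1)[OF that], of 2]
          by (simp add: Suc shifted_homogeneous_add)
        moreover have "u i = (\<Sum>j\<in>pivots. (Var 1 * f1 j + Var 2 * f2 j) * pivot_syz j i)" if "i < r" for i
          unfolding sum_yz_distrib using upq[OF that] f1(2)[OF that] f2(2)[OF that] by simp
        ultimately show ?thesis by (intro exI[of _ "\<lambda>j. Var 1 * f1 j + Var 2 * f2 j"]) blast
      qed
    qed
  next
    case (step k)
    show ?case
    proof (intro impI)
      assume u: "syz d u" and x: "\<forall>i<k. x_coeff (u i) = 0"
      show "\<exists>f. (\<forall>j\<in>pivots. shifted_homogeneous (pivot_degree j) d (f j)) \<and> 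
         (\<forall>i<r. u i = (\<Sum>j\<in>pivots. f j * pivot_syz j i))"
      proof (cases "x_coeff (u k) = 0")
        case True
        then show ?thesis using step.IH[of u] u x by (simp add: less_Suc_eq)
      next
        case False
        define c where "c = x_coeff (u k)"
        have c: "c \<noteq> 0" using False by (simp add: c_def)
        have "syz d (\<lambda>i. const (inverse c) * u i)"
          using u shifted_homogeneous_mult_homogeneous[OF homogeneous_const[of "inverse c"], of _ d]
          by (auto simp: syz_def mult.assoc simp flip: sum_distrib_left)
        then have piv: "has_pivot d k (\<lambda>i. const (inverse c) * u i)"
          using x c by (simp add: has_pivot_def flip: c_def)
        then have k: "k \<in> pivots" using step.hyps by (auto simp: pivots_def)
        have le: "pivot_degree k \<le> d" by (rule pivot_degree_le[OF piv])
        \<comment> \<open>The power of x exists because the chosen pivot syzygy has least degree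
          among those with pivot k.\<close>
        define m :: "'k ternary" where "m = const c * Var 0 ^ (d - pivot_degree k)"
        have hm: "homogeneous (d - pivot_degree k) m"
          unfolding m_def using homogeneous_power[OF homogeneous_Var(1)[of 0]] by (auto intro!: homogeneous_const_mult)
        have xm: "x_coeff m = c" by (simp add: m_def)
        define u' where "u' i = u i - m * pivot_syz k i" for i
        have psk: "syz (pivot_degree k) (pivot_syz k)" using pivot_syz[OF k] by (simp add: has_pivot_def)
        have "shifted_homogeneous (a i) d (u' i)" if "i < r" for i
          unfolding u'_def
        proof (rule shifted_homogeneous_diff)
          show "shifted_homogeneous (a i) d (u i)" using u that by (simp add: syz_def)
          show "shifted_homogeneous (a i) d (m * pivot_syz k i)"
            using shifted_homogeneous_mult_homogeneous[OF hm pivot_syz_homogeneous[OF k that]] le by simp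
        qed
        moreover have "(\<Sum>i<r. u' i * g i) = 0"
          unfolding u'_def sum_diff_distrib using u psk by (simp add: syz_def)
        ultimately have "syz d u'" by (simp add: syz_def)
        moreover have "\<forall>i<Suc k. x_coeff (u' i) = 0"
          using x pivot_syz[OF k] by (auto simp: less_Suc_eq u'_def xm has_pivot_def c_def)
        ultimately obtain f where f: "\<forall>j\<in>pivots. shifted_homogeneous (pivot_degree j) d (f j)" 
          "\<forall>i<r. u' i = (\<Sum>j\<in>pivots. f j * pivot_syz j i)" using step.IH[of u'] by blast
        define f' where "f' = f(k := f k + m)"
        have "shifted_homogeneous (pivot_degree j) d (f' j)" if "j \<in> pivots" for j
          using f(1) that hm le by (auto simp: f'_def shifted_homogeneous_iff intro: homogeneous_add split: if_splits)
        moreover have "u i = (\<Sum>j\<in>pivots. f' j * pivot_syz j i)" if "i < r" for i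
        proof -
          have "(\<Sum>j\<in>pivots. f' j * pivot_syz j i) = (\<Sum>j\<in>pivots. f j * pivot_syz j i + (if j = k then m * pivot_syz k i else 0))"
            by (rule sum.cong) (auto simp: f'_def distrib_right)
          also have "\<dots> = u' i + m * pivot_syz k i"
            using f(2) that k finite_pivots by (simp add: sum.distrib)
          finally show ?thesis by (simp add: u'_def)
        qed
        ultimately show ?thesis by (intro exI[of _ f']) blast
      qed
    qed
  qed
  from this[of 0 u] less.prems show ?case by simp
qed

text \<open>Modulo (y, z) the pivot syzygies are triangular, so f = y p + z q. The combinations A, B
  with coefficients p, q satisfy y A + z B = 0, hence A = z w, B = - y w for a syzygy w, which is
  itself a combination with coefficients v. Then p - z v and q + y v are relations of degree d - 1,
  so by induction p = z v, q = - y v, and f cancels.\<close>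

lemma syz_independent:
  "\<forall>j\<in>pivots. shifted_homogeneous (pivot_degree j) d (f j) \<Longrightarrow> 
   \<forall>i<r. (\<Sum>j\<in>pivots. f j * pivot_syz j i) = 0 \<Longrightarrow> \<forall>j\<in>pivots. f j = 0"
proof (induction d arbitrary: f rule: less_induct)
  case (less d)
  \<comment> \<open>In entry j, pivots after j contribute nothing and those before j have
    coefficients already known to be zero.\<close>
  have x: "j \<in> pivots \<Longrightarrow> x_coeff (f j) = 0" for j
  proof (induction j rule: less_induct)
    case (less j)
    have "0 = x_coeff (\<Sum>j'\<in>pivots. f j' * pivot_syz j' j)"
      using \<open>\<forall>i<r. (\<Sum>j\<in>pivots. f j * pivot_syz j i) = 0\<close> pivots_less[OF less.prems] by simp
    also have "\<dots> = (\<Sum>j'\<in>pivots. if j' = j then x_coeff (f j) else 0)"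
      unfolding x_coeff_sum
    proof (rule sum.cong[OF refl])
      fix j' assume j': "j' \<in> pivots"
      show "x_coeff (f j' * pivot_syz j' j) = (if j' = j then x_coeff (f j) else 0)"
        using pivot_syz[OF j'] less.IH[of j'] j' by (cases j' j rule: linorder_cases) (auto simp: has_pivot_def)
    qed
    also have "\<dots> = x_coeff (f j)" using less.prems finite_pivots by simp
    finally show ?case by simp
  qed
  have "\<forall>j. \<exists>PQ. j \<in> pivots \<longrightarrow> f j = Var 1 * fst PQ + Var 2 * snd PQ \<and> 
      shifted_homogeneous (Suc (pivot_degree j)) d (fst PQ) \<and> shifted_homogeneous (Suc (pivot_degree j)) d (snd PQ)"
  proof
    fix j
    show "\<exists>PQ. j \<in> pivots \<longrightarrow> f j = Var 1 * fst PQ + Var 2 * snd PQ \<and> 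
      shifted_homogeneous (Suc (pivot_degree j)) d (fst PQ) \<and> shifted_homogeneous (Suc (pivot_degree j)) d (snd PQ)"
    proof (cases "j \<in> pivots")
      case True
      then obtain P Q where "f j = Var 1 * P + Var 2 * Q" 
        "shifted_homogeneous (Suc (pivot_degree j)) d P" "shifted_homogeneous (Suc (pivot_degree j)) d Q"
        using shifted_homogeneous_div_yz[of "pivot_degree j" d "f j"] less.prems(1) x by blast
      then show ?thesis by (intro exI[of _ "(P, Q)"]) simp
    qed simp
  qed
  from choice[OF this] obtain PQ where PQ: "\<forall>j\<in>pivots. f j = Var 1 * fst (PQ j) + Var 2 * snd (PQ j) \<and> 
      shifted_homogeneous (Suc (pivot_degree j)) d (fst (PQ j)) \<and> shifted_homogeneous (Suc (pivot_degree j)) d (snd (PQ j))" by blast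
  define p q where "p j = fst (PQ j)" and "q j = snd (PQ j)" for j
  have fpq: "f j = Var 1 * p j + Var 2 * q j" and p: "shifted_homogeneous (Suc (pivot_degree j)) d (p j)"
    and q: "shifted_homogeneous (Suc (pivot_degree j)) d (q j)" if "j \<in> pivots" for j
    using PQ that by (auto simp: p_def q_def)
  show ?case
  proof (cases d)
    case 0
    then have "f j = 0" if "j \<in> pivots" for j
      using fpq[OF that] p[OF that] q[OF that] by (simp add: shifted_homogeneous_iff)
    then show ?thesis by blast
  next
    case (Suc d')
    define A B where "A i = (\<Sum>j\<in>pivots. p j * pivot_syz j i)" and "B i = (\<Sum>j\<in>pivots. q j * pivot_syz j i)" for i
    have AB: "Var 1 * A i + Var 2 * B i = 0" if "i < r" for i
    proof -
      have "(\<Sum>j\<in>pivots. f j * pivot_syz j i) = (\<Sum>j\<in>pivots. (Var 1 * p j + Var 2 * q j) * pivot_syz j i)"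
        by (rule sum.cong) (auto simp: fpq)
      then show ?thesis using less.prems(2) that by (simp add: A_def B_def sum_yz_distrib)
    qed
    have hA: "shifted_homogeneous (a i) d' (A i)" if "i < r" for i
      unfolding A_def
    proof (rule shifted_homogeneous_sum)
      fix j assume j: "j \<in> pivots"
      have "shifted_homogeneous (pivot_degree j) d' (p j)" using p[OF j] by (simp add: Suc)
      then show "shifted_homogeneous (a i) d' (p j * pivot_syz j i)"
        by (rule shifted_homogeneous_mult[OF _ pivot_syz_homogeneous[OF j that]])
    qed
    have "\<forall>i. \<exists>t. i < r \<longrightarrow> A i = Var 2 * t \<and> B i = - (Var 1 * t) \<and> shifted_homogeneous (Suc (a i)) d' t"
      using shifted_homogeneous_koszul hA AB by metis
    from choice[OF this] obtain w where w: "\<And>i. i < r \<Longrightarrow> A i = Var 2 * w i" "\<And>i. i < r \<Longrightarrow> B i = - (Var 1 * w i)" 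
      "\<And>i. i < r \<Longrightarrow> shifted_homogeneous (Suc (a i)) d' (w i)" by blast
    have "Var 2 * (\<Sum>i<r. w i * g i) = (\<Sum>i<r. A i * g i)"
      unfolding sum_distrib_left by (rule sum.cong) (simp_all add: w(1) mult.assoc)
    also have "\<dots> = (\<Sum>j\<in>pivots. p j * (\<Sum>i<r. pivot_syz j i * g i))"
      unfolding A_def sum_distrib_left sum_distrib_right by (subst sum.swap) (simp add: mult.assoc)
    also have "\<dots> = 0" by (rule sum.neutral) (use pivot_syz in \<open>auto simp: has_pivot_def syz_def\<close>)
    finally have wg: "(\<Sum>i<r. w i * g i) = 0" by simp
    obtain v where v: "\<And>j. j \<in> pivots \<Longrightarrow> shifted_homogeneous (Suc (pivot_degree j)) d' (v j)" 
      "\<And>i. i < r \<Longrightarrow> w i = (\<Sum>j\<in>pivots. v j * pivot_syz j i)"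
    proof (cases d')
      case 0
      then have "w i = 0" if "i < r" for i using w(3)[OF that] by (simp add: shifted_homogeneous_iff)
      then show thesis using that[of "\<lambda>_. 0"] by simp
    next
      case (Suc d'')
      have "syz d'' w" using w(3) wg by (simp add: syz_def Suc)
      from syz_generated[OF this] that show thesis by (auto simp: Suc)
    qed
    have "\<forall>j\<in>pivots. p j - Var 2 * v j = 0"
    proof (rule less.IH[of d'])
      show "\<forall>j\<in>pivots. shifted_homogeneous (pivot_degree j) d' (p j - Var 2 * v j)"
        using p v(1) by (auto simp: Suc intro!: shifted_homogeneous_diff shifted_homogeneous_Var_mult)
      show "\<forall>i<r. (\<Sum>j\<in>pivots. (p j - Var 2 * v j) * pivot_syz j i) = 0"
        unfolding sum_diff_distrib using w(1) v(2) by (simp add: A_def)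
    qed (simp add: Suc)
    moreover have "\<forall>j\<in>pivots. q j + Var 1 * v j = 0"
    proof (rule less.IH[of d'])
      show "\<forall>j\<in>pivots. shifted_homogeneous (pivot_degree j) d' (q j + Var 1 * v j)"
        using q v(1) by (auto simp: Suc intro!: shifted_homogeneous_add shifted_homogeneous_Var_mult)
      show "\<forall>i<r. (\<Sum>j\<in>pivots. (q j + Var 1 * v j) * pivot_syz j i) = 0"
        unfolding sum_add_distrib using w(2) v(2) by (simp add: B_def)
    qed (simp add: Suc)
    ultimately have pq: "p j = Var 2 * v j" "q j = - (Var 1 * v j)" if "j \<in> pivots" for j
      using that by (auto simp: eq_neg_iff_add_eq_0)
    have "f j = 0" if "j \<in> pivots" for j
      unfolding fpq[OF that] pq[OF that] by (simp add: mult.left_commute)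
    then show ?thesis by blast
  qed
qed

text \<open>The graded statements extend to arbitrary vectors, because taking shifted components
  commutes with the maps given by the generators and by the matrix of pivot syzygies.\<close>

theorem min_graded_free_resolution_exists:
  "\<exists>s b M. min_graded_free_resolution I r a s b (vec r g) M"
proof -
  define s where "s = card pivots"
  obtain h where h: "bij_betw h {..<s} pivots"
    using ex_bij_betw_nat_finite[OF finite_pivots] by (auto simp: s_def atLeast0LessThan)
  have hp: "h j \<in> pivots" if "j < s" for j using h that by (auto simp: bij_betw_def)
  define M where "M = mat r s (\<lambda>(i, j). pivot_syz (h j) i)"
  have g_scalar: "vec r g \<bullet> u = (\<Sum>i<r. u $ i * g i)" if "u \<in> carrier_vec r" for u
    using that by (auto simp: scalar_prod_def atLeast0LessThan mult.commute intro!: sum.cong)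
  have M_index: "(M *\<^sub>v w) $ i = (\<Sum>j<s. w $ j * pivot_syz (h j) i)" if "w \<in> carrier_vec s" "i < r" for w i
    using that by (auto simp: M_def mult_mat_vec_def scalar_prod_def row_def atLeast0LessThan mult.commute intro!: sum.cong)
  have reindex: "(\<Sum>j\<in>pivots. f j) = (\<Sum>j<s. f (h j))" for f :: "nat \<Rightarrow> 'k ternary"
    by (rule sum.reindex_bij_betw[OF h, symmetric])
  have image: "(\<lambda>u. vec r g \<bullet> u) ` carrier_vec r = I"
  proof (intro equalityI subsetI)
    fix F assume "F \<in> (\<lambda>u. vec r g \<bullet> u) ` carrier_vec r"
    then obtain u where "F = (\<Sum>i<r. u $ i * g i)" using g_scalar by auto
    then show "F \<in> I"
      by (auto intro!: ring_ideal.subspace_sum[OF ideal] ring_ideal.subspace_scale[OF ideal] g_mem)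
  next
    fix F assume F: "F \<in> I"
    obtain N where N: "F = (\<Sum>d\<le>N. hcomp d F)" by (rule hcomp_bound)
    have "\<forall>d. \<exists>u. hcomp d F = (\<Sum>i<r. u i * g i)"
      using gen[OF hcomp_mem[OF F] homogeneous_hcomp] by blast
    from choice[OF this] obtain u where u: "\<forall>d. hcomp d F = (\<Sum>i<r. u d i * g i)" by blast
    have "F = (\<Sum>d\<le>N. \<Sum>i<r. u d i * g i)" by (rule trans[OF N]) (intro sum.cong refl u[rule_format])
    also have "\<dots> = (\<Sum>i<r. (\<Sum>d\<le>N. u d i) * g i)" by (subst sum.swap) (simp add: sum_distrib_right)
    also have "\<dots> = vec r g \<bullet> vec r (\<lambda>i. \<Sum>d\<le>N. u d i)" by (subst g_scalar) auto
    finally show "F \<in> (\<lambda>u. vec r g \<bullet> u) ` carrier_vec r" by (rule image_eqI) simp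
  qed
  have kernel: "{u \<in> carrier_vec r. vec r g \<bullet> u = 0} = (\<lambda>w. M *\<^sub>v w) ` carrier_vec s"
  proof (intro equalityI subsetI)
    fix u assume "u \<in> (\<lambda>w. M *\<^sub>v w) ` carrier_vec s"
    then obtain w where w: "w \<in> carrier_vec s" "u = M *\<^sub>v w" by blast
    have u: "u \<in> carrier_vec r" unfolding w(2) by (rule carrier_vecI) (simp add: M_def)
    have "vec r g \<bullet> u = (\<Sum>i<r. (\<Sum>j<s. w $ j * pivot_syz (h j) i) * g i)"
      unfolding g_scalar[OF u] by (rule sum.cong) (auto simp: w(2) M_index[OF w(1)])
    also have "\<dots> = (\<Sum>j<s. w $ j * (\<Sum>i<r. pivot_syz (h j) i * g i))"
      unfolding sum_distrib_left sum_distrib_right by (subst sum.swap) (simp add: mult.assoc)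
    also have "\<dots> = 0" by (rule sum.neutral) (use pivot_syz hp in \<open>auto simp: has_pivot_def syz_def\<close>)
    finally show "u \<in> {u \<in> carrier_vec r. vec r g \<bullet> u = 0}" using u by simp
  next
    fix u assume "u \<in> {u \<in> carrier_vec r. vec r g \<bullet> u = 0}"
    then have u: "u \<in> carrier_vec r" "(\<Sum>i<r. u $ i * g i) = 0" using g_scalar by auto
    obtain N where N: "\<And>i. i < r \<Longrightarrow> u $ i = (\<Sum>d\<le>N. shifted_comp (a i) d (u $ i))"
      using shifted_comp_decompose_family[of "{..<r}" "\<lambda>i. u $ i" a] by auto
    have "syz d (\<lambda>i. shifted_comp (a i) d (u $ i))" for d
    proof -
      have "shifted_comp (a i) d (u $ i) * g i = shifted_comp 0 d (u $ i * g i)" if "i < r" for i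
        by (rule shifted_comp_mult[symmetric]) (simp add: shifted_homogeneous_0_iff hom_g that)
      then have "(\<Sum>i<r. shifted_comp (a i) d (u $ i) * g i) = shifted_comp 0 d (\<Sum>i<r. u $ i * g i)"
        unfolding shifted_comp_sum by (intro sum.cong) auto
      then show ?thesis using u(2) by (simp add: syz_def) (simp add: shifted_comp_def)
    qed
    then have "\<forall>d. \<exists>f. \<forall>i<r. shifted_comp (a i) d (u $ i) = (\<Sum>j\<in>pivots. f j * pivot_syz j i)"
      using syz_generated by blast
    from choice[OF this] obtain f where 
      f: "\<And>d i. i < r \<Longrightarrow> shifted_comp (a i) d (u $ i) = (\<Sum>j\<in>pivots. f d j * pivot_syz j i)" by blast
    define w where "w = vec s (\<lambda>j. \<Sum>d\<le>N. f d (h j))"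
    have "u = M *\<^sub>v w"
    proof (rule eq_vecI)
      show "dim_vec u = dim_vec (M *\<^sub>v w)" using u(1) by (simp add: M_def)
      fix i assume "i < dim_vec (M *\<^sub>v w)"
      then have i: "i < r" by (simp add: M_def)
      have "u $ i = (\<Sum>d\<le>N. \<Sum>j<s. f d (h j) * pivot_syz (h j) i)"
        by (subst N[OF i]) (simp add: f[OF i] reindex)
      also have "\<dots> = (\<Sum>j<s. w $ j * pivot_syz (h j) i)"
        by (subst sum.swap) (simp add: w_def sum_distrib_right)
      also have "\<dots> = (M *\<^sub>v w) $ i" by (rule M_index[symmetric]) (auto simp: i w_def)
      finally show "u $ i = (M *\<^sub>v w) $ i" .
    qed
    then show "u \<in> (\<lambda>w. M *\<^sub>v w) ` carrier_vec s" by (auto simp: w_def)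
  qed
  have inj: "inj_on (\<lambda>w. M *\<^sub>v w) (carrier_vec s)"
  proof (rule inj_onI)
    fix w w' assume w: "w \<in> carrier_vec s" and w': "w' \<in> carrier_vec s" and eq: "M *\<^sub>v w = M *\<^sub>v w'"
    define hi where "hi = inv_into {..<s} h"
    have hi: "hi (h j) = j" if "j < s" for j using h that by (simp add: hi_def bij_betw_def inv_into_f_f)
    define v where "v j = w $ hi j - w' $ hi j" for j
    have v0: "(\<Sum>j\<in>pivots. v j * pivot_syz j i) = 0" if "i < r" for i
    proof -
      have "(\<Sum>j\<in>pivots. v j * pivot_syz j i) = (\<Sum>j<s. (w $ j - w' $ j) * pivot_syz (h j) i)"
        unfolding reindex by (rule sum.cong) (auto simp: v_def hi)
      also have "\<dots> = (M *\<^sub>v w) $ i - (M *\<^sub>v w') $ i"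
        by (simp add: M_index w w' that left_diff_distrib sum_subtractf)
      finally show ?thesis by (simp add: eq)
    qed
    have "shifted_comp (pivot_degree j) d (v j) = 0" if j: "j \<in> pivots" for j d
    proof -
      have "\<forall>j\<in>pivots. shifted_comp (pivot_degree j) d (v j) = 0"
      proof (rule syz_independent[of d])
        show "\<forall>i<r. (\<Sum>j\<in>pivots. shifted_comp (pivot_degree j) d (v j) * pivot_syz j i) = 0"
        proof (intro allI impI)
          fix i assume i: "i < r"
          have "(\<Sum>j\<in>pivots. shifted_comp (pivot_degree j) d (v j) * pivot_syz j i) = 
              shifted_comp (a i) d (\<Sum>j\<in>pivots. v j * pivot_syz j i)"
            unfolding shifted_comp_sum
            by (intro sum.cong refl shifted_comp_mult[symmetric] pivot_syz_homogeneous i)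
          then show "(\<Sum>j\<in>pivots. shifted_comp (pivot_degree j) d (v j) * pivot_syz j i) = 0"
            using v0[OF i] by (simp add: shifted_comp_def)
        qed
      qed simp
      then show ?thesis using j by blast
    qed
    then have "v j = 0" if "j \<in> pivots" for j
    proof -
      obtain N where "v j = (\<Sum>d\<le>N. shifted_comp (pivot_degree j) d (v j))"
        using shifted_comp_decompose by blast
      also have "\<dots> = 0" using \<open>\<And>j d. j \<in> pivots \<Longrightarrow> shifted_comp (pivot_degree j) d (v j) = 0\<close> that by simp
      finally show ?thesis .
    qed
    then have "v (h j) = 0" if "j < s" for j using hp[OF that] by blast
    then have "w $ j = w' $ j" if "j < s" for j using that hi[OF that] unfolding v_def by fastforce
    then show "w = w'" using w w' by (intro eq_vecI) auto
  qed
  have const: "Poly_Mapping.lookup ((M *\<^sub>v w) $ i) 0 = 0" if "w \<in> carrier_vec s" "i < r" for w i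
  proof -
    have "Poly_Mapping.lookup (pivot_syz (h j) i) 0 = 0" if "j < s" for j
      using minimal[of "pivot_degree (h j)" "pivot_syz (h j)" i] pivot_syz[OF hp[OF that]] \<open>i < r\<close>
      by (simp add: has_pivot_def syz_def)
    then show ?thesis using that
      by (simp add: M_index lookup_0_eq_eval eval_mpoly_eq_subst subst_sum subst_mult)
  qed
  have entries: "exp_degree e + a i = pivot_degree (h j)" 
    if "i < r" "j < s" "e \<in> Poly_Mapping.keys (M $$ (i, j))" for i j e
    using pivot_syz_homogeneous[OF hp[OF that(2)] that(1)] that by (auto simp: M_def shifted_homogeneous_def)
  show ?thesis
    unfolding min_graded_free_resolution_def
  proof (rule exI[of _ s], rule exI[of _ "\<lambda>j. pivot_degree (h j)"], rule exI[of _ M], intro conjI)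
    show "vec r g \<in> carrier_vec r" "M \<in> carrier_mat r s" by (simp_all add: M_def)
    show "\<forall>i<r. homogeneous (a i) (vec r g $ i)" by (simp add: hom_g)
    show "\<forall>i<r. \<forall>j<s. \<forall>e\<in>Poly_Mapping.keys (M $$ (i, j)). exp_degree e + a i = pivot_degree (h j)"
      by (intro allI impI ballI) (rule entries)
    show "\<forall>w\<in>carrier_vec s. \<forall>i<r. Poly_Mapping.lookup ((M *\<^sub>v w) $ i) 0 = 0"
      by (intro allI impI ballI) (rule const)
  qed (fact image kernel inj)+
qed

end

section \<open>Generators of saturated ideals with the expected Hilbert function\<close>

lemma homogeneous_split:
  fixes F :: "'k::field ternary"
  assumes "homogeneous (Suc d) F"
  shows "\<exists>A B C. homogeneous d A \<and> homogeneous d B \<and> homogeneous d C \<and> F = Var 0 * A + Var 1 * B + Var 2 * C"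
proof -
  define A :: "'k ternary" where "A = const (x_coeff F) * Var 0 ^ d"
  have A: "homogeneous d A"
    unfolding A_def using homogeneous_power[OF homogeneous_Var(1)[of 0], of d] by (auto intro!: homogeneous_const_mult)
  have "homogeneous (Suc d) (F - Var 0 * A)"
    by (intro homogeneous_diff assms homogeneous_Var_mult A)
  then have "shifted_homogeneous 0 (Suc d) (F - Var 0 * A)" by (simp add: shifted_homogeneous_0_iff)
  moreover have "x_coeff (F - Var 0 * A) = 0" by (simp add: A_def)
  ultimately obtain B C where BC: "F - Var 0 * A = Var 1 * B + Var 2 * C" 
    "shifted_homogeneous (Suc 0) (Suc d) B" "shifted_homogeneous (Suc 0) (Suc d) C"
    using shifted_homogeneous_div_yz by blast
  have "F = Var 0 * A + Var 1 * B + Var 2 * C" using BC(1) by (simp add: algebra_simps)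
  with A BC(2,3) show ?thesis by (auto simp: shifted_homogeneous_0_iff)
qed

lemma sum_lessThan_add: 
  fixes a b :: nat
  shows "(\<Sum>i<a + b. f i) = (\<Sum>i<a. f i) + (\<Sum>i<b. f (a + i) :: 'a::comm_monoid_add)"
  by (induction b) (simp_all add: add.assoc)

text \<open>The last assumption says that z is a nonzerodivisor modulo I. For fat points it is
  secured by keeping all points off the line z = 0, a generic condition.\<close>

locale saturated_ideal =
  fixes I :: "'k::field ternary set"
  assumes ideal: "ring_ideal.subspace I"
    and hcomp_mem: "F \<in> I \<Longrightarrow> hcomp d F \<in> I"
    and sat: "homogeneous d F \<Longrightarrow> Var 2 * F \<in> I \<Longrightarrow> F \<in> I"
begin

lemma mult_mem: "F \<in> I \<Longrightarrow> G * F \<in> I"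
  using ring_ideal.subspace_scale[OF ideal] by blast

lemma subspace_graded_part: "mpoly_space.subspace (graded_part I t)"
  by (rule mpoly_space.subspaceI) 
    (auto simp: graded_part_def scale_mpoly_const ring_ideal.subspace_0[OF ideal] 
      intro: homogeneous_add homogeneous_const_mult mult_mem ring_ideal.subspace_add[OF ideal])

lemma graded_part_subset: "graded_part I t \<subseteq> {F. homogeneous t F}"
  by (auto simp: graded_part_def)

lemma basis_exists: "\<exists>f. basis_of (hilbert I t) f (graded_part I t)"
  unfolding hilbert_def by (rule basis_of_exists[OF subspace_graded_part graded_part_subset])

lemma Var_mult_mem: "F \<in> graded_part I t \<Longrightarrow> Var i * F \<in> graded_part I (Suc t)"
  by (auto simp: graded_part_def intro: mult_mem homogeneous_Var_mult)

lemma comb_mem: "(\<And>i. i \<in> A \<Longrightarrow> f i \<in> graded_part I t) \<Longrightarrow> (\<Sum>i\<in>A. const (c i) * f i) \<in> graded_part I t"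
  by (intro mpoly_space.subspace_sum[OF subspace_graded_part] subspace_const_mult[OF subspace_graded_part])

lemma graded_part_eq_0_iff: "graded_part I t = {0} \<longleftrightarrow> hilbert I t = 0"
  unfolding hilbert_def using dim_eq_0_iff[OF subspace_graded_part graded_part_subset] by simp

text \<open>By saturation the intersection of z R_t with I_(t+1) is z I_t, so z R_t + I_(t+1) has
  dimension dim R_t + (t + 2), which is dim R_(t+1).\<close>

lemma complement:
  assumes growth: "hilbert I (Suc t) = hilbert I t + t + 2" and F: "homogeneous (Suc t) F"
  shows "\<exists>G H. homogeneous t G \<and> H \<in> graded_part I (Suc t) \<and> F = Var 2 * G + H"
proof -
  define h D where "h = hilbert I t" and "D = (t + 1) * (t + 2) div 2"
  obtain f0 where f0: "basis_of h f0 (graded_part I t)" using basis_exists h_def by blast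
  obtain f where f: "basis_of D f {F :: 'k ternary. homogeneous t F}" "h \<le> D" "\<forall>i<h. f i = f0 i"
    using basis_of_extend[OF subspace_homogeneous order_refl, of h f0 t] f0
    by (auto simp: basis_of_def D_def dim_homogeneous graded_part_def)
  have f_indep: "lin_indep D f" and f_hom: "\<And>i. i < D \<Longrightarrow> homogeneous t (f i)" 
    using f(1) by (auto simp: basis_of_def)
  have fI: "f i \<in> graded_part I t" if "i < h" for i using f(3) f0 that by (auto simp: basis_of_def)
  have zf: "lin_indep h (\<lambda>i. Var 2 * f i)"
    unfolding lin_indep_def
  proof (intro allI impI)
    fix c i assume *: "(\<Sum>i<h. const (c i) * (Var 2 * f i)) = 0" "i < h"
    have "(\<Sum>i<h. const (c i) * (Var 2 * f i)) = Var 2 * (\<Sum>i<h. const (c i) * f i)"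
      by (simp add: sum_distrib_left mult.left_commute)
    then have "(\<Sum>i<h. const (c i) * f i) = 0" using *(1) by simp
    moreover have "(\<Sum>i<h. const (c i) * f i) = (\<Sum>i<h. const (c i) * f0 i)"
      by (rule sum.cong) (use f(3) in auto)
    ultimately show "c i = 0" using f0 *(2) by (auto simp: basis_of_def lin_indep_def)
  qed
  obtain k where k: "basis_of (h + (t + 2)) k (graded_part I (Suc t))" "\<forall>i<h. k i = Var 2 * f i"
    using basis_of_extend[OF subspace_graded_part graded_part_subset zf, of "Suc t"] Var_mult_mem fI growth
    by (auto simp: hilbert_def h_def add.assoc)
  have k_indep: "lin_indep (h + (t + 2)) k" and kI: "\<And>i. i < h + (t + 2) \<Longrightarrow> k i \<in> graded_part I (Suc t)" 
    using k(1) by (auto simp: basis_of_def)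
  \<comment> \<open>The z-multiples of a basis of R_t, followed by the t + 2 basis elements of
    I_(t+1) that extend the z-multiples of a basis of I_t.\<close>
  define \<phi> where "\<phi> i = (if i < D then Var 2 * f i else k (h + (i - D)))" for i
  have \<phi>_sum: "(\<Sum>i<D + (t + 2). const (c i) * \<phi> i) = 
      Var 2 * (\<Sum>i<D. const (c i) * f i) + (\<Sum>i<t + 2. const (c (D + i)) * k (h + i))" for c
    unfolding sum_lessThan_add by (simp add: \<phi>_def sum_distrib_left mult.left_commute)
  have "lin_indep (D + (t + 2)) \<phi>"
    unfolding lin_indep_def
  proof (rule allI, rule impI)
    fix c assume *: "(\<Sum>i<D + (t + 2). const (c i) * \<phi> i) = 0"
    define P where "P = (\<Sum>i<D. const (c i) * f i)"
    define Q where "Q = (\<Sum>i<t + 2. const (c (D + i)) * k (h + i))"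
    have PQ: "Var 2 * P + Q = 0" using * unfolding \<phi>_sum P_def Q_def .
    have "Q \<in> graded_part I (Suc t)" unfolding Q_def by (rule comb_mem) (simp add: kI)
    then have "- Q \<in> I" using mult_mem[of Q "- 1"] by (simp add: graded_part_def)
    moreover have "Var 2 * P = - Q" using PQ by (simp add: eq_neg_iff_add_eq_0)
    moreover have hP: "homogeneous t P" unfolding P_def
      by (rule homogeneous_sum, rule homogeneous_const_mult) (simp add: f_hom)
    ultimately have "P \<in> graded_part I t" using sat[OF hP] by (simp add: graded_part_def)
    then obtain e where e: "P = (\<Sum>i<h. const (e i) * f0 i)" using f0 by (auto simp: basis_of_def)
    have "(\<Sum>i<D. const (c i - (if i < h then e i else 0)) * f i) = 
        P - (\<Sum>i<D. if i < h then const (e i) * f i else 0)"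
      unfolding P_def sum_subtractf[symmetric] by (rule sum.cong) (auto simp: const_hom left_diff_distrib)
    also have "(\<Sum>i<D. if i < h then const (e i) * f i else 0) = (\<Sum>i<h. const (e i) * f0 i)"
      by (rule sum.mono_neutral_cong_right) (use f(2,3) in auto)
    finally have "(\<Sum>i<D. const (c i - (if i < h then e i else 0)) * f i) = 0" using e by simp
    then have c_D: "c i = (if i < h then e i else 0)" if "i < D" for i
      using f_indep[unfolded lin_indep_def, rule_format, of "\<lambda>i. c i - (if i < h then e i else 0)" i] that by simp
    have "Var 2 * P = (\<Sum>i<h. const (c i) * k i)"
      unfolding e sum_distrib_left by (rule sum.cong) (use c_D f(2,3) k(2) in \<open>auto simp: mult.left_commute\<close>)
    then have "(\<Sum>i<h + (t + 2). const (if i < h then c i else c (D + (i - h))) * k i) = 0"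
      using PQ unfolding sum_lessThan_add Q_def by simp
    then have kc: "(if i < h then c i else c (D + (i - h))) = 0" if "i < h + (t + 2)" for i
      using k_indep[unfolded lin_indep_def, rule_format, of "\<lambda>i. if i < h then c i else c (D + (i - h))" i] that by blast
    have "c i = 0" if "i < D + (t + 2)" for i
    proof (cases "i < D")
      case True
      then show ?thesis using c_D[OF True] kc[of i] by auto
    next
      case False
      then obtain j where "i = D + j" using le_Suc_ex not_less by blast
      then show ?thesis using kc[of "h + j"] that by simp
    qed
    then show "\<forall>i<D + (t + 2). c i = 0" by blast
  qed
  moreover have "\<phi> i \<in> {F. homogeneous (Suc t) F}" if "i < D + (t + 2)" for i
    using that kI[of "h + (i - D)"] by (auto simp: \<phi>_def graded_part_def intro!: homogeneous_Var_mult f_hom)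
  moreover have "D + (t + 2) = mpoly_space.dim {F :: 'k ternary. homogeneous (Suc t) F}"
  proof -
    have "(Suc t + 1) * (Suc t + 2) = (t + 1) * (t + 2) + (t + 2) * 2" by (simp add: algebra_simps)
    then show ?thesis unfolding dim_homogeneous D_def by simp
  qed
  ultimately have "basis_of (D + (t + 2)) \<phi> {F. homogeneous (Suc t) F}"
    by (rule lin_indep_dim_basis[OF subspace_homogeneous order_refl])
  then obtain c where "F = (\<Sum>i<D + (t + 2). const (c i) * \<phi> i)" using F by (auto simp: basis_of_def)
  then have "F = Var 2 * (\<Sum>i<D. const (c i) * f i) + (\<Sum>i<t + 2. const (c (D + i)) * k (h + i))"
    by (simp only: \<phi>_sum)
  moreover have "(\<Sum>i<t + 2. const (c (D + i)) * k (h + i)) \<in> graded_part I (Suc t)"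
    by (rule comb_mem) (simp add: kI)
  moreover have "homogeneous t (\<Sum>i<D. const (c i) * f i)"
    by (rule homogeneous_sum, rule homogeneous_const_mult) (simp add: f_hom)
  ultimately show ?thesis by blast
qed

text \<open>Castelnuovo--Mumford regularity, by hand: the coefficients of \<open>x\<close> and \<open>y\<close> can be moved into \<open>I\<close>.\<close>

lemma generated_by_linear_multiples:
  assumes growth: "hilbert I (Suc t) = hilbert I t + t + 2" and F: "F \<in> graded_part I (Suc (Suc t))"
  shows "\<exists>A\<in>graded_part I (Suc t). \<exists>B\<in>graded_part I (Suc t). \<exists>C\<in>graded_part I (Suc t). 
    F = Var 0 * A + Var 1 * B + Var 2 * C"
proof -
  have "homogeneous (Suc (Suc t)) F" using F by (simp add: graded_part_def)
  then obtain A B C where ABC: "homogeneous (Suc t) A" "homogeneous (Suc t) B" "homogeneous (Suc t) C" 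
    "F = Var 0 * A + Var 1 * B + Var 2 * C" using homogeneous_split by blast
  obtain A' A'' where A: "homogeneous t A'" "A'' \<in> graded_part I (Suc t)" "A = Var 2 * A' + A''"
    using complement[OF growth ABC(1)] by blast
  obtain B' B'' where B: "homogeneous t B'" "B'' \<in> graded_part I (Suc t)" "B = Var 2 * B' + B''"
    using complement[OF growth ABC(2)] by blast
  \<comment> \<open>The terms x z A' and y z B' are reassigned to the coefficient of z. Then z C''
    is a difference of members of I, and saturation gives C'' itself.\<close>
  define C'' where "C'' = Var 0 * A' + Var 1 * B' + C"
  have F_eq: "F = Var 0 * A'' + Var 1 * B'' + Var 2 * C''"
    unfolding ABC(4) A(3) B(3) C''_def by (simp add: algebra_simps)
  have hC: "homogeneous (Suc t) C''"
    unfolding C''_def by (intro homogeneous_add homogeneous_Var_mult A B ABC)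
  have "Var 0 * A'' + Var 1 * B'' \<in> I"
    using A(2) B(2) by (auto simp: graded_part_def intro!: ring_ideal.subspace_add[OF ideal] mult_mem)
  moreover have "Var 2 * C'' = F - (Var 0 * A'' + Var 1 * B'')" using F_eq by simp
  ultimately have "Var 2 * C'' \<in> I"
    using F ring_ideal.subspace_diff[OF ideal] by (simp add: graded_part_def)
  then have "C'' \<in> graded_part I (Suc t)" using sat[OF hC] hC by (simp add: graded_part_def)
  then show ?thesis using A(2) B(2) F_eq by blast
qed

text \<open>The \<open>k i\<close> are representatives of a basis of I_(\<alpha>+1) modulo the image
  of \<mu>. Minimality: in a relation of degree d only generators of degree d can have constant
  coefficients. For d = \<alpha> these are zero by independence of \<open>f\<close>, for d =
  \<alpha> + 1 by \<open>indep\<close>.\<close>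

lemma resolution_from_generators:
  fixes \<alpha> h l :: nat
  assumes low: "\<And>t. t < \<alpha> \<Longrightarrow> graded_part I t = {0}"
    and growth: "\<And>t. \<alpha> \<le> t \<Longrightarrow> hilbert I (Suc t) = hilbert I t + t + 2"
    and f: "basis_of h f (graded_part I \<alpha>)"
    and k: "\<And>i. i < l \<Longrightarrow> k i \<in> graded_part I (Suc \<alpha>)"
    and span: "\<And>F. F \<in> graded_part I (Suc \<alpha>) \<Longrightarrow> 
      \<exists>A\<in>graded_part I \<alpha>. \<exists>B\<in>graded_part I \<alpha>. \<exists>C\<in>graded_part I \<alpha>. \<exists>c. 
        F = Var 0 * A + Var 1 * B + Var 2 * C + (\<Sum>i<l. const (c i) * k i)"
    and indep: "\<And>A B C c i. A \<in> graded_part I \<alpha> \<Longrightarrow> B \<in> graded_part I \<alpha> \<Longrightarrow> C \<in> graded_part I \<alpha> \<Longrightarrow>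
      Var 0 * A + Var 1 * B + Var 2 * C + (\<Sum>i<l. const (c i) * k i) = 0 \<Longrightarrow> i < l \<Longrightarrow> c i = 0"
  shows "\<exists>a s b g M. min_graded_free_resolution I (h + l) a s b g M"
proof -
  define a where "a i = (if i < h then \<alpha> else Suc \<alpha>)" for i
  define g where "g i = (if i < h then f i else k (i - h))" for i
  have fI: "f i \<in> graded_part I \<alpha>" if "i < h" for i using f that by (simp add: basis_of_def)
  have f_indep: "(\<Sum>i<h. const (c i) * f i) = 0 \<Longrightarrow> i < h \<Longrightarrow> c i = 0" for c i
    using f by (auto simp: basis_of_def lin_indep_def)
  have g_sum: "(\<Sum>i<h + l. u i * g i) = (\<Sum>i<h. u i * f i) + (\<Sum>i<l. u (h + i) * k i)" for u
    unfolding sum_lessThan_add by (simp add: g_def)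
  have g_graded: "g i \<in> graded_part I (a i)" if "i < h + l" for i
    using that fI k[of "i - h"] by (auto simp: g_def a_def)
  let ?gen = "\<lambda>d F u. (\<forall>i<h + l. shifted_homogeneous (a i) d (u i)) \<and> F = (\<Sum>i<h + l. u i * g i)"
  have gen_Var: "\<exists>u. ?gen (Suc d) (Var 0 * A + Var 1 * B + Var 2 * C) u"
    if "\<exists>u. ?gen d A u" "\<exists>u. ?gen d B u" "\<exists>u. ?gen d C u" for d A B C
  proof -
    obtain u v w where u: "?gen d A u" and v: "?gen d B v" and w: "?gen d C w" using \<open>\<exists>u. ?gen d A u\<close> \<open>\<exists>u. ?gen d B u\<close> \<open>\<exists>u. ?gen d C u\<close> by blast
    define x where "x i = Var 0 * u i + Var 1 * v i + Var 2 * w i" for i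
    have "shifted_homogeneous (a i) (Suc d) (x i)" if "i < h + l" for i
      unfolding x_def using u v w that
      by (intro shifted_homogeneous_add shifted_homogeneous_Var_mult) simp_all
    moreover have "(\<Sum>i<h + l. x i * g i) = Var 0 * A + Var 1 * B + Var 2 * C"
      using u v w unfolding x_def by (simp add: distrib_right sum.distrib sum_distrib_left mult.assoc)
    ultimately show ?thesis by (intro exI[of _ x]) simp
  qed
  have gen: "\<exists>u. ?gen d F u" if "F \<in> graded_part I d" for d F
    using that
  proof (induction d arbitrary: F rule: less_induct)
    case (less d)
    consider "d < \<alpha>" | "d = \<alpha>" | "d = Suc \<alpha>" | t where "d = Suc (Suc t)" "\<alpha> \<le> t"
      by (metis Suc_le_D le_neq_implies_less not_less not_less_eq_eq)
    then show ?case
    proof cases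
      case 1
      then have "F = 0" using low less.prems by blast
      then show ?thesis by (intro exI[of _ "\<lambda>_. 0"]) simp
    next
      case 2
      then obtain c where "F = (\<Sum>i<h. const (c i) * f i)" using f less.prems by (auto simp: basis_of_def)
      then show ?thesis
        by (intro exI[of _ "\<lambda>i. if i < h then const (c i) else 0"]) 
          (auto simp: g_sum 2 a_def shifted_homogeneous_iff)
    next
      case 3
      obtain A B C c where ABC: "A \<in> graded_part I \<alpha>" "B \<in> graded_part I \<alpha>" "C \<in> graded_part I \<alpha>"
        and F: "F = Var 0 * A + Var 1 * B + Var 2 * C + (\<Sum>i<l. const (c i) * k i)"
        using span less.prems unfolding 3 by blast
      from gen_Var[of \<alpha> A B C] less.IH ABC 3 obtain u where
        u: "?gen (Suc \<alpha>) (Var 0 * A + Var 1 * B + Var 2 * C) u" by blast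
      define v where "v i = u i + (if i < h then 0 else const (c (i - h)))" for i
      have "shifted_homogeneous (a i) d (v i)" if "i < h + l" for i
      proof -
        have "shifted_homogeneous (a i) (Suc \<alpha>) (if i < h then 0 else const (c (i - h)))"
          by (simp add: a_def shifted_homogeneous_iff)
        then show ?thesis using u that unfolding v_def 3 by (auto intro: shifted_homogeneous_add)
      qed
      moreover have "(\<Sum>i<h + l. v i * g i) = F"
      proof -
        have "(\<Sum>i<h + l. v i * g i) = (\<Sum>i<h + l. u i * g i) + (\<Sum>i<h + l. (if i < h then 0 else const (c (i - h))) * g i)"
          unfolding v_def distrib_right sum.distrib ..
        also have "(\<Sum>i<h + l. (if i < h then 0 else const (c (i - h))) * g i) = (\<Sum>i<l. const (c i) * k i)"
          unfolding g_sum by simp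
        finally show ?thesis using u F by simp
      qed
      ultimately show ?thesis by (intro exI[of _ v]) simp
    next
      case (4 t)
      from generated_by_linear_multiples[OF growth[OF 4(2)]] less.prems 4(1) obtain A B C where
        "A \<in> graded_part I (Suc t)" "B \<in> graded_part I (Suc t)" "C \<in> graded_part I (Suc t)"
        "F = Var 0 * A + Var 1 * B + Var 2 * C" by blast
      then show ?thesis using gen_Var[of "Suc t" A B C] less.IH[of "Suc t"] 4(1) by blast
    qed
  qed
  interpret saturated_generators I "h + l" a g
  proof
    show "ring_ideal.subspace I" by (rule ideal)
    show "hcomp d F \<in> I" if "F \<in> I" for F d by (rule hcomp_mem[OF that])
    show "homogeneous (a i) (g i)" "g i \<in> I" if "i < h + l" for i
      using g_graded[OF that] by (auto simp: graded_part_def)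
    show "\<exists>u. ?gen d F u" if "F \<in> I" "homogeneous d F" for F d
      by (rule gen) (simp add: graded_part_def that)
    show "F \<in> I" if "homogeneous d F" "Var 2 * F \<in> I" for d F by (rule sat[OF that])
    fix d u i assume u: "\<forall>i<h + l. shifted_homogeneous (a i) d (u i)" and eq: "(\<Sum>i<h + l. u i * g i) = 0"
      and i: "i < h + l"
    show "Poly_Mapping.lookup (u i) 0 = 0"
    proof (cases "a i = d")
      case False
      have "\<forall>e\<in>Poly_Mapping.keys (u i). exp_degree e + a i = d" using u i by (simp add: shifted_homogeneous_def)
      with False have "0 \<notin> Poly_Mapping.keys (u i)" using exp_degree_0 by (metis add_0)
      then show ?thesis by (simp add: in_keys_iff)
    next
      case True
      have const: "u j = const (Poly_Mapping.lookup (u j) 0)" if "j < h + l" "a j = d" for j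
        using u that by (intro homogeneous_0_const) (auto simp: shifted_homogeneous_iff)
      show ?thesis
      proof (cases "i < h")
        case i': True
        then have d: "d = \<alpha>" using True by (simp add: a_def)
        have "u (h + j) = 0" if "j < l" for j
          using u that by (auto simp: d a_def shifted_homogeneous_iff)
        then have "(\<Sum>j<h. u j * f j) = 0" using eq unfolding g_sum by simp
        moreover have "(\<Sum>j<h. u j * f j) = (\<Sum>j<h. const (Poly_Mapping.lookup (u j) 0) * f j)"
          by (rule sum.cong[OF refl], subst const) (auto simp: a_def d)
        ultimately show ?thesis using f_indep[of "\<lambda>j. Poly_Mapping.lookup (u j) 0" i] i' by simp
      next
        case i': False
        then have d: "d = Suc \<alpha>" using True by (simp add: a_def)
        \<comment> \<open>Here the coefficients of the generators of degree \<alpha> are linear.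
          Sorting them by variables brings the relation into the shape to which \<open>indep\<close>
          applies.\<close>
        have "\<forall>j. \<exists>T. j < h \<longrightarrow> u j = Var 0 * fst T + Var 1 * fst (snd T) + Var 2 * snd (snd T) \<and> 
          homogeneous 0 (fst T) \<and> homogeneous 0 (fst (snd T)) \<and> homogeneous 0 (snd (snd T))"
        proof
          fix j
          show "\<exists>T. j < h \<longrightarrow> u j = Var 0 * fst T + Var 1 * fst (snd T) + Var 2 * snd (snd T) \<and> 
            homogeneous 0 (fst T) \<and> homogeneous 0 (fst (snd T)) \<and> homogeneous 0 (snd (snd T))"
          proof (cases "j < h")
            case True
            then have "shifted_homogeneous (a j) d (u j)" using u by simp
            then have "homogeneous (Suc 0) (u j)" using True by (simp add: d a_def shifted_homogeneous_iff)
            from homogeneous_split[OF this] obtain A B C where 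
              "homogeneous 0 A" "homogeneous 0 B" "homogeneous 0 C" "u j = Var 0 * A + Var 1 * B + Var 2 * C" by blast
            then show ?thesis by (intro exI[of _ "(A, B, C)"]) simp
          qed simp
        qed
        from choice[OF this] obtain T where T: "\<And>j. j < h \<Longrightarrow> u j = Var 0 * fst (T j) + Var 1 * fst (snd (T j)) + Var 2 * snd (snd (T j))"
          "\<And>j. j < h \<Longrightarrow> homogeneous 0 (fst (T j))" "\<And>j. j < h \<Longrightarrow> homogeneous 0 (fst (snd (T j)))" 
          "\<And>j. j < h \<Longrightarrow> homogeneous 0 (snd (snd (T j)))" by blast
        have mem: "(\<Sum>j<h. e j * f j) \<in> graded_part I \<alpha>" if e: "\<And>j. j < h \<Longrightarrow> homogeneous 0 (e j)" for e
        proof (rule mpoly_space.subspace_sum[OF subspace_graded_part])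
          fix j assume "j \<in> {..<h}"
          then show "e j * f j \<in> graded_part I \<alpha>"
            using fI[of j] homogeneous_mult[OF e, of j \<alpha> "f j"] by (auto simp: graded_part_def intro: mult_mem)
        qed
        have "(\<Sum>j<h. u j * f j) = Var 0 * (\<Sum>j<h. fst (T j) * f j) + Var 1 * (\<Sum>j<h. fst (snd (T j)) * f j) 
            + Var 2 * (\<Sum>j<h. snd (snd (T j)) * f j)"
          unfolding sum_distrib_left sum.distrib[symmetric]
          by (rule sum.cong[OF refl], subst T(1)) (simp_all add: distrib_right mult.assoc)
        moreover have "(\<Sum>j<l. u (h + j) * k j) = (\<Sum>j<l. const (Poly_Mapping.lookup (u (h + j)) 0) * k j)"
          by (rule sum.cong[OF refl], subst const) (auto simp: d a_def)
        ultimately have "Var 0 * (\<Sum>j<h. fst (T j) * f j) + Var 1 * (\<Sum>j<h. fst (snd (T j)) * f j) 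
            + Var 2 * (\<Sum>j<h. snd (snd (T j)) * f j) + (\<Sum>j<l. const (Poly_Mapping.lookup (u (h + j)) 0) * k j) = 0"
          using eq unfolding g_sum by simp
        from indep[OF mem mem mem this, of "i - h"] T(2-4) i i' show ?thesis by simp
      qed
    qed
  qed
  show ?thesis using min_graded_free_resolution_exists by blast
qed

lemma resolution_surjective:
  assumes low: "\<And>t. t < \<alpha> \<Longrightarrow> graded_part I t = {0}"
    and growth: "\<And>t. \<alpha> \<le> t \<Longrightarrow> hilbert I (Suc t) = hilbert I t + t + 2"
    and surj: "\<And>F. F \<in> graded_part I (Suc \<alpha>) \<Longrightarrow> 
      \<exists>A\<in>graded_part I \<alpha>. \<exists>B\<in>graded_part I \<alpha>. \<exists>C\<in>graded_part I \<alpha>. F = Var 0 * A + Var 1 * B + Var 2 * C"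
  shows "\<exists>a s b g M. min_graded_free_resolution I (hilbert I \<alpha>) a s b g M"
proof -
  obtain f where f: "basis_of (hilbert I \<alpha>) f (graded_part I \<alpha>)" using basis_exists by blast
  have "\<exists>a s b g M. min_graded_free_resolution I (hilbert I \<alpha> + 0) a s b g M"
    by (rule resolution_from_generators[OF low growth f, of 0 "\<lambda>_. 0"]) (use surj in simp_all)
  then show ?thesis by simp
qed

text \<open>Injectivity makes the 3 h products of basis elements with variables independent.
  Completing them to a basis of I_(\<alpha>+1) yields exactly the missing generators.\<close>

lemma resolution_injective:
  assumes low: "\<And>t. t < \<alpha> \<Longrightarrow> graded_part I t = {0}"
    and growth: "\<And>t. \<alpha> \<le> t \<Longrightarrow> hilbert I (Suc t) = hilbert I t + t + 2"
    and inj: "\<And>A B C. A \<in> graded_part I \<alpha> \<Longrightarrow> B \<in> graded_part I \<alpha> \<Longrightarrow> C \<in> graded_part I \<alpha> \<Longrightarrow>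
      Var 0 * A + Var 1 * B + Var 2 * C = 0 \<Longrightarrow> A = 0 \<and> B = 0 \<and> C = 0"
  shows "3 * hilbert I \<alpha> \<le> hilbert I (Suc \<alpha>) \<and>
    (\<exists>a s b g M. min_graded_free_resolution I (hilbert I \<alpha> + (hilbert I (Suc \<alpha>) - 3 * hilbert I \<alpha>)) a s b g M)"
proof -
  define h h' where "h = hilbert I \<alpha>" and "h' = hilbert I (Suc \<alpha>)"
  obtain f where f: "basis_of h f (graded_part I \<alpha>)" using basis_exists h_def by blast
  have fI: "f i \<in> graded_part I \<alpha>" if "i < h" for i using f that by (simp add: basis_of_def)
  have f_indep: "(\<Sum>i<h. const (c i) * f i) = 0 \<Longrightarrow> i < h \<Longrightarrow> c i = 0" for c i
    using f by (auto simp: basis_of_def lin_indep_def)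
  define w where "w i = (if i < h then Var 0 * f i else if i < h + h then Var 1 * f (i - h) else Var 2 * f (i - (h + h)))" for i
  have w_sum: "(\<Sum>i<h + h + h. const (c i) * w i) = Var 0 * (\<Sum>i<h. const (c i) * f i) + 
    Var 1 * (\<Sum>i<h. const (c (h + i)) * f i) + Var 2 * (\<Sum>i<h. const (c (h + h + i)) * f i)" for c
    unfolding sum_lessThan_add by (simp add: w_def sum_distrib_left mult.left_commute)
  have w_indep: "lin_indep (h + h + h) w"
    unfolding lin_indep_def
  proof (rule allI, rule impI)
    fix c assume "(\<Sum>i<h + h + h. const (c i) * w i) = 0"
    then have "Var 0 * (\<Sum>i<h. const (c i) * f i) + Var 1 * (\<Sum>i<h. const (c (h + i)) * f i) + 
        Var 2 * (\<Sum>i<h. const (c (h + h + i)) * f i) = 0" by (simp only: w_sum)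
    from inj[OF comb_mem comb_mem comb_mem this] fI have 
      "(\<Sum>i<h. const (c i) * f i) = 0" "(\<Sum>i<h. const (c (h + i)) * f i) = 0" "(\<Sum>i<h. const (c (h + h + i)) * f i) = 0"
      by simp_all
    then have *: "c i = 0" "c (h + i) = 0" "c (h + h + i) = 0" if "i < h" for i
      using f_indep[of c i] f_indep[of "\<lambda>i. c (h + i)" i] f_indep[of "\<lambda>i. c (h + h + i)" i] that by auto
    show "\<forall>i<h + h + h. c i = 0"
    proof (intro allI impI)
      fix i assume "i < h + h + h"
      then consider "i < h" | j where "i = h + j" "j < h" | j where "i = h + h + j" "j < h"
        by (metis add_diff_inverse_nat nat_add_left_cancel_less)
      then show "c i = 0" using * by cases auto
    qed
  qed
  have wI: "w i \<in> graded_part I (Suc \<alpha>)" if "i < h + h + h" for i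
    using that unfolding w_def by (auto intro!: Var_mult_mem fI)
  obtain k where k: "basis_of h' k (graded_part I (Suc \<alpha>))" "h + h + h \<le> h'" "\<forall>i<h + h + h. k i = w i"
    using basis_of_extend[OF subspace_graded_part graded_part_subset w_indep wI] by (auto simp: hilbert_def h'_def)
  define l where "l = h' - (h + h + h)"
  have h': "h' = h + h + h + l" using k(2) by (simp add: l_def)
  have k_sum: "(\<Sum>i<h'. const (c i) * k i) = (\<Sum>i<h + h + h. const (c i) * w i) + (\<Sum>i<l. const (c (h + h + h + i)) * k (h + h + h + i))" for c
    unfolding h' sum_lessThan_add[of _ "h + h + h" l] using k(3) by simp
  have "\<exists>a s b g M. min_graded_free_resolution I (h + l) a s b g M"
  proof (rule resolution_from_generators[OF low growth f, of l "\<lambda>i. k (h + h + h + i)"])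
    show "k (h + h + h + i) \<in> graded_part I (Suc \<alpha>)" if "i < l" for i using k(1) that by (auto simp: basis_of_def h')
    fix F assume "F \<in> graded_part I (Suc \<alpha>)"
    then obtain c where c: "F = (\<Sum>i<h'. const (c i) * k i)" using k(1) by (auto simp: basis_of_def)
    show "\<exists>A\<in>graded_part I \<alpha>. \<exists>B\<in>graded_part I \<alpha>. \<exists>C\<in>graded_part I \<alpha>. \<exists>c. 
        F = Var 0 * A + Var 1 * B + Var 2 * C + (\<Sum>i<l. const (c i) * k (h + h + h + i))"
      unfolding c k_sum w_sum
      by (intro bexI exI[of _ "\<lambda>i. c (h + h + h + i)"], rule refl) (auto intro!: comb_mem fI)
  next
    fix A B C c i assume ABC: "A \<in> graded_part I \<alpha>" "B \<in> graded_part I \<alpha>" "C \<in> graded_part I \<alpha>"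
      and eq: "Var 0 * A + Var 1 * B + Var 2 * C + (\<Sum>i<l. const (c i) * k (h + h + h + i)) = 0" and i: "i < l"
    obtain c0 c1 c2 where c012: "A = (\<Sum>i<h. const (c0 i) * f i)" "B = (\<Sum>i<h. const (c1 i) * f i)" "C = (\<Sum>i<h. const (c2 i) * f i)"
      using f ABC unfolding basis_of_def by blast
    define c' where "c' i = (if i < h then c0 i else if i < h + h then c1 (i - h) else 
      if i < h + h + h then c2 (i - (h + h)) else c (i - (h + h + h)))" for i
    have "(\<Sum>i<h'. const (c' i) * k i) = 0"
      unfolding k_sum w_sum using eq unfolding c012 by (simp add: c'_def)
    moreover have "lin_indep h' k" using k(1) by (simp add: basis_of_def)
    ultimately have "c' (h + h + h + i) = 0" using i unfolding lin_indep_def h' by simp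
    then show "c i = 0" by (simp add: c'_def)
  qed
  moreover have "h + l = hilbert I \<alpha> + (hilbert I (Suc \<alpha>) - 3 * hilbert I \<alpha>)" 
    by (simp add: h_def h'_def l_def)
  moreover have "3 * hilbert I \<alpha> \<le> hilbert I (Suc \<alpha>)" using k(2) by (simp add: h_def h'_def)
  ultimately show ?thesis by simp
qed

end

section \<open>Genericity\<close>

text \<open>A predicate on functions, as elimination multiplies and subtracts functions. The zero
  polynomial has every admissible degree, which keeps the class closed under differences.\<close>

definition multihom_fun :: "nat \<Rightarrow> (nat \<Rightarrow> nat) \<Rightarrow> ((nat \<Rightarrow> 3 \<Rightarrow> 'k::field) \<Rightarrow> 'k) \<Rightarrow> bool" where
  "multihom_fun n d f \<longleftrightarrow> (\<forall>i\<ge>n. d i = 0) \<and>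
    (\<exists>F. (\<forall>e\<in>Poly_Mapping.keys F. \<forall>i. (\<Sum>j\<in>UNIV. Poly_Mapping.lookup e (i, j)) = d i) \<and>
       f = (\<lambda>v. eval_mpoly (\<lambda>(i, j). v i j) F))"

lemma multihom_fun_const: "multihom_fun n (\<lambda>_. 0) (\<lambda>_. c)"
  unfolding multihom_fun_def
  by (intro conjI exI[of _ "const c"]) (auto simp: const_def eval_mpoly_eq_subst subst_single)

lemma multihom_fun_zero: "\<forall>i\<ge>n. d i = 0 \<Longrightarrow> multihom_fun n d (\<lambda>_. 0)"
  unfolding multihom_fun_def by (intro conjI exI[of _ 0]) (auto simp: eval_mpoly_eq_subst)

lemma multihom_fun_coord:
  assumes "i < n" shows "multihom_fun n (\<lambda>i'. if i' = i then 1 else 0) (\<lambda>v. v i j)"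
  unfolding multihom_fun_def
proof (intro conjI exI[of _ "Var (i, j)"] ballI allI)
  fix e i' assume "e \<in> Poly_Mapping.keys (Var (i, j) :: (nat \<times> 3, 'a) mpoly)"
  then have "e = Poly_Mapping.single (i, j) 1" by (simp add: Var_def)
  then have "(\<Sum>j'\<in>UNIV. Poly_Mapping.lookup e (i', j')) = (\<Sum>j'\<in>UNIV. if j' = j then (if i' = i then 1 else 0) else 0)"
    by (intro sum.cong) (auto simp: lookup_single when_def)
  then show "(\<Sum>j'\<in>UNIV. Poly_Mapping.lookup e (i', j')) = (if i' = i then 1 else 0)" by simp
qed (use assms in \<open>auto simp: eval_mpoly_eq_subst subst_Var\<close>)

lemma multihom_fun_mult:
  assumes "multihom_fun n d f" "multihom_fun n e g"
  shows "multihom_fun n (\<lambda>i. d i + e i) (\<lambda>v. f v * g v)"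
proof -
  obtain F G where F: "\<forall>k\<in>Poly_Mapping.keys F. \<forall>i. (\<Sum>j\<in>UNIV. Poly_Mapping.lookup k (i, j)) = d i" 
      "f = (\<lambda>v. eval_mpoly (\<lambda>(i, j). v i j) F)"
    and G: "\<forall>k\<in>Poly_Mapping.keys G. \<forall>i. (\<Sum>j\<in>UNIV. Poly_Mapping.lookup k (i, j)) = e i" 
      "g = (\<lambda>v. eval_mpoly (\<lambda>(i, j). v i j) G)"
    using assms unfolding multihom_fun_def by auto
  have "(\<Sum>j\<in>UNIV. Poly_Mapping.lookup k (i, j)) = d i + e i" if k: "k \<in> Poly_Mapping.keys (F * G)" for k i
  proof -
    obtain k1 k2 where "k = k1 + k2" "k1 \<in> Poly_Mapping.keys F" "k2 \<in> Poly_Mapping.keys G"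
      using k keys_mult by blast
    then show ?thesis using F G by (simp add: lookup_add sum.distrib)
  qed
  then show ?thesis using assms F(2) G(2) unfolding multihom_fun_def
    by (intro conjI exI[of _ "F * G"]) (auto simp: eval_mpoly_eq_subst subst_mult)
qed

lemma multihom_fun_diff:
  assumes "multihom_fun n d f" "multihom_fun n d g"
  shows "multihom_fun n d (\<lambda>v. f v - g v)"
proof -
  obtain F G where F: "\<forall>k\<in>Poly_Mapping.keys F. \<forall>i. (\<Sum>j\<in>UNIV. Poly_Mapping.lookup k (i, j)) = d i" 
      "f = (\<lambda>v. eval_mpoly (\<lambda>(i, j). v i j) F)"
    and G: "\<forall>k\<in>Poly_Mapping.keys G. \<forall>i. (\<Sum>j\<in>UNIV. Poly_Mapping.lookup k (i, j)) = d i" 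
      "g = (\<lambda>v. eval_mpoly (\<lambda>(i, j). v i j) G)"
    using assms unfolding multihom_fun_def by auto
  have "k \<in> Poly_Mapping.keys F \<or> k \<in> Poly_Mapping.keys G" if "k \<in> Poly_Mapping.keys (F - G)" for k
    using that by (auto simp: in_keys_iff lookup_minus)
  then show ?thesis using assms F G unfolding multihom_fun_def
    by (intro conjI exI[of _ "F - G"]) (auto simp: eval_mpoly_eq_subst subst_diff)
qed

lemma multihom_fun_add:
  assumes "multihom_fun n d f" "multihom_fun n d g"
  shows "multihom_fun n d (\<lambda>v. f v + g v)"
proof -
  have "multihom_fun n d (\<lambda>_. 0)" using assms(1) by (intro multihom_fun_zero) (simp add: multihom_fun_def)
  from multihom_fun_diff[OF assms(1) multihom_fun_diff[OF this assms(2)]] show ?thesis by simp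
qed

interpretation multihom: graded_functions "multihom_fun n" for n
  by unfold_locales (auto intro: multihom_fun_const multihom_fun_mult multihom_fun_diff)

text \<open>Hence nonvanishing depends on the projective points only, not on the representatives
  chosen for them.\<close>

lemma multihom_fun_scale:
  assumes f: "multihom_fun n d f" and vw: "\<And>i j. i < n \<Longrightarrow> w i j = c i * v i j"
  shows "f w = (\<Prod>i<n. c i ^ d i) * f v"
proof -
  obtain F where d: "\<forall>i\<ge>n. d i = 0" 
    and F: "\<forall>k\<in>Poly_Mapping.keys F. \<forall>i. (\<Sum>j\<in>UNIV. Poly_Mapping.lookup k (i, j)) = d i" 
      "f = (\<lambda>v. eval_mpoly (\<lambda>(i, j). v i j) F)"
    using f unfolding multihom_fun_def by auto
  have mv: "mon_val (\<lambda>(i, j). u i j) e = (\<Prod>i<n. \<Prod>j\<in>UNIV. u i j ^ Poly_Mapping.lookup e (i, j))" 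
    if e: "e \<in> Poly_Mapping.keys F" for e and u :: "nat \<Rightarrow> 3 \<Rightarrow> 'a"
  proof -
    \<comment> \<open>Degree zero in the i-th point, for i at least n, excludes its three
      variables.\<close>
    have "Poly_Mapping.keys e \<subseteq> {..<n} \<times> UNIV"
    proof
      fix ij assume ij: "ij \<in> Poly_Mapping.keys e"
      obtain i j where [simp]: "ij = (i, j)" by force
      have "i < n"
      proof (rule ccontr)
        assume "\<not> i < n"
        then have "(\<Sum>j\<in>UNIV. Poly_Mapping.lookup e (i, j)) = 0" using F(1) d e by simp
        then show False using ij by (simp add: in_keys_iff)
      qed
      then show "ij \<in> {..<n} \<times> UNIV" by simp
    qed
    then show ?thesis
      by (subst mon_val_superset[of "{..<n} \<times> UNIV"]) (auto simp: prod.cartesian_product case_prod_unfold)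
  qed
  have "mon_val (\<lambda>(i, j). w i j) e = (\<Prod>i<n. c i ^ d i) * mon_val (\<lambda>(i, j). v i j) e"
    if e: "e \<in> Poly_Mapping.keys F" for e
  proof -
    have "(\<Prod>j\<in>UNIV. w i j ^ Poly_Mapping.lookup e (i, j)) = c i ^ d i * (\<Prod>j\<in>UNIV. v i j ^ Poly_Mapping.lookup e (i, j))" 
      if "i < n" for i
    proof -
      have "(\<Prod>j\<in>UNIV. w i j ^ Poly_Mapping.lookup e (i, j)) = 
          c i ^ (\<Sum>j\<in>UNIV. Poly_Mapping.lookup e (i, j)) * (\<Prod>j\<in>UNIV. v i j ^ Poly_Mapping.lookup e (i, j))"
        using that by (simp add: vw power_mult_distrib prod.distrib power_sum)
      then show ?thesis using F(1) e by simp
    qed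
    then show ?thesis by (simp add: mv[OF e] prod.distrib)
  qed
  then show ?thesis unfolding F(2) eval_mpoly_eq_subst subst_def
    by (simp add: sum_distrib_left mult.left_commute)
qed

definition nonzero_lifts :: "nat \<Rightarrow> (nat \<Rightarrow> 3 \<Rightarrow> 'k::field) \<Rightarrow> bool" where
  "nonzero_lifts n v \<longleftrightarrow> (\<forall>i<n. v i \<noteq> (\<lambda>_. 0))"

definition lifts :: "(nat \<Rightarrow> 'k::field proj_plane) \<Rightarrow> nat \<Rightarrow> 3 \<Rightarrow> 'k" where
  "lifts p i = rep_proj_plane (p i)"

text \<open>A principal open set. Its nonemptiness can be tested on arbitrary nonzero coordinate
  vectors, which is convenient for explicit configurations; \<open>multihom_fun_scale\<close> passes
  to chosen representatives.\<close>

definition generic :: "nat \<Rightarrow> ((nat \<Rightarrow> 'k::field proj_plane) \<Rightarrow> bool) \<Rightarrow> bool" where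
  "generic n Q \<longleftrightarrow> (\<exists>d f. multihom_fun n d f \<and> (\<exists>v. nonzero_lifts n v \<and> f v \<noteq> 0) \<and>
     (\<forall>p\<in>point_tuples n. f (lifts p) \<noteq> 0 \<longrightarrow> Q p))"

lemma for_general_points_if_generic:
  fixes Q :: "(nat \<Rightarrow> 'k::field proj_plane) \<Rightarrow> bool"
  assumes "generic n Q" shows "for_general_points n Q"
proof -
  obtain d f v where f: "multihom_fun n d f" and v: "nonzero_lifts n v" "f v \<noteq> 0" 
    and Q: "\<And>p. p \<in> point_tuples n \<Longrightarrow> f (lifts p) \<noteq> 0 \<Longrightarrow> Q p"
    using assms unfolding generic_def by blast
  obtain F where d: "\<forall>i\<ge>n. d i = 0" 
    and F: "\<forall>k\<in>Poly_Mapping.keys F. \<forall>i. (\<Sum>j\<in>UNIV. Poly_Mapping.lookup k (i, j)) = d i" 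
      "f = (\<lambda>v. eval_mpoly (\<lambda>(i, j). v i j) F)"
    using f unfolding multihom_fun_def by auto
  have eval: "eval_at_points p F = f (lifts p)" for p
    unfolding eval_at_points_def F(2) lifts_def ..
  define U where "U = {p \<in> point_tuples n. eval_at_points p F \<noteq> 0}"
  have "multihomogeneous n F" unfolding multihomogeneous_def using d F(1) by blast
  then have "zariski_open n U"
    unfolding zariski_open_def zariski_closed_def by (intro conjI exI[of _ "{F}"]) (auto simp: U_def)
  moreover have "U \<noteq> {}"
  proof -
    define p where "p = (\<lambda>i\<in>{..<n}. abs_proj_plane (v i))"
    have "proportional (v i) (lifts p i)" if "i < n" for i
    proof -
      have "proportional (v i) (v i)" 
        using v(1) that unfolding proportional_def nonzero_lifts_def by (auto intro!: exI[of _ 1])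
      from Quotient3_rep_abs[OF Quotient3_proj_plane, OF this] 
      have "proportional (rep_proj_plane (abs_proj_plane (v i))) (v i)" .
      then have "proportional (v i) (rep_proj_plane (abs_proj_plane (v i)))"
        using part_equivp_symp[OF part_equivp_proportional] by blast
      then show ?thesis using that by (simp add: lifts_def p_def)
    qed
    then have "\<forall>i. \<exists>c. i < n \<longrightarrow> c \<noteq> 0 \<and> lifts p i = (\<lambda>j. c * v i j)" unfolding proportional_def by blast
    from choice[OF this] obtain c where c: "\<And>i. i < n \<Longrightarrow> c i \<noteq> 0" "\<And>i. i < n \<Longrightarrow> lifts p i = (\<lambda>j. c i * v i j)" by blast
    have "f (lifts p) = (\<Prod>i<n. c i ^ d i) * f v"
      by (rule multihom_fun_scale[OF f]) (simp add: c(2))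
    then have "f (lifts p) \<noteq> 0" using c(1) v(2) by simp
    moreover have "p \<in> point_tuples n" by (simp add: point_tuples_def p_def)
    ultimately show ?thesis by (auto simp: U_def eval)
  qed
  moreover have "\<forall>p\<in>U. Q p" using Q by (auto simp: U_def eval)
  ultimately show ?thesis unfolding for_general_points_def by blast
qed

lemma generic_mono: "generic n Q \<Longrightarrow> (\<And>p. p \<in> point_tuples n \<Longrightarrow> Q p \<Longrightarrow> Q' p) \<Longrightarrow> generic n Q'"
  unfolding generic_def by blast

lemma generic_True: "generic n (\<lambda>_. True)"
  unfolding generic_def nonzero_lifts_def
  by (intro exI[of _ "\<lambda>_. 0"] exI[of _ "\<lambda>_. 1"] conjI exI[of _ "\<lambda>_ _. 1"] multihom_fun_const) (auto simp: fun_eq_iff)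

lemma multihom_fun_on_line:
  assumes "multihom_fun n d f"
  shows "\<exists>q. \<forall>s. f (\<lambda>i j. v i j + s * u i j) = poly q s"
proof -
  obtain F where F: "f = (\<lambda>v. eval_mpoly (\<lambda>(i, j). v i j) F)" using assms unfolding multihom_fun_def by auto
  have "poly (subst (\<lambda>c. [:c:]) (\<lambda>(i, j). [:v i j, u i j:]) F) s = f (\<lambda>i j. v i j + s * u i j)" for s
  proof -
    have "(\<lambda>x. poly (case x of (i, j) \<Rightarrow> [:v i j, u i j:]) s) = (\<lambda>(i, j). v i j + s * u i j)" by auto
    then show ?thesis unfolding F eval_mpoly_eq_subst by (subst hom_subst[OF coeff_hom_poly]) simp
  qed
  then show ?thesis by (intro exI[of _ "subst (\<lambda>c. [:c:]) (\<lambda>(i, j). [:v i j, u i j:]) F"]) simp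
qed

text \<open>Irreducibility of the space of point tuples, by hand: join the two witnesses by an
  affine line in coordinates. Each function restricts to a nonzero polynomial on it, since it is
  nonzero at one end.\<close>

lemma generic_conj:
  fixes Q Q' :: "(nat \<Rightarrow> 'k::alg_closed_field proj_plane) \<Rightarrow> bool"
  assumes "generic n Q" "generic n Q'" shows "generic n (\<lambda>p. Q p \<and> Q' p)"
proof -
  obtain d f v where f: "multihom_fun n d f" and v: "nonzero_lifts n v" "f v \<noteq> 0" 
    and Q: "\<And>p. p \<in> point_tuples n \<Longrightarrow> f (lifts p) \<noteq> 0 \<Longrightarrow> Q p"
    using assms(1) unfolding generic_def by blast
  obtain d' f' v' where f': "multihom_fun n d' f'" and v': "nonzero_lifts n v'" "f' v' \<noteq> 0" 
    and Q': "\<And>p. p \<in> point_tuples n \<Longrightarrow> f' (lifts p) \<noteq> 0 \<Longrightarrow> Q' p"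
    using assms(2) unfolding generic_def by blast
  define w where "w s i j = v i j + s * (v' i j - v i j)" for s i j
  obtain q where q: "\<And>s. f (w s) = poly q s" using multihom_fun_on_line[OF f, of v "\<lambda>i j. v' i j - v i j"] unfolding w_def by blast
  obtain q' where q': "\<And>s. f' (w s) = poly q' s" using multihom_fun_on_line[OF f', of v "\<lambda>i j. v' i j - v i j"] unfolding w_def by blast
  have "\<forall>i. \<exists>j. i < n \<longrightarrow> v i j \<noteq> 0" using v(1) unfolding nonzero_lifts_def by (metis ext)
  from choice[OF this] obtain l where l: "\<And>i. i < n \<Longrightarrow> v i (l i) \<noteq> 0" by blast
  \<comment> \<open>The last factor keeps one coordinate of every point nonzero, so that the chosen
    place on the line still represents a tuple of points.\<close>
  define P where "P = q * q' * (\<Prod>i<n. [:v i (l i), v' i (l i) - v i (l i):])"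
  have "w 0 = v" "w 1 = v'" by (simp_all add: w_def fun_eq_iff)
  then have "q \<noteq> 0" "q' \<noteq> 0" using q[of 0] v(2) q'[of 1] v'(2) by auto
  then have "P \<noteq> 0" using l by (simp add: P_def)
  then obtain s where s: "poly P s \<noteq> 0" using poly_eq_0_cofinite[of "{}" P] by blast
  then have "f (w s) * f' (w s) \<noteq> 0" by (simp add: P_def q q')
  moreover have "nonzero_lifts n (w s)"
    unfolding nonzero_lifts_def
  proof (intro allI impI notI)
    fix i assume "i < n" "w s i = (\<lambda>_. 0)"
    then have "v i (l i) + s * (v' i (l i) - v i (l i)) = 0" unfolding w_def by metis
    with s \<open>i < n\<close> show False by (auto simp: P_def poly_prod)
  qed
  ultimately show ?thesis unfolding generic_def
    using multihom_fun_mult[OF f f'] Q Q'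
    by (intro exI[of _ "\<lambda>i. d i + d' i"] exI[of _ "\<lambda>v. f v * f' v"]) auto
qed

section \<open>Elementary generic conditions\<close>

lemma generic_coord:
  assumes "i < n" shows "generic n (\<lambda>p :: nat \<Rightarrow> 'k::field proj_plane. lifts p i j \<noteq> 0)"
  unfolding generic_def nonzero_lifts_def
  by (intro exI[of _ "\<lambda>i'. if i' = i then 1 else 0"] exI[of _ "\<lambda>v. v i j"] conjI multihom_fun_coord assms exI[of _ "\<lambda>_ _. 1"])
    (auto simp: fun_eq_iff)

lemma generic_all_coords: "m \<le> n \<Longrightarrow> generic n (\<lambda>p :: nat \<Rightarrow> 'k::alg_closed_field proj_plane. \<forall>i<m. lifts p i j \<noteq> 0)"
proof (induction m)
  case 0
  show ?case using generic_True by simp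
next
  case (Suc m)
  then have "generic n (\<lambda>p :: nat \<Rightarrow> 'k proj_plane. \<forall>i<m. lifts p i j \<noteq> 0)" "m < n" by simp_all
  from generic_conj[OF this(1) generic_coord[OF this(2), of j]] show ?case by (rule generic_mono) (auto simp: less_Suc_eq)
qed

text \<open>This particular minor, rather than mere distinctness of the points, is the determinant D
  of \<open>syzygy_trivial\<close>.\<close>

lemma generic_distinct:
  assumes "a < n" "b < n" "a \<noteq> b" 
  shows "generic n (\<lambda>p :: nat \<Rightarrow> 'k::field proj_plane. lifts p a 0 * lifts p b 1 - lifts p a 1 * lifts p b 0 \<noteq> 0)"
proof -
  let ?d = "\<lambda>i. (if i = a then 1 else 0) + (if i = b then 1 else 0 :: nat)"
  let ?f = "\<lambda>v. v a 0 * v b 1 - v a 1 * v b 0"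
  have "multihom_fun n ?d (?f :: (nat \<Rightarrow> 3 \<Rightarrow> 'k) \<Rightarrow> 'k)"
    by (intro multihom_fun_diff multihom_fun_mult multihom_fun_coord assms)
  moreover define v where "v i j = (if i = a \<and> j = 1 \<or> i = b \<and> j = 0 then 0 else 1 :: 'k)" for i and j :: 3
  have "?f v \<noteq> 0" using assms(3) by (simp add: v_def)
  moreover have "v i 2 \<noteq> 0" for i by (simp add: v_def)
  then have "nonzero_lifts n v" unfolding nonzero_lifts_def by metis
  ultimately show ?thesis unfolding generic_def by blast
qed

subsection \<open>Interpolation conditions\<close>

lemma line_val_single_Suc:
  "line_val v w (Poly_Mapping.single (Poly_Mapping.single l 1 + e) 1) = [:v l, w l:] * line_val v w (Poly_Mapping.single e 1)"
  unfolding single_Var_step by (simp add: line_val_def line_val_simps)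

lemma degree_line_val_single: "degree (line_val v w (Poly_Mapping.single e 1)) \<le> exp_degree e"
proof (induction e rule: exponent_induct)
  case zero
  show ?case by (simp add: line_val_def line_val_simps)
next
  case (add e i)
  have "degree (line_val v w (Poly_Mapping.single (Poly_Mapping.single i 1 + e) 1)) \<le> 
      degree [:v i, w i:] + degree (line_val v w (Poly_Mapping.single e 1))"
    unfolding line_val_single_Suc by (rule degree_mult_le)
  also have "\<dots> \<le> 1 + exp_degree e" using add by (intro add_mono) auto
  finally show ?case by (simp add: exp_degree_add)
qed

lemma homogeneous_sum_single:
  assumes "homogeneous d F"
  shows "F = (\<Sum>e\<in>{e. exp_degree e = d}. const (Poly_Mapping.lookup F e) * Poly_Mapping.single e (1 :: 'k::comm_ring_1))"
proof -
  have "F = (\<Sum>e\<in>Poly_Mapping.keys F. Poly_Mapping.single e (Poly_Mapping.lookup F e))" by (rule poly_mapping_sum_single)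
  also have "\<dots> = (\<Sum>e\<in>{e. exp_degree e = d}. Poly_Mapping.single e (Poly_Mapping.lookup F e))"
    by (rule sum.mono_neutral_left) (use assms in \<open>auto simp: finite_exponents_eq homogeneous_def in_keys_iff\<close>)
  finally show ?thesis by (simp add: const_def mult_single)
qed

lemma lookup_sum_single:
  assumes "exp_degree e = d"
  shows "Poly_Mapping.lookup (\<Sum>e\<in>{e :: 'v::finite \<Rightarrow>\<^sub>0 nat. exp_degree e = d}. const (c e) * Poly_Mapping.single e (1 :: 'k::comm_ring_1)) e = c e"
proof -
  have "Poly_Mapping.lookup (\<Sum>e\<in>{e. exp_degree e = d}. const (c e) * Poly_Mapping.single e 1) e = 
      (\<Sum>e'\<in>{e. exp_degree e = d}. if e' = e then c e' else 0)"
    unfolding lookup_sum by (rule sum.cong) (auto simp: const_def mult_single lookup_single when_def)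
  then show ?thesis using assms by (simp add: finite_exponents_eq)
qed

lemma line_val_homogeneous:
  assumes "homogeneous d F"
  shows "line_val v w F = (\<Sum>e\<in>{e. exp_degree e = d}. [:Poly_Mapping.lookup F e:] * line_val v w (Poly_Mapping.single e 1))"
  by (subst homogeneous_sum_single[OF assms]) (simp add: line_val_def line_val_simps)

lemma degree_line_val:
  assumes "homogeneous d F" shows "degree (line_val v w F) \<le> d"
  unfolding line_val_homogeneous[OF assms]
proof (rule degree_sum_le)
  fix e :: "3 \<Rightarrow>\<^sub>0 nat" assume "e \<in> {e. exp_degree e = d}"
  then show "degree ([:Poly_Mapping.lookup F e:] * line_val v w (Poly_Mapping.single e 1)) \<le> d"
    using order_trans[OF degree_smult_le degree_line_val_single] by auto
qed (simp add: finite_exponents_eq)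

text \<open>The direction w is constant, so extracting t^k from a monomial lowers its degree in the
  i-th point by k. The truncated difference is harmless: beyond the degree of the monomial the
  coefficient is zero.\<close>

lemma multihom_fun_line_coeff:
  assumes i: "i < n"
  shows "multihom_fun n (\<lambda>i'. if i' = i then exp_degree e - k else 0) 
    (\<lambda>v. coeff (line_val (v i) w (Poly_Mapping.single e 1)) k)"
proof (induction e arbitrary: k rule: exponent_induct)
  case zero
  have "(\<lambda>i'. if i' = i then exp_degree (0 :: 3 \<Rightarrow>\<^sub>0 nat) - k else 0) = (\<lambda>_. 0)" by auto
  then show ?case
    using multihom_fun_const[of n 0] multihom_fun_const[of n 1] 
    by (cases "k = 0") (simp_all add: line_val_def line_val_simps coeff_1)
next
  case (add e l)
  let ?d = "\<lambda>i'. if i' = i then exp_degree (Poly_Mapping.single l 1 + e) - k else 0"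
  let ?c = "\<lambda>k v. coeff (line_val (v i) w (Poly_Mapping.single e 1)) k"
  have deg: "exp_degree (Poly_Mapping.single l 1 + e) = Suc (exp_degree e)" by (simp add: exp_degree_add)
  have "multihom_fun n ?d (\<lambda>v. v i l * ?c k v)"
  proof (cases "k \<le> exp_degree e")
    case True
    have "(\<lambda>i'. (if i' = i then 1 else 0) + (if i' = i then exp_degree e - k else 0)) = ?d"
      unfolding deg by (rule ext) (use True in auto)
    then show ?thesis using multihom_fun_mult[OF multihom_fun_coord[OF i, of l] add.IH[of k]] by simp
  next
    case False
    have "?c k v = 0" for v :: "nat \<Rightarrow> 3 \<Rightarrow> 'a"
      using degree_line_val_single[of "v i" w e] False by (intro coeff_eq_0) simp
    then show ?thesis using i by (simp add: multihom_fun_zero)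
  qed
  moreover have "multihom_fun n ?d (\<lambda>v. w l * (case k of 0 \<Rightarrow> 0 | Suc k' \<Rightarrow> ?c k' v))"
  proof (cases k)
    case 0
    then show ?thesis using i by (simp add: multihom_fun_zero)
  next
    case (Suc k')
    have "(\<lambda>i'. 0 + (if i' = i then exp_degree e - k' else 0)) = ?d"
      unfolding deg by (rule ext) (simp add: Suc)
    then show ?thesis using multihom_fun_mult[OF multihom_fun_const[of n "w l"] add.IH[of k']] by (simp add: Suc)
  qed
  ultimately have "multihom_fun n ?d (\<lambda>v. v i l * ?c k v + w l * (case k of 0 \<Rightarrow> 0 | Suc k' \<Rightarrow> ?c k' v))"
    by (rule multihom_fun_add)
  moreover have "coeff (line_val (v i) w (Poly_Mapping.single (Poly_Mapping.single l 1 + e) 1)) k = 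
      v i l * ?c k v + w l * (case k of 0 \<Rightarrow> 0 | Suc k' \<Rightarrow> ?c k' v)" for v
    unfolding line_val_single_Suc by (cases k) simp_all
  ultimately show ?case by simp
qed

text \<open>A family of forms indexed by \<open>K\<close>, with functionals in \<open>C\<close> that
  act on the coefficients of the whole family. A single form expresses I'_\<alpha> = 0; three forms
  express a bound on the syzygies.\<close>

definition constrained_forms :: "nat \<Rightarrow> (nat \<Rightarrow> nat) \<Rightarrow> nat \<Rightarrow> 3 set \<Rightarrow> (3 \<Rightarrow> (3 \<Rightarrow>\<^sub>0 nat) \<Rightarrow> 'k) set \<Rightarrow>
    (nat \<Rightarrow> 3 \<Rightarrow> 'k::field) \<Rightarrow> (3 \<Rightarrow> 'k ternary) \<Rightarrow> bool" where
  "constrained_forms n m d K C v F \<longleftrightarrow> (\<forall>c\<in>K. homogeneous d (F c) \<and> (\<forall>i<n. vanishes (m i) (v i) (F c))) \<and>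
     (\<forall>\<phi>\<in>C. (\<Sum>c\<in>K. \<Sum>e\<in>{e. exp_degree e = d}. \<phi> c e * Poly_Mapping.lookup (F c) e) = 0)"

text \<open>Semicontinuity. The unknowns are the coefficients of the forms, the same for all point
  tuples, and the entries of the linear system are multihomogeneous in the points. Elimination turns
  trivial kernel at one tuple into trivial kernel on a principal open set.\<close>

lemma generic_no_constrained_forms:
  assumes v0: "nonzero_lifts n v\<^sub>0" and no: "\<And>F. constrained_forms n m d K C v\<^sub>0 F \<Longrightarrow> \<forall>c\<in>K. F c = 0"
  shows "generic n (\<lambda>p :: nat \<Rightarrow> 'k::field proj_plane. \<forall>F. constrained_forms n m d K C (lifts p) F \<longrightarrow> (\<forall>c\<in>K. F c = 0))"
proof -
  define E where "E = {e :: 3 \<Rightarrow>\<^sub>0 nat. exp_degree e = d}"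
  have fin: "finite E" by (simp add: E_def finite_exponents_eq)
  define J where "J = K \<times> E"
  \<comment> \<open>The set of rows is in general infinite, as every direction w is tested;
    elimination only needs finitely many columns.\<close>
  define R where "R = (Inl ` {(c, i, w :: 3 \<Rightarrow> 'k, k). c \<in> K \<and> i < n \<and> k < m i}) \<union> (Inr ` C)"
  define A where "A r ce v = (case r of Inl (c, i, w, k) \<Rightarrow> 
      if fst ce = c then coeff (line_val (v i) w (Poly_Mapping.single (snd ce) 1)) k else 0 | Inr \<phi> \<Rightarrow> \<phi> (fst ce) (snd ce))"
    for r :: "3 \<times> nat \<times> (3 \<Rightarrow> 'k) \<times> nat + (3 \<Rightarrow> (3 \<Rightarrow>\<^sub>0 nat) \<Rightarrow> 'k)" and ce and v :: "nat \<Rightarrow> 3 \<Rightarrow> 'k"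
  define \<delta> where "\<delta> r i' = (case r of Inl (c, i, w, k) \<Rightarrow> if i' = i then d - k else 0 | Inr \<phi> \<Rightarrow> 0)" 
    for r :: "3 \<times> nat \<times> (3 \<Rightarrow> 'k) \<times> nat + (3 \<Rightarrow> (3 \<Rightarrow>\<^sub>0 nat) \<Rightarrow> 'k)" and i' :: nat
  define forms where "forms x c = (\<Sum>e\<in>E. const (x (c, e)) * Poly_Mapping.single e 1)" for x :: "3 \<times> (3 \<Rightarrow>\<^sub>0 nat) \<Rightarrow> 'k" and c
  have hom_forms: "homogeneous d (forms x c)" for x c
    unfolding forms_def
    by (rule homogeneous_sum, rule homogeneous_const_mult) (auto simp: E_def homogeneous_def)
  have lookup_forms: "Poly_Mapping.lookup (forms x c) e = x (c, e)" if "e \<in> E" for x c e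
    unfolding forms_def E_def using that by (subst lookup_sum_single) (auto simp: E_def)
  have hom: "multihom_fun n (\<lambda>i. \<delta> r i + 0) (A r j)" if r: "r \<in> R" and j: "j \<in> J" for r j
  proof (cases r)
    case (Inl a)
    obtain c i w k where a: "a = (c, i, w, k)" by (cases a)
    have i: "i < n" using r by (auto simp: R_def Inl a)
    have "exp_degree (snd j) = d" using j by (auto simp: J_def E_def)
    then show ?thesis
      using multihom_fun_line_coeff[OF i, of "snd j" k w, unfolded \<open>exp_degree (snd j) = d\<close>] multihom_fun_zero[of n "\<lambda>i'. if i' = i then d - k else 0"] i
      unfolding \<delta>_def A_def Inl a by (cases "fst j = c") simp_all
  next
    case (Inr \<phi>)
    then show ?thesis unfolding \<delta>_def A_def by (simp add: multihom_fun_const)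
  qed
  have sums: "(\<Sum>j\<in>J. A (Inl (c, i, w, k)) j v * x j) = coeff (line_val (v i) w (forms x c)) k" if "c \<in> K" for c i w k v x
  proof -
    have "(\<Sum>j\<in>J. A (Inl (c, i, w, k)) j v * x j) = 
       (\<Sum>c'\<in>K. \<Sum>e\<in>E. if c' = c then coeff (line_val (v i) w (Poly_Mapping.single e 1)) k * x (c, e) else 0)"
      unfolding J_def sum.cartesian_product by (rule sum.cong) (auto simp: A_def)
    also have "\<dots> = (\<Sum>c'\<in>K. if c' = c then \<Sum>e\<in>E. coeff (line_val (v i) w (Poly_Mapping.single e 1)) k * x (c, e) else 0)"
      by (rule sum.cong) auto
    also have "\<dots> = (\<Sum>e\<in>E. coeff (line_val (v i) w (Poly_Mapping.single e 1)) k * x (c, e))" using that by simp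
    also have "\<dots> = coeff (line_val (v i) w (forms x c)) k"
      unfolding forms_def by (simp add: line_val_def line_val_simps coeff_sum mult.commute)
    finally show ?thesis .
  qed
  have sums': "(\<Sum>j\<in>J. A (Inr \<phi>) j v * x j) = (\<Sum>c\<in>K. \<Sum>e\<in>E. \<phi> c e * Poly_Mapping.lookup (forms x c) e)" for \<phi> v x
    unfolding J_def sum.cartesian_product by (rule sum.cong) (auto simp: A_def lookup_forms)
  have iff: "(\<forall>r\<in>R. (\<Sum>j\<in>J. A r j v * x j) = 0) \<longleftrightarrow> constrained_forms n m d K C v (forms x)" for v x
  proof -
    have "(\<forall>r\<in>R. (\<Sum>j\<in>J. A r j v * x j) = 0) \<longleftrightarrow> 
       (\<forall>c\<in>K. \<forall>i<n. \<forall>w. \<forall>k<m i. coeff (line_val (v i) w (forms x c)) k = 0) \<and>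
       (\<forall>\<phi>\<in>C. (\<Sum>c\<in>K. \<Sum>e\<in>E. \<phi> c e * Poly_Mapping.lookup (forms x c) e) = 0)"
      unfolding R_def ball_Un by (auto simp: sums sums')
    then show ?thesis by (simp add: constrained_forms_def vanishes_iff hom_forms E_def)
  qed
  have zero: "x (c, e) = 0" if "forms x c = 0" "e \<in> E" for x c e
    using lookup_forms[OF that(2), of x c] that(1) by simp
  have "\<forall>j\<in>J. x j = 0" if "\<forall>r\<in>R. (\<Sum>j\<in>J. A r j v\<^sub>0 * x j) = 0" for x
  proof -
    have "\<forall>c\<in>K. forms x c = 0" by (rule no) (use that iff in simp)
    then show ?thesis using zero[of x] unfolding J_def by auto
  qed
  from multihom.generic_injective[of J R n \<delta> "\<lambda>_ _. 0" A v\<^sub>0, OF _ hom this] fin obtain f df where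
    f: "multihom_fun n df f" "f v\<^sub>0 \<noteq> 0" 
      "\<And>v x. f v \<noteq> 0 \<Longrightarrow> \<forall>r\<in>R. (\<Sum>j\<in>J. A r j v * x j) = 0 \<Longrightarrow> \<forall>j\<in>J. x j = 0"
    by (auto simp: J_def)
  have "\<forall>c\<in>K. F c = 0" if p: "f (lifts p) \<noteq> 0" and F: "constrained_forms n m d K C (lifts p) F" for p F
  proof -
    define x where "x ce = Poly_Mapping.lookup (F (fst ce)) (snd ce)" for ce
    have FE: "F c = forms x c" if "c \<in> K" for c
      using homogeneous_sum_single[of d "F c"] F that unfolding forms_def x_def E_def constrained_forms_def by simp
    have "constrained_forms n m d K C (lifts p) (forms x)"
      using F unfolding constrained_forms_def by (simp add: FE cong: sum.cong)
    then have "\<forall>j\<in>J. x j = 0" using f(3)[OF p] iff by blast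
    then have "forms x c = 0" if "c \<in> K" for c
      unfolding forms_def by (intro sum.neutral) (use that in \<open>auto simp: J_def\<close>)
    then show ?thesis using FE by simp
  qed
  then show ?thesis unfolding generic_def using f(1,2) v0 by blast
qed

section \<open>Rank minimality of unhindered fat point ideals\<close>

lemma saturated_fat_ideal:
  fixes p :: "nat \<Rightarrow> 'k::alg_closed_field proj_plane"
  assumes "\<forall>i<n. lifts p i 2 \<noteq> 0"
  shows "saturated_ideal (fat_ideal n m p)"
proof
  show "ring_ideal.subspace (fat_ideal n m p)" by (rule subspace_fat_ideal)
  show "hcomp d F \<in> fat_ideal n m p" if "F \<in> fat_ideal n m p" for F d by (rule fat_ideal_hcomp[OF that])
  show "F \<in> fat_ideal n m p" if F: "homogeneous d F" "Var 2 * F \<in> fat_ideal n m p" for d F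
  proof -
    have "\<forall>i<n. vanishes (m i) (rep_proj_plane (p i)) (Var 2 * F)"
      using F(2) fat_ideal_homogeneous_iff[OF homogeneous_Var_mult[OF F(1)]] by blast
    then have "\<forall>i<n. vanishes (m i) (rep_proj_plane (p i)) F"
    proof (intro allI impI)
      fix i assume "\<forall>i<n. vanishes (m i) (rep_proj_plane (p i)) (Var 2 * F)" "i < n"
      then show "vanishes (m i) (rep_proj_plane (p i)) F"
        using vanishes_cancel_nonzero[of "rep_proj_plane (p i)" "Var 2" "m i" F] assms by (simp add: eval_Var lifts_def)
    qed
    then show ?thesis using fat_ideal_homogeneous_iff[OF F(1)] by blast
  qed
qed

lemma graded_fat_ideal_iff:
  fixes p :: "nat \<Rightarrow> 'k::alg_closed_field proj_plane"
  shows "F \<in> graded_part (fat_ideal n m p) d \<longleftrightarrow> homogeneous d F \<and> (\<forall>i<n. vanishes (m i) (lifts p i) F)"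
  using fat_ideal_homogeneous_iff[of d F n m p] by (auto simp: graded_part_def lifts_def)

lemma hilbert_fat_ideal_0:
  fixes p :: "nat \<Rightarrow> 'k::alg_closed_field proj_plane"
  assumes "hilbert (fat_ideal n m p) d = 0" "F \<in> graded_part (fat_ideal n m p) d"
  shows "F = 0"
proof -
  have sub: "mpoly_space.subspace (graded_part (fat_ideal n m p) d)"
    by (rule mpoly_space.subspaceI)
      (auto simp: graded_part_def scale_mpoly_const ring_ideal.subspace_0[OF subspace_fat_ideal] 
        intro: homogeneous_add homogeneous_const_mult ring_ideal.subspace_scale[OF subspace_fat_ideal] 
          ring_ideal.subspace_add[OF subspace_fat_ideal])
  have "graded_part (fat_ideal n m p) d \<subseteq> {F. homogeneous d F}" by (auto simp: graded_part_def)
  from dim_eq_0_iff[OF sub this] show ?thesis using assms by (auto simp: hilbert_def)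
qed

text \<open>Twice the number of linear conditions expected from the points, so that all comparisons
  stay in the natural numbers.\<close>

definition conditions :: "nat \<Rightarrow> (nat \<Rightarrow> nat) \<Rightarrow> nat" where
  "conditions n m = (\<Sum>i<n. m i * (m i + 1))"

text \<open>The truncated subtraction on \<open>nat\<close> plays the role of \<open>max 0\<close>.\<close>

lemma unhindered_hilbert:
  assumes "unhindered n m p"
  shows "2 * hilbert (fat_ideal n m p) t = (t + 1) * (t + 2) - conditions n m"
proof -
  have "(\<Sum>i<n. real (m i * (m i + 1))) = real (conditions n m)" by (simp add: conditions_def)
  then have "real (hilbert (fat_ideal n m p) t) = max 0 ((real ((t + 1) * (t + 2)) - real (conditions n m)) / 2)"
    using assms unfolding unhindered_def by simp
  moreover have "2 * max 0 ((real a - real b) / 2) = real (a - b)" for a b :: nat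
    by (cases "b \<le> a") (simp_all add: max_def of_nat_diff)
  ultimately have "real (2 * hilbert (fat_ideal n m p) t) = real ((t + 1) * (t + 2) - conditions n m)"
    by (metis of_nat_mult of_nat_numeral)
  then show ?thesis by (simp only: of_nat_eq_iff)
qed

definition expected_degree :: "nat \<Rightarrow> (nat \<Rightarrow> nat) \<Rightarrow> nat" where
  "expected_degree n m = (LEAST t. conditions n m < (t + 1) * (t + 2))"

lemma expected_degree_iff: "expected_degree n m \<le> t \<longleftrightarrow> conditions n m < (t + 1) * (t + 2)"
proof -
  have "conditions n m < (conditions n m + 1) * (conditions n m + 2)" by simp
  then have *: "conditions n m < (expected_degree n m + 1) * (expected_degree n m + 2)"
    unfolding expected_degree_def by (rule LeastI)
  show ?thesis
  proof
    assume "expected_degree n m \<le> t"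
    then have "(expected_degree n m + 1) * (expected_degree n m + 2) \<le> (t + 1) * (t + 2)"
      by (intro mult_mono) auto
    with * show "conditions n m < (t + 1) * (t + 2)" by simp
  next
    assume "conditions n m < (t + 1) * (t + 2)"
    then show "expected_degree n m \<le> t" unfolding expected_degree_def by (rule Least_le)
  qed
qed

section \<open>Initial degree and rank of unhindered ideals\<close>

context
  fixes n m and p :: "nat \<Rightarrow> 'k::alg_closed_field proj_plane"
  assumes z: "\<forall>i<n. lifts p i 2 \<noteq> 0" and unh: "unhindered n m p"
begin

interpretation saturated_ideal "fat_ideal n m p"
  by (rule saturated_fat_ideal[OF z])

lemma unhindered_graded_part_iff: "graded_part (fat_ideal n m p) t = {0} \<longleftrightarrow> t < expected_degree n m"
proof -
  have "graded_part (fat_ideal n m p) t = {0} \<longleftrightarrow> 2 * hilbert (fat_ideal n m p) t = 0"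
    using graded_part_eq_0_iff by simp
  also have "\<dots> \<longleftrightarrow> t < expected_degree n m"
    unfolding unhindered_hilbert[OF unh] using expected_degree_iff[of n m t] by auto
  finally show ?thesis .
qed

lemma unhindered_initial_degree: "initial_degree (fat_ideal n m p) = expected_degree n m"
  unfolding initial_degree_def
  by (rule Least_equality) (use unhindered_graded_part_iff in \<open>auto simp: not_less[symmetric]\<close>)

lemma unhindered_growth:
  assumes "expected_degree n m \<le> t"
  shows "hilbert (fat_ideal n m p) (Suc t) = hilbert (fat_ideal n m p) t + t + 2"
proof -
  have "conditions n m < (t + 1) * (t + 2)" using assms expected_degree_iff by blast
  moreover have "(Suc t + 1) * (Suc t + 2) = (t + 1) * (t + 2) + 2 * (t + 2)" by (simp add: algebra_simps)
  ultimately have "2 * hilbert (fat_ideal n m p) (Suc t) = 2 * hilbert (fat_ideal n m p) t + 2 * (t + 2)"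
    unfolding unhindered_hilbert[OF unh] by simp
  then show ?thesis by simp
qed

lemma rank_minimal_injective:
  assumes "\<And>A B C. A \<in> graded_part (fat_ideal n m p) (expected_degree n m) \<Longrightarrow> 
      B \<in> graded_part (fat_ideal n m p) (expected_degree n m) \<Longrightarrow> 
      C \<in> graded_part (fat_ideal n m p) (expected_degree n m) \<Longrightarrow> 
      Var 0 * A + Var 1 * B + Var 2 * C = 0 \<Longrightarrow> A = 0 \<and> B = 0 \<and> C = 0"
  shows "rank_minimal n m p"
proof -
  let ?\<alpha> = "expected_degree n m" and ?I = "fat_ideal n m p"
  have low: "graded_part ?I t = {0}" if "t < ?\<alpha>" for t using that unhindered_graded_part_iff by blast
  from resolution_injective[OF low unhindered_growth assms] have
    le: "3 * hilbert ?I ?\<alpha> \<le> hilbert ?I (Suc ?\<alpha>)" and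
    res: "\<exists>a s b g M. min_graded_free_resolution ?I (hilbert ?I ?\<alpha> + (hilbert ?I (Suc ?\<alpha>) - 3 * hilbert ?I ?\<alpha>)) a s b g M"
    by blast+
  \<comment> \<open>With h' = h + \<alpha> + 2 the rank is h' - 2 h = \<alpha> + 2 - h, and 3 h
    \<le> h' says that this is at least h.\<close>
  have "int (hilbert ?I ?\<alpha> + (hilbert ?I (Suc ?\<alpha>) - 3 * hilbert ?I ?\<alpha>)) = max (int (hilbert ?I ?\<alpha>)) (int ?\<alpha> + 2 - int (hilbert ?I ?\<alpha>))"
    using le unhindered_growth[of ?\<alpha>] by (simp add: of_nat_diff)
  with res show ?thesis unfolding rank_minimal_def Let_def unhindered_initial_degree using unh by blast
qed

lemma rank_minimal_surjective:
  assumes surj: "\<And>F. F \<in> graded_part (fat_ideal n m p) (Suc (expected_degree n m)) \<Longrightarrow> 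
      \<exists>A\<in>graded_part (fat_ideal n m p) (expected_degree n m). 
      \<exists>B\<in>graded_part (fat_ideal n m p) (expected_degree n m).
      \<exists>C\<in>graded_part (fat_ideal n m p) (expected_degree n m). F = Var 0 * A + Var 1 * B + Var 2 * C"
    and le: "expected_degree n m + 2 \<le> 2 * hilbert (fat_ideal n m p) (expected_degree n m)"
  shows "rank_minimal n m p"
proof -
  let ?\<alpha> = "expected_degree n m" and ?I = "fat_ideal n m p"
  have low: "graded_part ?I t = {0}" if "t < ?\<alpha>" for t using that unhindered_graded_part_iff by blast
  from resolution_surjective[OF low unhindered_growth surj] have
    res: "\<exists>a s b g M. min_graded_free_resolution ?I (hilbert ?I ?\<alpha>) a s b g M" by blast
  have "int (hilbert ?I ?\<alpha>) = max (int (hilbert ?I ?\<alpha>)) (int ?\<alpha> + 2 - int (hilbert ?I ?\<alpha>))"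
    using le by simp
  with res show ?thesis unfolding rank_minimal_def Let_def unhindered_initial_degree using unh by blast
qed

end

subsection \<open>Few forms of least degree\<close>

lemma vanishes_const_mult: "vanishes m v F \<Longrightarrow> vanishes m v (const c * F)"
  by (rule vanishes_mult_left)

lemma conditions_uniform: "conditions n (uniform_mult m) = n * (m * (m + 1))"
  by (simp add: conditions_def uniform_mult_def)

lemma conditions_raised:
  assumes "0 < n" shows "conditions n (raised_mult m) = n * (m * (m + 1)) + 2 * (m + 1)"
proof -
  have "conditions n (raised_mult m) = (\<Sum>i<n. m * (m + 1) + (if i = 0 then 2 * (m + 1) else 0))"
    unfolding conditions_def by (rule sum.cong) (auto simp: raised_mult_def)
  then show ?thesis using assms by (simp add: sum.distrib)
qed

text \<open>By the syzygy, z times the combination equals - (u A + u' B), where u and u' are linear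
  forms through v. That product vanishes to order m + 1, and z can be cancelled as it is nonzero at
  v.\<close>

lemma syzygy_vanishes_more:
  fixes A B C :: "'k::alg_closed_field ternary"
  assumes eq: "Var 0 * A + Var 1 * B + Var 2 * C = 0" and z: "v 2 \<noteq> 0"
    and "vanishes m v A" "vanishes m v B"
  shows "vanishes (Suc m) v (const (v 0) * A + const (v 1) * B + const (v 2) * C)"
proof -
  define u u' where "u = const (v 2) * Var 0 - const (v 0) * Var (2::3)" and "u' = const (v 2) * Var 1 - const (v 1) * Var (2::3)"
  have u1: "vanishes 1 v u" "vanishes 1 v u'"
    unfolding vanishes_iff u_def u'_def by (simp_all add: line_val_def line_val_simps)
  have "vanishes (1 + m) v (u * A + u' * B)"
    by (intro vanishes_add vanishes_mult u1 assms)
  then have "vanishes (Suc m) v (- (u * A + u' * B))" using vanishes_uminus by (metis plus_1_eq_Suc)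
  moreover have "Var 2 * (const (v 0) * A + const (v 1) * B + const (v 2) * C) = 
      const (v 2) * (Var 0 * A + Var 1 * B + Var 2 * C) - (u * A + u' * B)"
    by (simp add: u_def u'_def algebra_simps)
  then have "Var 2 * (const (v 0) * A + const (v 1) * B + const (v 2) * C) = - (u * A + u' * B)"
    unfolding eq by simp
  ultimately have "vanishes (Suc m) v (Var 2 * (const (v 0) * A + const (v 1) * B + const (v 2) * C))"
    by simp
  then show ?thesis using vanishes_cancel_nonzero[of v "Var 2"] z by (simp add: eval_Var)
qed

text \<open>The rows v, w and (x, y, z) form a matrix that annihilates (A, B, C). Cramer's rule
  gives L C = 0 for its determinant L, and A, B are then recovered by dividing by the nonzero minor
  D.\<close>

lemma syzygy_trivial:
  fixes A B C :: "'k::alg_closed_field ternary"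
  assumes eq: "Var 0 * A + Var 1 * B + Var 2 * C = 0" 
    and v: "const (v 0) * A + const (v 1) * B + const (v 2) * C = 0"
    and w: "const (w 0) * A + const (w 1) * B + const (w 2) * C = 0"
    and D: "v 0 * w 1 - v 1 * w 0 \<noteq> (0::'k)"
  shows "A = 0 \<and> B = 0 \<and> C = 0"
proof -
  define D' where "D' = v 0 * w 1 - v 1 * w 0"
  have A: "const D' * A = const (v 1 * w 2 - v 2 * w 1) * C"
  proof -
    have "const D' * A - const (v 1 * w 2 - v 2 * w 1) * C = 
        const (w 1) * (const (v 0) * A + const (v 1) * B + const (v 2) * C) -
        const (v 1) * (const (w 0) * A + const (w 1) * B + const (w 2) * C)"
      unfolding D'_def const_hom by (simp add: algebra_simps)
    then show ?thesis using v w by simp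
  qed
  have B: "const D' * B = const (v 2 * w 0 - v 0 * w 2) * C"
  proof -
    have "const D' * B - const (v 2 * w 0 - v 0 * w 2) * C = 
        const (v 0) * (const (w 0) * A + const (w 1) * B + const (w 2) * C) -
        const (w 0) * (const (v 0) * A + const (v 1) * B + const (v 2) * C)"
      unfolding D'_def const_hom by (simp add: algebra_simps)
    then show ?thesis using v w by simp
  qed
  \<comment> \<open>The equation of the line through v and w; the coefficient of z in it is D, so it
    is not zero.\<close>
  define L where "L = const (v 1 * w 2 - v 2 * w 1) * Var 0 + const (v 2 * w 0 - v 0 * w 2) * Var 1 + const D' * Var (2 :: 3)"
  have "L * C = Var 0 * (const D' * A) + Var 1 * (const D' * B) + Var 2 * (const D' * C)"
    unfolding A B L_def by (simp only: distrib_right mult.assoc mult.left_commute)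
  also have "\<dots> = const D' * (Var 0 * A + Var 1 * B + Var 2 * C)"
    by (simp only: distrib_left mult.left_commute)
  finally have "L * C = 0" using eq by simp
  moreover have "eval_mpoly (\<lambda>i. if i = 2 then 1 else 0) L = D'"
    by (simp add: L_def eval_mpoly_eq_subst subst_add subst_mult subst_const subst_Var)
  then have "L \<noteq> 0" using D by (auto simp: D'_def eval_mpoly_eq_subst)
  ultimately have C: "C = 0" by simp
  have "const D' \<noteq> (0 :: 'k ternary)" 
    using D by (auto simp: D'_def const_def dest: arg_cong[of _ _ "\<lambda>F. Poly_Mapping.lookup F 0"])
  then show ?thesis using A B C by simp
qed

text \<open>The two inequalities say that the expected dimension of I_t is positive and that of I'_t
  is not. The first gives \<alpha> \<le> t, and then the second makes I'_\<alpha> zero.\<close>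

theorem general_rank_minimal_injective:
  assumes n: "2 \<le> n" 
    and t: "n * (m * (m + 1)) < (t + 1) * (t + 2)" "(t + 1) * (t + 2) \<le> n * (m * (m + 1)) + 2 * (m + 1)"
  shows "for_general_points n (\<lambda>p :: nat \<Rightarrow> 'k::alg_closed_field proj_plane.
    unhindered n (uniform_mult m) p \<and> unhindered n (raised_mult m) p \<longrightarrow> rank_minimal n (uniform_mult m) p)"
\<comment> \<open>If I' is hindered for every tuple, the claim is vacuous. Otherwise a single
  unhindered tuple is a witness that I'_\<alpha> = 0 is a generic condition, and this can be imposed
  with the raised multiplicity at either of two points.\<close>
proof (cases "\<exists>p :: nat \<Rightarrow> 'k proj_plane. unhindered n (raised_mult m) p")
  case False
  then have "generic n (\<lambda>p :: nat \<Rightarrow> 'k proj_plane. 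
     unhindered n (uniform_mult m) p \<and> unhindered n (raised_mult m) p \<longrightarrow> rank_minimal n (uniform_mult m) p)"
    by (intro generic_mono[OF generic_True]) blast
  then show ?thesis by (rule for_general_points_if_generic)
next
  case True
  then obtain p0 :: "nat \<Rightarrow> 'k proj_plane" where p0: "unhindered n (raised_mult m) p0" by blast
  define \<alpha> where "\<alpha> = expected_degree n (uniform_mult m)"
  \<comment> \<open>Renumbering the witness moves the raised multiplicity to the second
    point.\<close>
  define swap :: "nat \<Rightarrow> nat" where "swap i = (if i = 0 then 1 else if i = 1 then 0 else i)" for i
  have swap: "swap i < n" "swap (swap i) = i" if "i < n" for i using that n by (auto simp: swap_def)
  have "\<alpha> \<le> t" unfolding \<alpha>_def expected_degree_iff conditions_uniform by (rule t(1))
  then have "(\<alpha> + 1) * (\<alpha> + 2) \<le> (t + 1) * (t + 2)" by (intro mult_mono) auto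
  then have "2 * hilbert (fat_ideal n (raised_mult m) p0) \<alpha> = 0"
    unfolding unhindered_hilbert[OF p0] using conditions_raised[of n m] n t(2) by simp
  then have h0: "hilbert (fat_ideal n (raised_mult m) p0) \<alpha> = 0" by simp
  have no0: "F = 0" if "homogeneous \<alpha> F" "\<And>i. i < n \<Longrightarrow> vanishes (raised_mult m i) (lifts p0 i) F" for F
    by (rule hilbert_fat_ideal_0[OF h0]) (use that in \<open>simp add: graded_fat_ideal_iff\<close>)
  have nz: "nonzero_lifts n (lifts p0)" "nonzero_lifts n (\<lambda>i. lifts p0 (swap i))"
    by (auto simp: nonzero_lifts_def lifts_def rep_proj_plane_nonzero)
  have G0: "generic n (\<lambda>p :: nat \<Rightarrow> 'k proj_plane. \<forall>F. constrained_forms n (raised_mult m) \<alpha> {0} {} (lifts p) F \<longrightarrow> (\<forall>c\<in>{0}. F c = 0))"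
    by (rule generic_no_constrained_forms[OF nz(1)]) (use no0 in \<open>auto simp: constrained_forms_def\<close>)
  have G1: "generic n (\<lambda>p :: nat \<Rightarrow> 'k proj_plane. \<forall>F. constrained_forms n (\<lambda>i. raised_mult m (swap i)) \<alpha> {0} {} (lifts p) F \<longrightarrow> (\<forall>c\<in>{0}. F c = 0))"
  proof (rule generic_no_constrained_forms[OF nz(2)])
    fix F assume F: "constrained_forms n (\<lambda>i. raised_mult m (swap i)) \<alpha> {0} {} (\<lambda>i. lifts p0 (swap i)) F"
    have "F 0 = 0"
    proof (rule no0)
      show "homogeneous \<alpha> (F 0)" using F by (simp add: constrained_forms_def)
      fix i assume i: "i < n"
      have "vanishes (raised_mult m (swap (swap i))) (lifts p0 (swap (swap i))) (F 0)"
        using F swap(1)[OF i] by (auto simp: constrained_forms_def)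
      then show "vanishes (raised_mult m i) (lifts p0 i) (F 0)" using swap(2)[OF i] by simp
    qed
    then show "\<forall>c\<in>{0}. F c = 0" by simp
  qed
  have GD: "generic n (\<lambda>p :: nat \<Rightarrow> 'k proj_plane. lifts p 0 0 * lifts p 1 1 - lifts p 0 1 * lifts p 1 0 \<noteq> 0)"
    by (rule generic_distinct) (use n in auto)
  have GZ: "generic n (\<lambda>p :: nat \<Rightarrow> 'k proj_plane. \<forall>i<n. lifts p i 2 \<noteq> 0)" by (rule generic_all_coords) simp
  show ?thesis
  proof (rule for_general_points_if_generic, rule generic_mono[OF generic_conj[OF generic_conj[OF G0 G1] generic_conj[OF GD GZ]]], rule impI)
    fix p :: "nat \<Rightarrow> 'k proj_plane"
    assume G: "((\<forall>F. constrained_forms n (raised_mult m) \<alpha> {0} {} (lifts p) F \<longrightarrow> (\<forall>c\<in>{0}. F c = 0)) \<and>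
        (\<forall>F. constrained_forms n (\<lambda>i. raised_mult m (swap i)) \<alpha> {0} {} (lifts p) F \<longrightarrow> (\<forall>c\<in>{0}. F c = 0))) \<and>
        lifts p 0 0 * lifts p 1 1 - lifts p 0 1 * lifts p 1 0 \<noteq> 0 \<and> (\<forall>i<n. lifts p i 2 \<noteq> 0)"
      and "unhindered n (uniform_mult m) p \<and> unhindered n (raised_mult m) p"
    then have unh: "unhindered n (uniform_mult m) p" by blast
    have z: "\<forall>i<n. lifts p i 2 \<noteq> 0" using G by blast
    show "rank_minimal n (uniform_mult m) p"
    proof (rule rank_minimal_injective[OF z unh])
      fix A B C :: "'k ternary"
      assume mem: "A \<in> graded_part (fat_ideal n (uniform_mult m) p) (expected_degree n (uniform_mult m))"
          "B \<in> graded_part (fat_ideal n (uniform_mult m) p) (expected_degree n (uniform_mult m))"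
          "C \<in> graded_part (fat_ideal n (uniform_mult m) p) (expected_degree n (uniform_mult m))"
        and eq: "Var 0 * A + Var 1 * B + Var 2 * C = 0"
      have A: "homogeneous \<alpha> A \<and> (\<forall>i<n. vanishes m (lifts p i) A)"
        and B: "homogeneous \<alpha> B \<and> (\<forall>i<n. vanishes m (lifts p i) B)"
        and C: "homogeneous \<alpha> C \<and> (\<forall>i<n. vanishes m (lifts p i) C)"
        using mem unfolding graded_fat_ideal_iff \<alpha>_def by (simp_all add: uniform_mult_def)
      define L where "L i = const (lifts p i 0) * A + const (lifts p i 1) * B + const (lifts p i 2) * C" for i
      have L: "homogeneous \<alpha> (L i)" "\<And>i'. i' < n \<Longrightarrow> vanishes m (lifts p i') (L i)" for i
        unfolding L_def using A B C by (auto intro!: homogeneous_add homogeneous_const_mult vanishes_add vanishes_const_mult)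
      have L': "vanishes (Suc m) (lifts p i) (L i)" if "i < n" for i
        unfolding L_def by (rule syzygy_vanishes_more[OF eq]) (use A B z that in auto)
      have "constrained_forms n (raised_mult m) \<alpha> {0} {} (lifts p) (\<lambda>_. L 0)"
        using L(1)[of 0] L(2)[of _ 0] L'[of 0] by (auto simp: constrained_forms_def raised_mult_def)
      then have L0: "L 0 = 0" using G by blast
      have "constrained_forms n (\<lambda>i. raised_mult m (swap i)) \<alpha> {0} {} (lifts p) (\<lambda>_. L 1)"
        using L(1)[of 1] L(2)[of _ 1] L'[of 1] by (auto simp: constrained_forms_def raised_mult_def swap_def)
      then have L1: "L 1 = 0" using G by blast
      show "A = 0 \<and> B = 0 \<and> C = 0"
        by (rule syzygy_trivial[OF eq L0[unfolded L_def] L1[unfolded L_def]]) (use G in blast)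
    qed
  qed
qed

section \<open>A special configuration of an even square number of points\<close>

text \<open>The curve is a union of \<open>2 q\<close> lines tangent to a common conic, so that the line with parameter \<open>s\<close> and the
  line with parameter \<open>t\<close> meet at \<open>node s t\<close>.\<close>

definition node :: "'k::comm_ring_1 \<Rightarrow> 'k \<Rightarrow> 3 \<Rightarrow> 'k" where
  "node s t i = (if i = 0 then s * t else if i = 1 then - (s + t) else 1)"

text \<open>\<open>node s t\<close> lists the coefficients of the quadratic with roots s and t, and
  this linear form evaluates the quadratic at -c up to the sign convention: its value at the node is
  (c - s)(c - t).\<close>

definition line_form :: "'k::comm_ring_1 \<Rightarrow> 'k ternary" where
  "line_form c = Var 0 + const c * Var 1 + const (c\<^sup>2) * Var 2"

definition line_dir :: "'k::comm_ring_1 \<Rightarrow> 3 \<Rightarrow> 'k" where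
  "line_dir c i = (if i = 0 then c else if i = 1 then - 1 else 0)"

text \<open>The parametrization sends t to \<open>node c t\<close>. By symmetry of nodes, the value
  of a form at the intersection of two lines is read off from either restriction at the parameter of
  the other line.\<close>

definition restrict_line :: "'k::comm_ring_1 \<Rightarrow> 'k ternary \<Rightarrow> 'k poly" where
  "restrict_line c = line_val (node c 0) (line_dir c)"

lemma node_commute: "node s t = node t s"
  by (auto simp: node_def fun_eq_iff algebra_simps)

lemma poly_restrict_line: "poly (restrict_line c F) t = eval_mpoly (node c t) F"
proof -
  have "(\<lambda>i. node c 0 i + t * line_dir c i) = node c t"
    by (auto simp: node_def line_dir_def fun_eq_iff algebra_simps)
  then show ?thesis by (simp add: restrict_line_def poly_line_val)
qed

lemma restrict_line_simps:
  "restrict_line c 0 = 0" "restrict_line c (F + G) = restrict_line c F + restrict_line c G" 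
  "restrict_line c (F * G) = restrict_line c F * restrict_line c G"
  "restrict_line c (F ^ k) = restrict_line c F ^ k" "restrict_line c (const a) = [:a:]"
  "restrict_line c (Var 0) = [:0, c:]" "restrict_line c (Var 1) = [:- c, - 1:]" "restrict_line c (Var 2) = [:1:]"
  by (simp_all add: restrict_line_def line_val_def line_val_simps node_def line_dir_def)

lemma restrict_line_sum: "restrict_line c (\<Sum>i\<in>A. f i) = (\<Sum>i\<in>A. restrict_line c (f i))"
  by (simp add: restrict_line_def line_val_sum)

lemma homogeneous_line_form [simp]: "homogeneous 1 (line_form c)"
  unfolding line_form_def by (intro homogeneous_add homogeneous_const_mult) simp_all

lemma eval_line_form: "eval_mpoly (node s t) (line_form c) = (c - s) * (c - t :: 'k::comm_ring_1)"
  by (simp add: line_form_def eval_mpoly_eq_subst subst_add subst_mult subst_const subst_Var node_def 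
      algebra_simps power2_eq_square)

lemma pcompose_power: "pcompose (p ^ k) r = pcompose p r ^ k" for p r :: "'k::comm_ring_1 poly"
  by (induction k) (simp_all add: pcompose_mult pcompose_1)

text \<open>In the coordinates \<open>line_form c\<close>, y, z only the terms free of
  \<open>line_form c\<close> survive on the line. There y becomes -(c + t) and z becomes 1, so those
  terms form a polynomial in -(c + t) whose coefficients must all be zero.\<close>

lemma line_form_dvd:
  fixes F :: "'k::alg_closed_field ternary"
  assumes F: "homogeneous d F" and zero: "restrict_line c F = 0"
  shows "\<exists>G. F = line_form c * G \<and> shifted_homogeneous 1 d G"
proof -
  have "\<exists>r s t. Var i = const r * line_form c + const s * Var 1 + const t * Var 2" for i
  proof -
    have "Var 0 = const 1 * line_form c + const (- c) * Var 1 + const (- (c\<^sup>2)) * Var 2"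
      by (simp add: line_form_def const_hom)
    moreover have "Var 1 = const 0 * line_form c + const 1 * Var 1 + const 0 * (Var 2 :: 'k ternary)"
      "Var 2 = const 0 * line_form c + const 0 * Var 1 + const 1 * (Var 2 :: 'k ternary)" by simp_all
    ultimately have "\<forall>i. \<exists>r s t. Var i = const r * line_form c + const s * Var 1 + const t * (Var 2 :: 'k ternary)"
      unfolding forall_3 by blast
    then show ?thesis by blast
  qed
  from homogeneous_linear_basis[OF this F] obtain k where
    k: "F = (\<Sum>(i,j)\<in>{(i,j). i + j \<le> d}. const (k i j) * (line_form c ^ i * Var 1 ^ j * Var 2 ^ (d - i - j)))" by blast
  define S where "S = {(i::nat,j::nat). i + j \<le> d}"
  have fin: "finite S" unfolding S_def by (rule finite_subset[of _ "{..d} \<times> {..d}"]) auto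
  have line0: "restrict_line c (line_form c) = 0"
    by (simp add: line_form_def restrict_line_simps power2_eq_square)
  define Q where "Q = (\<Sum>j\<le>d. monom (k 0 j) j)"
  have "restrict_line c F = (\<Sum>(i,j)\<in>S. if i = 0 then [:k 0 j:] * [:- c, - 1:] ^ j else 0)"
    unfolding k restrict_line_sum S_def
    by (rule sum.cong) (auto simp: restrict_line_simps line0 zero_power simp flip: one_pCons)
  also have "\<dots> = (\<Sum>(i,j)\<in>Pair (0::nat) ` {..d}. if i = 0 then [:k 0 j:] * [:- c, - 1:] ^ j else 0)"
    by (rule sum.mono_neutral_right[OF fin]) (auto simp: S_def)
  also have "\<dots> = (\<Sum>j\<le>d. [:k 0 j:] * [:- c, - 1:] ^ j)"
    by (subst sum.reindex) (auto simp: inj_on_def)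
  also have "\<dots> = pcompose Q [:- c, - 1:]"
    by (simp add: Q_def pcompose_sum monom_altdef pcompose_smult pcompose_power pcompose_pCons)
  finally have "pcompose Q [:- c, - 1:] = 0" using zero by simp
  then have "Q = 0" by (rule pcompose_eq_0) simp
  have k0: "k 0 j = 0" if "j \<le> d" for j
  proof -
    have "coeff Q j = k 0 j" using that by (simp add: Q_def coeff_sum)
    then show ?thesis using \<open>Q = 0\<close> by simp
  qed
  define S' where "S' = {(i, j) \<in> S. 0 < i}"
  define G where "G = (\<Sum>(i,j)\<in>S'. const (k i j) * (line_form c ^ (i - 1) * Var 1 ^ j * Var 2 ^ (d - i - j)))"
  have "F = (\<Sum>(i,j)\<in>S'. const (k i j) * (line_form c ^ i * Var 1 ^ j * Var 2 ^ (d - i - j)))"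
    unfolding k S_def[symmetric] S'_def
  proof (rule sum.mono_neutral_right[OF fin])
    show "\<forall>x\<in>S - {(i, j) \<in> S. 0 < i}. (case x of (i, j) \<Rightarrow> const (k i j) * (line_form c ^ i * Var 1 ^ j * Var 2 ^ (d - i - j))) = 0"
    proof
      fix x assume "x \<in> S - {(i, j) \<in> S. 0 < i}"
      moreover obtain i j where "x = (i, j)" by force
      ultimately have "x = (0, j)" "j \<le> d" by (cases i; auto simp: S_def)+
      then show "(case x of (i, j) \<Rightarrow> const (k i j) * (line_form c ^ i * Var 1 ^ j * Var 2 ^ (d - i - j))) = 0"
        by (simp add: k0)
    qed
  qed auto
  also have "\<dots> = line_form c * G"
    unfolding G_def sum_distrib_left
  proof (rule sum.cong[OF refl])
    fix x assume "x \<in> S'"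
    then obtain i j where x: "x = (Suc i, j)" by (auto simp: S'_def gr0_conv_Suc)
    show "(case x of (i, j) \<Rightarrow> const (k i j) * (line_form c ^ i * Var 1 ^ j * Var 2 ^ (d - i - j))) =
      line_form c * (case x of (i, j) \<Rightarrow> const (k i j) * (line_form c ^ (i - 1) * Var 1 ^ j * Var 2 ^ (d - i - j)))"
      by (simp add: x mult.assoc mult.left_commute)
  qed
  finally have "F = line_form c * G" .
  moreover have "shifted_homogeneous 1 d G"
    unfolding G_def
  proof (rule shifted_homogeneous_sum)
    fix x assume "x \<in> S'"
    then obtain i j where x: "x = (Suc i, j)" "Suc i + j \<le> d" by (auto simp: S'_def S_def gr0_conv_Suc)
    have "homogeneous (i * 1 + j * 1 + (d - Suc i - j) * 1) (line_form c ^ i * Var 1 ^ j * Var 2 ^ (d - Suc i - j))"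
      by (intro homogeneous_mult homogeneous_power homogeneous_line_form homogeneous_Var(1))
    moreover have "i * 1 + j * 1 + (d - Suc i - j) * 1 = d - 1" using x(2) by simp
    ultimately show "shifted_homogeneous 1 d (case x of (i, j) \<Rightarrow> const (k i j) * (line_form c ^ (i - 1) * Var 1 ^ j * Var 2 ^ (d - i - j)))"
      using x by (simp add: shifted_homogeneous_iff homogeneous_const_mult)
  qed
  ultimately show ?thesis by blast
qed

lemma restrict_line_line_form_neq_0:
  assumes "b \<noteq> c" shows "restrict_line c (line_form b) \<noteq> (0 :: 'k::field poly)"
proof
  assume "restrict_line c (line_form b) = 0"
  then have "eval_mpoly (node c 0) (line_form b) = 0" "eval_mpoly (node c 1) (line_form b) = 0"
    using poly_restrict_line by (metis poly_0)+
  then show False using assms by (auto simp: eval_line_form)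
qed

lemma line_forms_dvd:
  fixes F :: "'k::alg_closed_field ternary"
  assumes F: "homogeneous d F" and inj: "inj_on c {..<N}" and zero: "\<And>a. a < N \<Longrightarrow> restrict_line (c a) F = 0"
  shows "\<exists>G. F = (\<Prod>a<N. line_form (c a)) * G \<and> shifted_homogeneous N d G"
  using inj zero
proof (induction N)
  case 0
  then show ?case using F by (auto simp: shifted_homogeneous_0_iff)
next
  case (Suc N)
  then obtain G where G: "F = (\<Prod>a<N. line_form (c a)) * G" "shifted_homogeneous N d G"
    by (auto simp: inj_on_def)
  have "restrict_line (c N) F = (\<Prod>a<N. restrict_line (c N) (line_form (c a))) * restrict_line (c N) G"
    unfolding G(1) restrict_line_def line_val_def line_val_simps ..
  moreover have "(\<Prod>a<N. restrict_line (c N) (line_form (c a))) \<noteq> 0"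
    using Suc.prems(1) by (auto simp: inj_on_def intro!: restrict_line_line_form_neq_0)
  ultimately have zero: "restrict_line (c N) G = 0" using Suc.prems(2)[of N] by simp
  show ?case
  proof (cases "N \<le> d")
    case True
    then have "homogeneous (d - N) G" using G(2) by (simp add: shifted_homogeneous_iff)
    from line_form_dvd[OF this zero] obtain H where "G = line_form (c N) * H" "shifted_homogeneous 1 (d - N) H" by blast
    moreover from this(2) have "shifted_homogeneous (Suc N) d H"
      using True unfolding shifted_homogeneous_def by fastforce
    ultimately show ?thesis using G(1) by (intro exI[of _ H]) (simp add: mult.assoc)
  next
    case False
    then have "F = 0" using G by (simp add: shifted_homogeneous_iff)
    then show ?thesis by (intro exI[of _ 0]) simp
  qed
qed

subsection \<open>Multiplicities on the lines\<close>

text \<open>Polynomial dependence on the direction allows finitely many exceptional directions to be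
  ignored.\<close>

lemma line_coeff_polynomial:
  fixes F :: "'k::comm_ring_1 ternary"
  assumes F: "homogeneous d F"
  shows "\<exists>Q. \<forall>x. coeff (line_val v (\<lambda>i. w i + x * u i) F) k = poly Q x"
proof -
  have single: "\<exists>Q. \<forall>x. coeff (line_val v (\<lambda>i. w i + x * u i) (Poly_Mapping.single e 1)) k = poly Q x" for e k
  proof (induction e arbitrary: k rule: exponent_induct)
    case zero
    show ?case by (rule exI[of _ "[:if k = 0 then 1 else 0:]"]) (simp add: line_val_def line_val_simps coeff_1)
  next
    case (add e i)
    have "\<forall>k. \<exists>Q. \<forall>x. coeff (line_val v (\<lambda>i. w i + x * u i) (Poly_Mapping.single e 1)) k = poly Q x"
      by (intro allI add.IH)
    from choice[OF this] obtain Q where 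
      Q: "\<And>k x. coeff (line_val v (\<lambda>i. w i + x * u i) (Poly_Mapping.single e 1)) k = poly (Q k) x" by blast
    show ?case
    proof (cases k)
      case 0
      then show ?thesis unfolding line_val_single_Suc
        by (intro exI[of _ "[:v i:] * Q 0"]) (simp add: Q)
    next
      case (Suc k')
      then show ?thesis unfolding line_val_single_Suc
        by (intro exI[of _ "[:v i:] * Q k + [:w i, u i:] * Q k'"]) (simp add: Q algebra_simps)
    qed
  qed
  have "\<forall>e. \<exists>Q. \<forall>x. coeff (line_val v (\<lambda>i. w i + x * u i) (Poly_Mapping.single e 1)) k = poly Q x"
    by (intro allI single)
  from choice[OF this] obtain Q where 
    Q: "\<And>e x. coeff (line_val v (\<lambda>i. w i + x * u i) (Poly_Mapping.single e 1)) k = poly (Q e) x" by blast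
  show ?thesis
    unfolding line_val_homogeneous[OF F]
    by (intro exI[of _ "\<Sum>e\<in>{e. exp_degree e = d}. [:Poly_Mapping.lookup F e:] * Q e"])
      (simp add: coeff_sum poly_sum Q)
qed

text \<open>In a direction transverse to the line, its form restricts to a nonzero multiple of t,
  which can be cancelled. Directions along the line are reached by perturbing: adding x to the first
  coordinate makes them transverse for all but one x.\<close>

lemma vanishes_cancel_line_form:
  fixes F :: "'k::alg_closed_field ternary"
  assumes F: "homogeneous d F" and v: "eval_mpoly v (line_form c) = 0" 
    and van: "vanishes (Suc m) v (line_form c * F)"
  shows "vanishes m v F"
  unfolding vanishes_iff
proof (intro allI impI)
  fix w k assume k: "k < m"
  define l where "l w = w 0 + c * w 1 + c\<^sup>2 * w 2" for w :: "3 \<Rightarrow> 'k"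
  have lv: "line_val v w (line_form c) = [:0, l w:]" for w
    using v by (simp add: line_form_def line_val_def line_val_simps l_def eval_mpoly_eq_subst subst_add subst_mult subst_const subst_Var algebra_simps)
  define u :: "3 \<Rightarrow> 'k" where "u i = (if i = 0 then 1 else 0)" for i
  obtain Q where Q: "\<And>x. coeff (line_val v (\<lambda>i. w i + x * u i) F) k = poly Q x"
    using line_coeff_polynomial[OF F, of v w u k] by blast
  have "poly Q x = 0" if x: "x \<notin> {- l w}" for x
  proof -
    let ?w = "\<lambda>i. w i + x * u i"
    have "l ?w = l w + x" by (simp add: l_def u_def algebra_simps)
    then have nz: "l ?w \<noteq> 0" using x by (auto simp: add_eq_0_iff add.commute)
    have "line_val v ?w (line_form c * F) = [:0, l ?w:] * line_val v ?w F"
      using lv[of ?w] by (simp add: line_val_def line_val_simps)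
    moreover have "coeff (line_val v ?w (line_form c * F)) (Suc k) = 0" using van k by (simp add: vanishes_iff)
    ultimately have "l ?w * coeff (line_val v ?w F) k = 0" by simp
    then show ?thesis using nz Q by simp
  qed
  then have "Q = 0" using poly_eq_0_cofinite[of "{- l w}" Q] by simp
  then show "coeff (line_val v w F) k = 0" using Q[of 0] by simp
qed

lemma linear_power_dvd_cancel:
  fixes f g :: "'k::field poly"
  assumes "[:- a, 1:] ^ m dvd g * f" "poly g a \<noteq> 0"
  shows "[:- a, 1:] ^ m dvd f"
  using assms(1)
proof (induction m arbitrary: f)
  case (Suc m)
  have "[:- a, 1:] dvd g * f" by (rule dvd_trans[OF _ Suc.prems]) (simp only: power_Suc dvd_triv_left)
  then have "poly (g * f) a = 0" using poly_eq_0_iff_dvd by blast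
  then have "poly f a = 0" using assms(2) by simp
  then obtain f' where f': "f = [:- a, 1:] * f'" by (auto simp: poly_eq_0_iff_dvd)
  have "[:- a, 1:] * [:- a, 1:] ^ m dvd [:- a, 1:] * (g * f')"
    using Suc.prems by (simp only: f' power_Suc mult.left_commute)
  then have "[:- a, 1:] ^ m dvd g * f'" by (simp only: dvd_mult_cancel_left) simp
  from Suc.IH[OF this] show ?case unfolding f' power_Suc by (rule mult_dvd_mono[OF dvd_refl])
qed simp

lemma linear_powers_dvd:
  fixes f :: "'k::field poly"
  assumes "finite A" "inj_on s A" "\<And>k. k \<in> A \<Longrightarrow> [:- s k, 1:] ^ m dvd f"
  shows "(\<Prod>k\<in>A. [:- s k, 1:]) ^ m dvd f"
  using assms
proof (induction A rule: finite_induct)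
  case (insert k A)
  then obtain h where h: "f = (\<Prod>k\<in>A. [:- s k, 1:]) ^ m * h" by (auto simp: inj_on_def elim: dvdE)
  have "poly ((\<Prod>k\<in>A. [:- s k, 1:]) ^ m) (s k) \<noteq> 0"
    using insert.hyps insert.prems(1) by (auto simp: poly_power poly_prod inj_on_def)
  moreover have "[:- s k, 1:] ^ m dvd (\<Prod>k\<in>A. [:- s k, 1:]) ^ m * h" using insert.prems(2)[of k] h by simp
  ultimately have "[:- s k, 1:] ^ m dvd h" by (rule linear_power_dvd_cancel[rotated])
  then have "[:- s k, 1:] ^ m * (\<Prod>k\<in>A. [:- s k, 1:]) ^ m dvd h * (\<Prod>k\<in>A. [:- s k, 1:]) ^ m" 
    by (rule mult_dvd_mono) simp
  moreover have "(\<Prod>k\<in>insert k A. [:- s k, 1:]) ^ m = [:- s k, 1:] ^ m * (\<Prod>k\<in>A. [:- s k, 1:]) ^ m"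
    by (simp only: prod.insert[OF insert.hyps] power_mult_distrib)
  ultimately show ?case using h by (simp only: mult.commute)
qed simp

text \<open>The parametrization starting at \<open>node c s\<close> is the one starting at
  \<open>node c 0\<close> with t replaced by t + s.\<close>

lemma restrict_line_dvd:
  fixes F :: "'k::alg_closed_field ternary"
  assumes "vanishes m (node c s) F"
  shows "[:- s, 1:] ^ m dvd restrict_line c F"
proof -
  have "line_val (node c s) (line_dir c) F = pcompose (restrict_line c F) [:s, 1:]"
  proof -
    have "poly (line_val (node c s) (line_dir c) F - pcompose (restrict_line c F) [:s, 1:]) t = 0" for t
    proof -
      have "(\<lambda>i. node c s i + t * line_dir c i) = node c (s + t)"
        by (auto simp: node_def line_dir_def fun_eq_iff algebra_simps)
      then show ?thesis by (simp add: poly_line_val poly_pcompose poly_restrict_line)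
    qed
    then show ?thesis using poly_eq_0_cofinite[of "{}"] by (metis eq_iff_diff_eq_0 finite.emptyI)
  qed
  then have "monom 1 m dvd pcompose (restrict_line c F) [:s, 1:]" using assms by (metis vanishes_def)
  then obtain h where "pcompose (restrict_line c F) [:s, 1:] = monom 1 m * h" by blast
  then have "pcompose (pcompose (restrict_line c F) [:s, 1:]) [:- s, 1:] = pcompose (monom 1 m) [:- s, 1:] * pcompose h [:- s, 1:]"
    by (simp add: pcompose_mult)
  moreover have "pcompose (pcompose (restrict_line c F) [:s, 1:]) [:- s, 1:] = restrict_line c F"
    by (simp flip: pcompose_assoc add: pcompose_pCons)
  moreover have "pcompose (monom 1 m) [:- s, 1:] = [:- s, 1:] ^ m"
    by (simp add: monom_altdef pcompose_power pcompose_pCons)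
  ultimately show ?thesis by simp
qed

subsection \<open>Gluing along the nodes\<close>

text \<open>The \<open>2 q\<close> lines come in pairs \<open>{2 u, 2 u + 1}\<close>. As \<open>\<epsilon>\<close> tends to \<open>0\<close>, the point \<open>k \<noteq> a div 2\<close> (\<open>k < q\<close>) of
  line \<open>a\<close> moves to the intersection with the line \<open>partner a k\<close> of pair \<open>k\<close>. For any two lines of different
  pairs, exactly one of them has a point that moves to their intersection. In the limit the
  restrictions to different pairs decouple.\<close>

definition partner :: "nat \<Rightarrow> nat \<Rightarrow> nat" where
  "partner a v = 2 * v + (if v < a div 2 then a mod 2 else 1 - a mod 2)"

text \<open>The line of pair \<open>v\<close> that has a point moving to line \<open>b\<close>; the
  other line of that pair is \<open>partner b v\<close>, to which \<open>b\<close> sends a point.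
  The parity rule decides between two lines: with equal parity the later pair supplies the point,
  with different parity the earlier one.\<close>

definition copartner :: "nat \<Rightarrow> nat \<Rightarrow> nat" where
  "copartner b v = 2 * v + (if b div 2 < v then b mod 2 else 1 - b mod 2)"

lemma parity_cases: "(a::nat) mod 2 = 0 \<or> a mod 2 = 1"
  by auto

lemma partner_div [simp]: "partner a v div 2 = v"
  using parity_cases[of a] by (auto simp: partner_def)

lemma copartner_div [simp]: "copartner a v div 2 = v"
  using parity_cases[of a] by (auto simp: copartner_def)

lemma partner_less: "v < q \<Longrightarrow> partner a v < 2 * q"
  using parity_cases[of a] by (auto simp: partner_def)

lemma copartner_less: "v < q \<Longrightarrow> copartner a v < 2 * q"
  using parity_cases[of a] by (auto simp: copartner_def)

lemma partner_copartner: "v \<noteq> b div 2 \<Longrightarrow> partner (copartner b v) (b div 2) = b"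
proof -
  assume v: "v \<noteq> b div 2"
  have m: "copartner b v mod 2 = (if b div 2 < v then b mod 2 else 1 - b mod 2)"
    using parity_cases[of b] by (auto simp: copartner_def)
  have "2 * (b div 2) + b mod 2 = b" by simp
  then show ?thesis using v parity_cases[of b] unfolding partner_def m copartner_div by auto
qed

lemma partner_neq_copartner: "v \<noteq> b div 2 \<Longrightarrow> partner b v \<noteq> copartner b v"
  using parity_cases[of b] by (auto simp: partner_def copartner_def)

section \<open>Moving points and gluing conditions\<close>

locale configuration =
  fixes q :: nat and e :: "nat \<Rightarrow> 'k::alg_closed_field"
  assumes q: "1 \<le> q" and inj_e: "inj e"
begin

text \<open>The lines have parameters \<open>e 0, \<dots>, e (2 q - 1)\<close>. The remaining \<open>e (2 q + k)\<close> are used for the points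
  that do not move.\<close>

definition point_param :: "'k \<Rightarrow> nat \<Rightarrow> nat \<Rightarrow> 'k" where
  "point_param \<epsilon> a k = (if k < q \<and> k \<noteq> a div 2 then e (partner a k) + \<epsilon> else e (2 * q + k))"

text \<open>Values of \<epsilon> at which a moving point may hit a line or a fixed point. The value
  0 is among them: the limit enters only through its gluing conditions.\<close>

definition bad :: "'k set" where
  "bad = (\<lambda>(i, j). e i - e j) ` ({..<4 * q} \<times> {..<4 * q})"

lemma finite_bad: "finite bad"
  by (simp add: bad_def)

lemma good_neq: "\<epsilon> \<notin> bad \<Longrightarrow> i < 4 * q \<Longrightarrow> j < 4 * q \<Longrightarrow> e j + \<epsilon> \<noteq> e i"
  unfolding bad_def by (auto simp: image_iff algebra_simps)

lemma e_eq_iff: "e i = e j \<longleftrightarrow> i = j"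
  using inj_e by (auto simp: inj_def)

lemma point_param_inj:
  assumes \<epsilon>: "\<epsilon> \<notin> bad"
  shows "inj_on (point_param \<epsilon> a) {..<2 * q}"
proof (rule inj_onI)
  fix k l assume kl: "k \<in> {..<2 * q}" "l \<in> {..<2 * q}" "point_param \<epsilon> a k = point_param \<epsilon> a l"
  have less: "partner a k < 4 * q" if "k < q" for k using partner_less[OF that, of a] by simp
  show "k = l"
  proof (cases "k < q \<and> k \<noteq> a div 2"; cases "l < q \<and> l \<noteq> a div 2")
    assume "k < q \<and> k \<noteq> a div 2" "l < q \<and> l \<noteq> a div 2"
    then have "partner a k = partner a l" using kl(3) by (simp add: point_param_def e_eq_iff)
    then show ?thesis by (metis partner_div)
  next
    assume "k < q \<and> k \<noteq> a div 2" "\<not> (l < q \<and> l \<noteq> a div 2)"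
    then have False using kl good_neq[OF \<epsilon>, of "2 * q + l" "partner a k"] less[of k] by (auto simp: point_param_def)
    then show ?thesis ..
  next
    assume "\<not> (k < q \<and> k \<noteq> a div 2)" "l < q \<and> l \<noteq> a div 2"
    then have False using kl good_neq[OF \<epsilon>, of "2 * q + k" "partner a l"] less[of l] by (auto simp: point_param_def)
    then show ?thesis ..
  next
    assume "\<not> (k < q \<and> k \<noteq> a div 2)" "\<not> (l < q \<and> l \<noteq> a div 2)"
    then have "point_param \<epsilon> a k = e (2 * q + k)" "point_param \<epsilon> a l = e (2 * q + l)"
      unfolding point_param_def by - (rule if_not_P, assumption)+
    then have "e (2 * q + k) = e (2 * q + l)" using kl(3) by (simp only:)
    then show ?thesis unfolding e_eq_iff by simp
  qed
qed

lemma point_param_not_line: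
  assumes "\<epsilon> \<notin> bad" "k < 2 * q" "b < 2 * q"
  shows "point_param \<epsilon> a k \<noteq> e b"
proof (cases "k < q \<and> k \<noteq> a div 2")
  case True
  then show ?thesis using good_neq[OF assms(1), of b "partner a k"] partner_less[of k q a] assms(3)
    by (simp add: point_param_def)
next
  case False
  then show ?thesis using assms(3) by (auto simp: point_param_def e_eq_iff)
qed

text \<open>The value at \<open>e b\<close> of the monic polynomial whose roots are the points of
  line a. For \<epsilon> = 0 it is zero when a point of a has moved to the intersection with
  b.\<close>

definition gap :: "'k \<Rightarrow> nat \<Rightarrow> nat \<Rightarrow> 'k" where
  "gap \<epsilon> a b = (\<Prod>k<2 * q. e b - point_param \<epsilon> a k)"

lemma gap_0_eq_0: 
  assumes "b < 2 * q" "v < q" "v \<noteq> b div 2" shows "gap 0 (copartner b v) b = 0"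
proof -
  have "b div 2 < q" using assms(1) by simp
  then have "point_param 0 (copartner b v) (b div 2) = e b" 
    using assms by (simp add: point_param_def partner_copartner)
  moreover have "b div 2 < 2 * q" using assms(1) by simp
  ultimately show ?thesis unfolding gap_def by (metis cancel_comm_monoid_add_class.diff_cancel finite_lessThan lessThan_iff prod_zero_iff)
qed

lemma gap_0_neq_0:
  assumes "a < 2 * q" "\<And>k. k < q \<Longrightarrow> k \<noteq> b div 2 \<Longrightarrow> partner b k \<noteq> a" 
  shows "gap 0 b a \<noteq> 0"
  unfolding gap_def using assms by (auto simp: point_param_def e_eq_iff)

text \<open>\<open>G a c\<close> stands for the restriction to line a of the c-th entry of a syzygy,
  divided by the j-th power of the polynomial of the points on a. Besides degree at most q - 1 and
  the syzygy equation, the restrictions must agree at the nodes, with the divisors multiplied back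
  in. This is a linear system in G that still makes sense at \<epsilon> = 0.\<close>

definition glued :: "nat \<Rightarrow> 'k \<Rightarrow> (nat \<Rightarrow> 3 \<Rightarrow> 'k poly) \<Rightarrow> bool" where
  "glued j \<epsilon> G \<longleftrightarrow>
    (\<forall>a<2 * q. \<forall>c. \<forall>l\<ge>q. coeff (G a c) l = 0) \<and>
    (\<forall>a<2 * q. [:0, e a:] * G a 0 + [:- e a, - 1:] * G a 1 + G a 2 = 0) \<and>
    (\<forall>a<2 * q. \<forall>b<2 * q. \<forall>c. a \<noteq> b \<longrightarrow> 
       gap \<epsilon> a b ^ j * poly (G a c) (e b) = gap \<epsilon> b a ^ j * poly (G b c) (e a))"

text \<open>At a node with the copartner in another pair, one gap is zero and the other is not, so
  \<open>G b c\<close> has q - 1 prescribed roots and is a scalar multiple of their product. The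
  syzygy equation makes the three scalars proportional to (1, e, e^2) with e the parameter of the
  line. Gluing with the other line of the pair makes two such triples with different e proportional,
  so they are zero.\<close>

lemma glued_0_trivial:
  assumes j: "1 \<le> j" and G: "glued j 0 G" and b: "b < 2 * q"
  shows "G b c = 0"
proof -
  define P where "P b = (\<Prod>v\<in>{..<q} - {b div 2}. [:- e (copartner b v), 1:])" for b
  have deg_P: "degree (P b) = q - 1" if "b < 2 * q" for b
    unfolding P_def using that by (subst degree_prod_eq_sum_degree) auto
  have root: "poly (G b c) (e (copartner b v)) = 0" if b: "b < 2 * q" and v: "v < q" "v \<noteq> b div 2" for b c v
  proof -
    let ?a = "copartner b v"
    have a: "?a < 2 * q" by (rule copartner_less[OF v(1)])
    have "?a \<noteq> b" using v(2) by (metis copartner_div)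
    then have "gap 0 ?a b ^ j * poly (G ?a c) (e b) = gap 0 b ?a ^ j * poly (G b c) (e ?a)"
      using G a b unfolding glued_def by blast
    moreover have "gap 0 b ?a \<noteq> 0"
    proof (rule gap_0_neq_0[OF a])
      fix k assume "k < q" "k \<noteq> b div 2"
      show "partner b k \<noteq> ?a"
        using partner_neq_copartner[OF \<open>k \<noteq> b div 2\<close>] by (metis partner_div copartner_div)
    qed
    ultimately show ?thesis using gap_0_eq_0[OF b v] j by (auto simp: power_0_left)
  qed
  have G_eq: "G b c = Polynomial.smult (coeff (G b c) (q - 1)) (P b)" if b: "b < 2 * q" for b c
  proof (rule ccontr)
    define H where "H = G b c - Polynomial.smult (coeff (G b c) (q - 1)) (P b)"
    assume "G b c \<noteq> Polynomial.smult (coeff (G b c) (q - 1)) (P b)"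
    then have H: "H \<noteq> 0" by (simp add: H_def)
    have lead: "coeff (P b) (q - 1) = 1"
      using lead_coeff_prod[of "\<lambda>v. [:- e (copartner b v), 1:]" "{..<q} - {b div 2}"] deg_P[OF b] by (simp add: P_def)
    have "coeff H l = 0" if "l \<ge> q - 1" for l
    proof (cases "l = q - 1")
      case True
      then show ?thesis using lead by (simp add: H_def)
    next
      case False
      then have "l \<ge> q" using that by simp
      moreover have "coeff (P b) l = 0" using deg_P[OF b] False that by (intro coeff_eq_0) simp
      ultimately show ?thesis using G b by (simp add: H_def glued_def)
    qed
    \<comment> \<open>For q = 1 there is no smaller degree, but then all coefficients of
      \<open>H\<close> are zero.\<close>
    then have deg: "degree H < q - 1 \<or> q - 1 = 0" using H 
      by (metis leading_coeff_neq_0 not_less)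
    have roots: "e ` copartner b ` ({..<q} - {b div 2}) \<subseteq> {x. poly H x = 0}"
      using root[OF b] by (auto simp: H_def P_def poly_prod)
    have "card (e ` copartner b ` ({..<q} - {b div 2})) = q - 1"
    proof -
      have "inj_on (copartner b) A" for A by (metis copartner_div inj_onI)
      then have "card (copartner b ` ({..<q} - {b div 2})) = q - 1" using b by (subst card_image) auto
      moreover have "inj_on e A" for A using inj_e by (rule inj_on_subset) simp
      ultimately show ?thesis by (subst card_image) auto
    qed
    then have "q - 1 \<le> card {x. poly H x = 0}"
      using card_mono[OF poly_roots_finite[OF H] roots] by simp
    also have "\<dots> \<le> degree H" by (rule card_poly_roots_bound[OF H])
    finally have "q - 1 = 0" using deg by simp
    then show False using \<open>\<And>l. l \<ge> q - 1 \<Longrightarrow> coeff H l = 0\<close> H by (metis le0 leading_coeff_0_iff)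
  qed
  define g where "g b c = coeff (G b c) (q - 1)" for b c
  \<comment> \<open>Comparing coefficients of t and 1 after cancelling the common factor
    \<open>P b\<close>.\<close>
  have g: "g b 1 = e b * g b 0" "g b 2 = e b * g b 1" if b: "b < 2 * q" for b
  proof -
    have "[:0, e b:] * G b 0 + [:- e b, - 1:] * G b 1 + G b 2 = 0" using G b by (simp add: glued_def)
    also have "[:0, e b:] * G b 0 + [:- e b, - 1:] * G b 1 + G b 2 = 
        ([:0, e b:] * [:g b 0:] + [:- e b, - 1:] * [:g b 1:] + [:g b 2:]) * P b"
    proof -
      have G': "G b c = [:g b c:] * P b" for c using G_eq[OF b, of c] by (simp add: g_def)
      show ?thesis by (simp only: G' distrib_right mult.assoc)
    qed
    finally have "([:0, e b:] * [:g b 0:] + [:- e b, - 1:] * [:g b 1:] + [:g b 2:]) * P b = 0" .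
    moreover have "P b \<noteq> 0" by (simp add: P_def)
    ultimately have "[:0, e b:] * [:g b 0:] + [:- e b, - 1:] * [:g b 1:] + [:g b 2:] = 0"
      unfolding mult_eq_0_iff by blast
    then show "g b 1 = e b * g b 0" "g b 2 = e b * g b 1" by (auto simp: mult.commute)
  qed
  \<comment> \<open>The other line of the pair of b. No point of either line moves to their common
    node, so both gaps there are nonzero.\<close>
  define b' where "b' = 2 * (b div 2) + (1 - b mod 2)"
  have b': "b' < 2 * q" "b' div 2 = b div 2" "b' \<noteq> b"
    using b parity_cases[of b] by (auto simp: b'_def, presburger)
  have gap0: "gap 0 b b' \<noteq> 0" "gap 0 b' b \<noteq> 0"
    by (rule gap_0_neq_0; use b b' partner_div in metis)+
  have P0: "poly (P b) (e b') \<noteq> 0" "poly (P b') (e b) \<noteq> 0"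
  proof -
    have "copartner b v \<noteq> b'" if "v \<noteq> b div 2" for v using that b'(2) by (metis copartner_div)
    then show "poly (P b) (e b') \<noteq> 0" by (auto simp: P_def poly_prod e_eq_iff)
    have "copartner b' v \<noteq> b" if "v \<noteq> b div 2" for v using that by (metis copartner_div)
    then show "poly (P b') (e b) \<noteq> 0" by (auto simp: P_def poly_prod e_eq_iff b'(2))
  qed
  define x x' where "x = gap 0 b b' ^ j * poly (P b) (e b')" and "x' = gap 0 b' b ^ j * poly (P b') (e b)"
  have x: "x \<noteq> 0" using gap0 P0 by (simp add: x_def)
  have xg: "x * g b c = x' * g b' c" for c
  proof -
    have "gap 0 b b' ^ j * poly (G b c) (e b') = gap 0 b' b ^ j * poly (G b' c) (e b)"
      using G b b' unfolding glued_def by metis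
    then show ?thesis using arg_cong[OF G_eq[OF b, of c], of "\<lambda>p. poly p (e b')"] arg_cong[OF G_eq[OF b'(1), of c], of "\<lambda>p. poly p (e b)"]
      by (simp add: x_def x'_def g_def mult_ac)
  qed
  have "x * g b 0 * e b = x * g b 1" by (simp only: g(1)[OF b] mult_ac)
  also have "\<dots> = x' * g b' 0 * e b'" unfolding xg g(1)[OF b'(1)] by (simp only: mult_ac)
  also have "\<dots> = x * g b 0 * e b'" by (simp only: xg)
  finally have "x * g b 0 * (e b - e b') = 0" by (simp only: right_diff_distrib diff_self)
  then have "g b 0 = 0" using x b'(3) by (simp add: e_eq_iff)
  then have "\<forall>c. g b c = 0" using g[OF b] unfolding forall_3 by simp
  then show ?thesis using G_eq[OF b, of c] by (simp add: g_def)
qed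

end

context configuration
begin

interpretation univariate: graded_functions "\<lambda>(d :: nat \<Rightarrow> nat) (f :: 'k \<Rightarrow> 'k). \<exists>p. \<forall>x. f x = poly p x"
proof
  show "\<exists>p. \<forall>x. (1 :: 'k) = poly p x" by (rule exI[of _ 1]) simp
  fix f g :: "'k \<Rightarrow> 'k"
  assume "\<exists>p. \<forall>x. f x = poly p x" "\<exists>p. \<forall>x. g x = poly p x"
  then obtain p p' where "\<And>x. f x = poly p x" "\<And>x. g x = poly p' x" by blast
  then show "\<exists>p. \<forall>x. f x * g x = poly p x" "\<exists>p. \<forall>x. f x - g x = poly p x"
    by (auto intro: exI[of _ "p * p'"] exI[of _ "p - p'"])
qed

lemma gap_polynomial: "\<exists>p. \<forall>\<epsilon>. gap \<epsilon> a b = poly p \<epsilon>"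
  by (rule exI[of _ "\<Prod>k<2 * q. if k < q \<and> k \<noteq> a div 2 then [:e b - e (partner a k), - 1:] else [:e b - e (2 * q + k):]"])
    (auto simp: gap_def poly_prod point_param_def intro!: prod.cong)

text \<open>The unknowns are the q coefficients of each \<open>G a c\<close>, and the entries of the
  system are polynomials in \<epsilon>. Trivial kernel at 0 thus persists wherever one nonzero
  polynomial does not vanish.\<close>

lemma glued_generic_trivial:
  assumes j: "1 \<le> j"
  shows "\<exists>B. finite B \<and> (\<forall>\<epsilon>. \<epsilon> \<notin> B \<longrightarrow> (\<forall>G. glued j \<epsilon> G \<longrightarrow> (\<forall>a<2 * q. \<forall>c. G a c = 0)))"
proof -
  define J where "J = {..<2 * q} \<times> (UNIV :: 3 set) \<times> {..<q}"
  define R :: "(nat \<times> nat + nat \<times> nat \<times> 3) set" where 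
    "R = Inl ` {(a, t). a < 2 * q} \<union> Inr ` {(a, b, c). a < 2 * q \<and> b < 2 * q \<and> a \<noteq> b}"
  \<comment> \<open>The restrictions of x, y and z to line a.\<close>
  define lin where "lin a c = (if c = 0 then [:0, e a:] else if c = 1 then [:- e a, - 1:] else 1)" for a and c :: 3
  define A where "A r x \<epsilon> = (case x of (a', c', l) \<Rightarrow> (case r of 
      Inl (a, t) \<Rightarrow> if a' = a then coeff (lin a c' * monom 1 l) t else 0
    | Inr (a, b, c) \<Rightarrow> (if a' = a then if c' = c then gap \<epsilon> a b ^ j * e b ^ l else 0 else 0) - 
       (if a' = b then if c' = c then gap \<epsilon> b a ^ j * e a ^ l else 0 else 0)))" 
    for r :: "nat \<times> nat + nat \<times> nat \<times> 3" and x :: "nat \<times> 3 \<times> nat" and \<epsilon>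
  define polys where "polys x a c = (\<Sum>l<q. monom (x (a, c, l)) l)" for x :: "nat \<times> 3 \<times> nat \<Rightarrow> 'k" and a c
  have coeff_polys: "coeff (polys x a c) l = (if l < q then x (a, c, l) else 0)" for x a c l
    by (simp add: polys_def coeff_sum)
  have poly_polys: "poly (polys x a c) y = (\<Sum>l<q. y ^ l * x (a, c, l))" for x a c y
    by (simp add: polys_def poly_sum poly_monom mult.commute)
  have J_sum: "(\<Sum>(a', c', l)\<in>J. (if a' = a then f c' l else 0) * x (a', c', l)) = (\<Sum>c\<in>UNIV. \<Sum>l<q. f c l * x (a, c, l))" 
    if "a < 2 * q" for a f and x :: "nat \<times> 3 \<times> nat \<Rightarrow> 'k"
  proof -
    have "(\<Sum>(a', c', l)\<in>J. (if a' = a then f c' l else 0) * x (a', c', l)) = 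
        (\<Sum>a'<2 * q. \<Sum>c\<in>UNIV. \<Sum>l<q. (if a' = a then f c l else 0) * x (a', c, l))"
      unfolding J_def by (simp add: sum.cartesian_product case_prod_unfold)
    also have "\<dots> = (\<Sum>a'<2 * q. if a' = a then \<Sum>c\<in>UNIV. \<Sum>l<q. f c l * x (a, c, l) else 0)"
      by (rule sum.cong) auto
    finally show ?thesis using that by simp
  qed
  have sum_lin: "(\<Sum>y\<in>J. A (Inl (a, t)) y \<epsilon> * x y) = coeff (\<Sum>c\<in>UNIV. lin a c * polys x a c) t" if a: "a < 2 * q" for a t \<epsilon> x
  proof -
    have "(\<Sum>y\<in>J. A (Inl (a, t)) y \<epsilon> * x y) = 
        (\<Sum>(a', c', l)\<in>J. (if a' = a then coeff (lin a c' * monom 1 l) t else 0) * x (a', c', l))"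
      by (rule sum.cong) (auto simp: A_def)
    also have "\<dots> = (\<Sum>c\<in>UNIV. \<Sum>l<q. coeff (lin a c * monom 1 l) t * x (a, c, l))" by (rule J_sum[OF a])
    also have "\<dots> = coeff (\<Sum>c\<in>UNIV. lin a c * polys x a c) t"
    proof -
      have "lin a c * polys x a c = (\<Sum>l<q. [:x (a, c, l):] * (lin a c * monom 1 l))" for c
        unfolding polys_def sum_distrib_left by (rule sum.cong) (simp_all add: smult_monom flip: mult_smult_right)
      then show ?thesis by (simp add: coeff_sum mult.commute)
    qed
    finally show ?thesis .
  qed
  have sum_node: "(\<Sum>y\<in>J. A (Inr (a, b, c)) y \<epsilon> * x y) = 
      gap \<epsilon> a b ^ j * poly (polys x a c) (e b) - gap \<epsilon> b a ^ j * poly (polys x b c) (e a)" 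
    if a: "a < 2 * q" and b: "b < 2 * q" for a b c \<epsilon> x
  proof -
    have one: "(\<Sum>c'\<in>UNIV. \<Sum>l<q. (if c' = c then g * y ^ l else 0) * x (a, c', l)) = g * poly (polys x a c) y" for a g y
    proof -
      have "(\<Sum>c'\<in>UNIV. \<Sum>l<q. (if c' = c then g * y ^ l else 0) * x (a, c', l)) = 
        (\<Sum>c'\<in>UNIV. if c' = c then \<Sum>l<q. g * y ^ l * x (a, c, l) else 0)"
        by (rule sum.cong) auto
      then show ?thesis by (simp add: poly_polys sum_distrib_left mult.assoc)
    qed
    have "(\<Sum>y\<in>J. A (Inr (a, b, c)) y \<epsilon> * x y) = 
        (\<Sum>(a', c', l)\<in>J. (if a' = a then if c' = c then gap \<epsilon> a b ^ j * e b ^ l else 0 else 0) * x (a', c', l)) -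
        (\<Sum>(a', c', l)\<in>J. (if a' = b then if c' = c then gap \<epsilon> b a ^ j * e a ^ l else 0 else 0) * x (a', c', l))"
      unfolding sum_subtractf[symmetric] by (rule sum.cong) (auto simp: A_def left_diff_distrib)
    then show ?thesis 
      unfolding J_sum[OF a, of "\<lambda>c' l. if c' = c then gap \<epsilon> a b ^ j * e b ^ l else 0" x] 
        J_sum[OF b, of "\<lambda>c' l. if c' = c then gap \<epsilon> b a ^ j * e a ^ l else 0" x] one .
  qed
  have lin_sum: "(\<Sum>c\<in>UNIV. lin a c * H c) = [:0, e a:] * H 0 + [:- e a, - 1:] * H 1 + H 2" for a H
    unfolding sum_UNIV_3 lin_def by simp
  have iff: "(\<forall>r\<in>R. (\<Sum>y\<in>J. A r y \<epsilon> * x y) = 0) \<longleftrightarrow> glued j \<epsilon> (polys x)" for \<epsilon> x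
  proof -
    have "(\<forall>r\<in>R. (\<Sum>y\<in>J. A r y \<epsilon> * x y) = 0) \<longleftrightarrow> 
        (\<forall>a<2 * q. \<forall>t. coeff (\<Sum>c\<in>UNIV. lin a c * polys x a c) t = 0) \<and>
        (\<forall>a b c. a < 2 * q \<and> b < 2 * q \<and> a \<noteq> b \<longrightarrow> 
          gap \<epsilon> a b ^ j * poly (polys x a c) (e b) - gap \<epsilon> b a ^ j * poly (polys x b c) (e a) = 0)"
      unfolding R_def ball_Un by (auto simp: sum_lin sum_node)
    also have "\<dots> \<longleftrightarrow> glued j \<epsilon> (polys x)"
      unfolding glued_def lin_sum[symmetric] poly_eq_iff coeff_0 by (auto simp: coeff_polys)
    finally show ?thesis .
  qed
  have entries: "\<exists>p. \<forall>\<epsilon>. A r y \<epsilon> = poly p \<epsilon>" for r y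
  proof -
    obtain p1 where p1: "\<And>a b \<epsilon>. gap \<epsilon> a b = poly (p1 a b) \<epsilon>" using gap_polynomial by metis
    obtain a' c' l where y: "y = (a', c', l)" by (cases y)
    show ?thesis
    proof (cases r)
      case (Inl r')
      obtain a t where "r' = (a, t)" by force
      then show ?thesis using Inl y by (intro exI[of _ "[:A r y 0:]"]) (simp add: A_def)
    next
      case (Inr r')
      obtain a b c where "r' = (a, b, c)" by (cases r')
      then show ?thesis using Inr y 
        by (intro exI[of _ "(if a' = a then if c' = c then p1 a b ^ j * [:e b ^ l:] else 0 else 0) - 
           (if a' = b then if c' = c then p1 b a ^ j * [:e a ^ l:] else 0 else 0)"]) 
          (simp add: A_def p1 poly_power)
    qed
  qed
  have triv: "\<forall>y\<in>J. x y = 0" if "\<forall>r\<in>R. (\<Sum>y\<in>J. A r y 0 * x y) = 0" for x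
  proof -
    have "polys x a c = 0" if "a < 2 * q" for a c
      using glued_0_trivial[OF j _ that] \<open>\<forall>r\<in>R. (\<Sum>y\<in>J. A r y 0 * x y) = 0\<close> iff by blast
    then have "coeff (polys x a c) l = 0" if "a < 2 * q" for a c l using that by simp
    then have "x (a, c, l) = 0" if "a < 2 * q" "l < q" for a c l using that coeff_polys[of x a c l] by simp
    then show ?thesis unfolding J_def by auto
  qed
  have "finite J" by (simp add: J_def)
  from univariate.generic_injective[of J R A 0, OF this entries triv] obtain f where
    f: "\<exists>p. \<forall>x. f x = poly p x" "f 0 \<noteq> 0" 
      "\<And>\<epsilon> x. f \<epsilon> \<noteq> 0 \<Longrightarrow> \<forall>r\<in>R. (\<Sum>y\<in>J. A r y \<epsilon> * x y) = 0 \<Longrightarrow> \<forall>y\<in>J. x y = 0" by blast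
  obtain p where p: "\<And>x. f x = poly p x" using f(1) by blast
  have "p \<noteq> 0" using f(2) p by auto
  have "G a c = 0" if "f \<epsilon> \<noteq> 0" "glued j \<epsilon> G" "a < 2 * q" for \<epsilon> G a c
  proof -
    define x where "x = (\<lambda>(a, c, l). coeff (G a c) l)"
    have G_eq: "G a c = polys x a c" if "a < 2 * q" for a c
      by (rule poly_eqI) (use \<open>glued j \<epsilon> G\<close> that in \<open>auto simp: coeff_polys x_def glued_def not_less\<close>)
    have "glued j \<epsilon> (polys x)"
      using \<open>glued j \<epsilon> G\<close> unfolding glued_def by (simp add: G_eq)
    then have "\<forall>y\<in>J. x y = 0" using f(3)[OF \<open>f \<epsilon> \<noteq> 0\<close>] iff by blast
    then have "polys x a c = 0" unfolding polys_def using \<open>a < 2 * q\<close> by (auto simp: J_def)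
    then show ?thesis using G_eq \<open>a < 2 * q\<close> by simp
  qed
  then show ?thesis
    by (intro exI[of _ "{x. poly p x = 0}"]) (use poly_roots_finite[OF \<open>p \<noteq> 0\<close>] in \<open>auto simp: p\<close>)
qed

section \<open>Syzygies at the special configuration\<close>

definition config_point :: "'k \<Rightarrow> nat \<Rightarrow> 3 \<Rightarrow> 'k" where
  "config_point \<epsilon> i = node (e (i div (2 * q))) (point_param \<epsilon> (i div (2 * q)) (i mod (2 * q)))"

definition curve :: "'k ternary" where
  "curve = (\<Prod>a<2 * q. line_form (e a))"

lemma line_form_neq_0: "line_form c \<noteq> (0 :: 'k ternary)"
proof
  assume "line_form c = (0 :: 'k ternary)"
  then have "x_coeff (line_form c) = (0 :: 'k)" by simp
  then show False by (simp add: line_form_def)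
qed

lemma curve_neq_0: "curve \<noteq> 0"
  by (simp add: curve_def line_form_neq_0)

text \<open>For good \<epsilon> each point lies on exactly one of the lines, so all other factors of
  the curve are nonzero there and the remaining one cancels a single order.\<close>

lemma vanishes_cancel_curve:
  assumes \<epsilon>: "\<epsilon> \<notin> bad" and i: "i < 2 * q * (2 * q)" and F: "homogeneous d F" 
    and van: "vanishes (Suc j) (config_point \<epsilon> i) (curve * F)"
  shows "vanishes j (config_point \<epsilon> i) F"
proof -
  define a k where "a = i div (2 * q)" and "k = i mod (2 * q)"
  have a: "a < 2 * q" using i by (simp add: a_def less_mult_imp_div_less)
  have k: "k < 2 * q" using q by (simp add: k_def)
  have v: "config_point \<epsilon> i = node (e a) (point_param \<epsilon> a k)" by (simp add: config_point_def a_def k_def)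
  define u where "u = (\<Prod>b\<in>{..<2 * q} - {a}. line_form (e b))"
  have "curve = line_form (e a) * u"
    unfolding curve_def u_def using a by (intro prod.remove) auto
  then have "vanishes (Suc j) (config_point \<epsilon> i) (u * (line_form (e a) * F))"
    using van by (simp add: mult.assoc mult.left_commute)
  moreover have "eval_mpoly (config_point \<epsilon> i) u \<noteq> 0"
  proof -
    have "eval_mpoly (config_point \<epsilon> i) u = (\<Prod>b\<in>{..<2 * q} - {a}. eval_mpoly (config_point \<epsilon> i) (line_form (e b)))"
      unfolding u_def eval_mpoly_eq_subst by (rule subst_prod) simp
    moreover have "e b \<noteq> point_param \<epsilon> a k" if "b < 2 * q" for b
      using point_param_not_line[OF \<epsilon> k that] by metis
    ultimately show ?thesis by (auto simp: v eval_line_form e_eq_iff)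
  qed
  ultimately have "vanishes (Suc j) (config_point \<epsilon> i) (line_form (e a) * F)"
    by (rule vanishes_cancel_nonzero[rotated])
  then show ?thesis by (rule vanishes_cancel_line_form[OF F, rotated]) (simp add: v eval_line_form)
qed

text \<open>Dividing the entries by the curve lowers the degree by 2 q and the order at every point
  by one, so the hypotheses recur with j - 1. At j = 0 the degree q - 1 is left.\<close>

lemma syzygy_factor:
  assumes \<epsilon>: "\<epsilon> \<notin> bad" and triv: "\<And>j G a c. 1 \<le> j \<Longrightarrow> j \<le> m \<Longrightarrow> glued j \<epsilon> G \<Longrightarrow> a < 2 * q \<Longrightarrow> G a c = 0"
  shows "j \<le> m \<Longrightarrow> \<forall>c. homogeneous (q * (2 * j + 1) - 1) (F c) \<Longrightarrow> 
    \<forall>c. \<forall>i<2 * q * (2 * q). vanishes j (config_point \<epsilon> i) (F c) \<Longrightarrow>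
    Var 0 * F 0 + Var 1 * F 1 + Var 2 * F 2 = 0 \<Longrightarrow> 
    \<exists>F'. \<forall>c. homogeneous (q - 1) (F' c) \<and> F c = curve ^ j * F' (c :: 3)"
proof (induction j arbitrary: F)
  case 0
  then show ?case by (intro exI[of _ F]) simp
next
  case (Suc j F)
  define d where "d = q * (2 * Suc j + 1) - 1"
  have F_hom: "homogeneous d (F c)" for c using Suc.prems(2) by (simp add: d_def)
  define B where "B a = (\<Prod>k<2 * q. [:- point_param \<epsilon> a k, 1:])" for a
  have B_neq: "B a \<noteq> 0" and deg_B: "degree (B a) = 2 * q" for a
    unfolding B_def by (auto simp: degree_prod_eq_sum_degree)
  have poly_B: "poly (B a) (e b) = gap \<epsilon> a b" for a b by (simp add: B_def gap_def poly_prod)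
  have "B a ^ Suc j dvd restrict_line (e a) (F c)" if a: "a < 2 * q" for a c
    unfolding B_def
  proof (rule linear_powers_dvd[OF _ point_param_inj[OF \<epsilon>]])
    fix k assume k: "k \<in> {..<2 * q}"
    have "a * (2 * q) + k < 2 * q * (2 * q)"
    proof -
      have "a * (2 * q) + k < a * (2 * q) + 2 * q" using k by simp
      also have "\<dots> = (a + 1) * (2 * q)" by simp
      also have "\<dots> \<le> 2 * q * (2 * q)" using a by (intro mult_right_mono) auto
      finally show ?thesis .
    qed
    moreover have "config_point \<epsilon> (a * (2 * q) + k) = node (e a) (point_param \<epsilon> a k)"
      using k q by (simp add: config_point_def)
    ultimately have "vanishes (Suc j) (node (e a) (point_param \<epsilon> a k)) (F c)" using Suc.prems(3) by metis
    then show "[:- point_param \<epsilon> a k, 1:] ^ Suc j dvd restrict_line (e a) (F c)" by (rule restrict_line_dvd)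
  qed simp
  then have "\<forall>a c. \<exists>g. a < 2 * q \<longrightarrow> restrict_line (e a) (F c) = B a ^ Suc j * g" by (meson dvd_def)
  then obtain G where G: "\<And>a c. a < 2 * q \<Longrightarrow> restrict_line (e a) (F c) = B a ^ Suc j * G a c" by metis
  \<comment> \<open>The degree bound is d - 2 q (j + 1) = q - 1. The node condition compares the two
    restrictions of the same form at the common point of two lines.\<close>
  have "glued (Suc j) \<epsilon> G"
    unfolding glued_def
  proof (intro conjI allI impI)
    fix a c l assume a: "a < 2 * q" and l: "q \<le> l"
    show "coeff (G a c) l = 0"
    proof (cases "G a c = 0")
      case False
      have "degree (restrict_line (e a) (F c)) \<le> d" unfolding restrict_line_def by (rule degree_line_val[OF F_hom])
      then have "Suc j * (2 * q) + degree (G a c) \<le> d"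
        unfolding G[OF a] using False B_neq by (simp add: degree_mult_eq degree_power_eq deg_B)
      then have "degree (G a c) < l" using l q by (simp add: d_def algebra_simps)
      then show ?thesis by (rule coeff_eq_0)
    qed simp
  next
    fix a assume a: "a < 2 * q"
    have "restrict_line (e a) (Var 0 * F 0 + Var 1 * F 1 + Var 2 * F 2) = 
        B a ^ Suc j * ([:0, e a:] * G a 0 + [:- e a, - 1:] * G a 1 + G a 2)"
      unfolding restrict_line_simps G[OF a] by (simp only: distrib_left mult.left_commute one_pCons[symmetric] mult_1)
    then have "B a ^ Suc j * ([:0, e a:] * G a 0 + [:- e a, - 1:] * G a 1 + G a 2) = 0"
      unfolding Suc.prems(4) restrict_line_simps by (rule sym)
    moreover have "B a ^ Suc j \<noteq> 0" using B_neq by simp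
    ultimately show "[:0, e a:] * G a 0 + [:- e a, - 1:] * G a 1 + G a 2 = 0" unfolding mult_eq_0_iff by blast
  next
    fix a b c assume "a < 2 * q" "b < 2 * q"
    then have "poly (B a ^ Suc j * G a c) (e b) = poly (B b ^ Suc j * G b c) (e a)"
      unfolding G[symmetric, OF \<open>a < 2 * q\<close>] G[symmetric, OF \<open>b < 2 * q\<close>] poly_restrict_line
      by (simp only: node_commute)
    then show "gap \<epsilon> a b ^ Suc j * poly (G a c) (e b) = gap \<epsilon> b a ^ Suc j * poly (G b c) (e a)"
      by (simp only: poly_mult poly_power poly_B)
  qed
  then have "G a c = 0" if "a < 2 * q" for a c
    using triv[of "Suc j" G a c] Suc.prems(1) that by simp
  then have zero: "restrict_line (e a) (F c) = 0" if "a < 2 * q" for a c using G[OF that, of c] that by simp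
  have "\<exists>H. F c = curve * H \<and> homogeneous (q * (2 * j + 1) - 1) H" for c
  proof -
    have "inj_on e {..<2 * q}" using inj_e by (rule inj_on_subset) simp
    from line_forms_dvd[OF F_hom this zero] obtain H where H: "F c = curve * H" "shifted_homogeneous (2 * q) d H"
      by (auto simp: curve_def)
    have "2 * q \<le> d" "d - 2 * q = q * (2 * j + 1) - 1" using q by (auto simp: d_def algebra_simps)
    then show ?thesis using H by (auto simp: shifted_homogeneous_iff)
  qed
  then obtain H where H: "\<And>c. F c = curve * H c" "\<And>c. homogeneous (q * (2 * j + 1) - 1) (H c)" by metis
  have "\<exists>F'. \<forall>c. homogeneous (q - 1) (F' c) \<and> H c = curve ^ j * F' c"
  proof (rule Suc.IH)
    show "j \<le> m" using Suc.prems(1) by simp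
    show "\<forall>c. homogeneous (q * (2 * j + 1) - 1) (H c)" using H(2) by blast
    show "\<forall>c. \<forall>i<2 * q * (2 * q). vanishes j (config_point \<epsilon> i) (H c)"
      using vanishes_cancel_curve[OF \<epsilon> _ H(2)] Suc.prems(3) H(1) by metis
    have "curve * (Var 0 * H 0 + Var 1 * H 1 + Var 2 * H 2) = Var 0 * F 0 + Var 1 * F 1 + Var 2 * F 2"
      unfolding H(1) by (simp only: distrib_left mult.left_commute)
    then show "Var 0 * H 0 + Var 1 * H 1 + Var 2 * H 2 = 0" using Suc.prems(4) curve_neq_0 by simp
  qed
  then obtain F' where "\<forall>c. homogeneous (q - 1) (F' c) \<and> H c = curve ^ j * F' c" by blast
  then show ?case using H(1) by (intro exI[of _ F']) (simp add: mult.assoc)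
qed

end

subsection \<open>Surjectivity from few syzygies\<close>

context saturated_ideal
begin

text \<open>Rank and nullity: if the functionals in \<Phi> detect every syzygy, the kernel of \<mu>
  has dimension at most \<open>card \<Phi>\<close>, so the image is large enough to be all of
  I_(\<alpha>+1).\<close>

lemma surjective_if_few_syzygies:
  fixes \<Phi> :: "(3 \<Rightarrow> (3 \<Rightarrow>\<^sub>0 nat) \<Rightarrow> 'k) set"
  assumes fin: "finite \<Phi>" and card: "card \<Phi> + hilbert I (Suc \<alpha>) \<le> 3 * hilbert I \<alpha>"
    and triv: "\<And>F. (\<And>c. F c \<in> graded_part I \<alpha>) \<Longrightarrow> Var 0 * F 0 + Var 1 * F 1 + Var 2 * F 2 = 0 \<Longrightarrow>
      (\<And>\<phi>. \<phi> \<in> \<Phi> \<Longrightarrow> (\<Sum>c\<in>UNIV. \<Sum>e\<in>{e. exp_degree e = \<alpha>}. \<phi> c e * Poly_Mapping.lookup (F c) e) = 0) \<Longrightarrow> F = (\<lambda>_. 0)"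
    and G: "G \<in> graded_part I (Suc \<alpha>)"
  shows "\<exists>A\<in>graded_part I \<alpha>. \<exists>B\<in>graded_part I \<alpha>. \<exists>C\<in>graded_part I \<alpha>. G = Var 0 * A + Var 1 * B + Var 2 * C"
proof -
  define h where "h = hilbert I \<alpha>"
  obtain f where f: "basis_of h f (graded_part I \<alpha>)" using basis_exists h_def by blast
  have fI: "f i \<in> graded_part I \<alpha>" if "i < h" for i using f that by (simp add: basis_of_def)
  define W where "W = mpoly_space.span ((\<lambda>(c, i). Var c * f i) ` (UNIV \<times> {..<h}))"
  have W: "mpoly_space.subspace W" by (simp add: W_def)
  have W_sub: "W \<subseteq> graded_part I (Suc \<alpha>)"
    unfolding W_def by (rule mpoly_space.span_minimal[OF _ subspace_graded_part]) (auto intro: Var_mult_mem fI)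
  then have W_hom: "W \<subseteq> {F. homogeneous (Suc \<alpha>) F}" using graded_part_subset by blast
  define D where "D = mpoly_space.dim W"
  obtain b where b: "basis_of D b W" using basis_of_exists[OF W W_hom] D_def by blast
  have "D \<ge> hilbert I (Suc \<alpha>)"
  proof (rule ccontr)
    assume "\<not> D \<ge> hilbert I (Suc \<alpha>)"
    \<comment> \<open>If the image W were too small, being a syzygy and being killed by \<Phi> would
      be D + \<open>card \<Phi>\<close> equations in 3 h unknowns, and a nonzero solution would
      exist.\<close>
    have "\<forall>ci. \<exists>M. ci \<in> UNIV \<times> {..<h} \<longrightarrow> Var (fst ci) * f (snd ci) = (\<Sum>j<D. const (M j) * b j)"
    proof
      fix ci
      show "\<exists>M. ci \<in> UNIV \<times> {..<h} \<longrightarrow> Var (fst ci) * f (snd ci) = (\<Sum>j<D. const (M j) * b j)"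
      proof (cases "ci \<in> UNIV \<times> {..<h}")
        case True
        then have "Var (fst ci) * f (snd ci) \<in> W" unfolding W_def by (intro mpoly_space.span_base) force
        then show ?thesis using b by (auto simp: basis_of_def)
      qed blast
    qed
    from choice[OF this] obtain M where 
      M: "\<And>c i. i < h \<Longrightarrow> Var c * f i = (\<Sum>j<D. const (M (c, i) j) * b j)" by auto
    define R where "R = Inl ` {..<D} \<union> Inr ` \<Phi>"
    define A where "A r ci = (case r of Inl j \<Rightarrow> M ci j 
        | Inr \<phi> \<Rightarrow> \<Sum>e\<in>{e. exp_degree e = \<alpha>}. \<phi> (fst ci) e * Poly_Mapping.lookup (f (snd ci)) e)" 
      for r :: "nat + (3 \<Rightarrow> (3 \<Rightarrow>\<^sub>0 nat) \<Rightarrow> 'k)" and ci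
    have "finite R" using fin by (simp add: R_def)
    moreover have "card R < card ((UNIV :: 3 set) \<times> {..<h})"
    proof -
      have "card R \<le> card (Inl ` {..<D} :: (nat + (3 \<Rightarrow> (3 \<Rightarrow>\<^sub>0 nat) \<Rightarrow> 'k)) set) + card (Inr ` \<Phi> :: (nat + _) set)"
        unfolding R_def by (rule card_Un_le)
      also have "\<dots> = D + card \<Phi>" by (simp add: card_image)
      also have "\<dots> < 3 * h" using card \<open>\<not> D \<ge> hilbert I (Suc \<alpha>)\<close> by (simp add: h_def)
      finally show ?thesis by simp
    qed
    ultimately obtain x where x: "\<exists>ci\<in>UNIV \<times> {..<h}. x ci \<noteq> 0" 
      "\<And>r. r \<in> R \<Longrightarrow> (\<Sum>ci\<in>UNIV \<times> {..<h}. A r ci * x ci) = 0"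
      using nontrivial_solution[of R "UNIV \<times> {..<h}" A] by auto
    define F where "F c = (\<Sum>i<h. const (x (c, i)) * f i)" for c
    have "F = (\<lambda>_. 0)"
    proof (rule triv)
      show "F c \<in> graded_part I \<alpha>" for c unfolding F_def by (rule comb_mem) (simp add: fI)
      have "(\<Sum>c\<in>UNIV. Var c * F c) = (\<Sum>c\<in>UNIV. \<Sum>i<h. \<Sum>j<D. const (M (c, i) j * x (c, i)) * b j)"
        unfolding F_def sum_distrib_left
      proof (intro sum.cong refl)
        fix c i assume "i \<in> {..<h}"
        then have "Var c * (const (x (c, i)) * f i) = const (x (c, i)) * (\<Sum>j<D. const (M (c, i) j) * b j)"
          using M[of i c] by (simp add: mult.left_commute)
        also have "\<dots> = (\<Sum>j<D. const (M (c, i) j * x (c, i)) * b j)"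
          unfolding sum_distrib_left const_hom by (intro sum.cong refl) (simp only: mult_ac)
        finally show "Var c * (const (x (c, i)) * f i) = (\<Sum>j<D. const (M (c, i) j * x (c, i)) * b j)" .
      qed
      also have "\<dots> = (\<Sum>ci\<in>UNIV \<times> {..<h}. \<Sum>j<D. const (M ci j * x ci) * b j)"
        unfolding sum.cartesian_product[of "\<lambda>c i. \<Sum>j<D. const (M (c, i) j * x (c, i)) * b j"] by (rule sum.cong) auto
      also have "\<dots> = (\<Sum>j<D. \<Sum>ci\<in>UNIV \<times> {..<h}. const (M ci j * x ci) * b j)" by (rule sum.swap)
      also have "\<dots> = (\<Sum>j<D. const (\<Sum>ci\<in>UNIV \<times> {..<h}. M ci j * x ci) * b j)"
      proof -
        have "const (\<Sum>a\<in>S. y a) = (\<Sum>a\<in>S. const (y a) :: 'k ternary)" for S :: "(3 \<times> nat) set" and y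
          by (induction S rule: infinite_finite_induct) (simp_all add: const_hom)
        then show ?thesis by (simp add: sum_distrib_right)
      qed
      also have "\<dots> = 0"
      proof (rule sum.neutral, rule ballI)
        fix j assume "j \<in> {..<D}"
        then have "(\<Sum>ci\<in>UNIV \<times> {..<h}. M ci j * x ci) = 0" using x(2)[of "Inl j"] by (simp add: R_def A_def)
        then show "const (\<Sum>ci\<in>UNIV \<times> {..<h}. M ci j * x ci) * b j = 0" by simp
      qed
      finally show "Var 0 * F 0 + Var 1 * F 1 + Var 2 * F 2 = 0" by (simp only: sum_UNIV_3)
      fix \<phi> assume "\<phi> \<in> \<Phi>"
      then have "0 = (\<Sum>ci\<in>UNIV \<times> {..<h}. A (Inr \<phi>) ci * x ci)" using x(2)[of "Inr \<phi>"] by (simp add: R_def)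
      also have "\<dots> = (\<Sum>c\<in>UNIV. \<Sum>i<h. \<Sum>e\<in>{e. exp_degree e = \<alpha>}. \<phi> c e * (x (c, i) * Poly_Mapping.lookup (f i) e))"
        unfolding sum.cartesian_product[of "\<lambda>c i. \<Sum>e\<in>{e. exp_degree e = \<alpha>}. \<phi> c e * (x (c, i) * Poly_Mapping.lookup (f i) e)"] 
        by (rule sum.cong) (auto simp: A_def sum_distrib_left mult_ac)
      also have "\<dots> = (\<Sum>c\<in>UNIV. \<Sum>e\<in>{e. exp_degree e = \<alpha>}. \<phi> c e * Poly_Mapping.lookup (F c) e)"
        by (rule sum.cong[OF refl], subst sum.swap) (simp add: F_def lookup_sum lookup_const_mult sum_distrib_left)
      finally show "(\<Sum>c\<in>UNIV. \<Sum>e\<in>{e. exp_degree e = \<alpha>}. \<phi> c e * Poly_Mapping.lookup (F c) e) = 0" by (rule sym)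
    qed
    then have "(\<Sum>i<h. const (x (c, i)) * f i) = 0" for c unfolding F_def by (rule fun_cong)
    moreover have f_indep: "lin_indep h f" using f by (simp add: basis_of_def)
    ultimately have "x (c, i) = 0" if "i < h" for c i
      using f_indep[unfolded lin_indep_def, rule_format, of "\<lambda>i. x (c, i)" i] that by simp
    then show False using x(1) by auto
  qed
  moreover have "D \<le> hilbert I (Suc \<alpha>)"
    unfolding hilbert_def 
    by (rule lin_indep_le_dim[OF subspace_graded_part graded_part_subset]) (use b W_sub in \<open>auto simp: basis_of_def\<close>)
  ultimately have "basis_of D b (graded_part I (Suc \<alpha>))"
    by (intro lin_indep_dim_basis[OF subspace_graded_part graded_part_subset])
      (use b W_sub in \<open>auto simp: basis_of_def hilbert_def\<close>)
  then obtain c where "G = (\<Sum>j<D. const (c j) * b j)" using G by (auto simp: basis_of_def)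
  moreover have "(\<Sum>j<D. const (c j) * b j) \<in> W"
    using b by (intro mpoly_space.subspace_sum[OF W] subspace_const_mult[OF W]) (auto simp: basis_of_def)
  ultimately have "G \<in> W" by simp
  moreover have "finite ((UNIV :: 3 set) \<times> {..<h})" by simp
  ultimately obtain y where y: "G = (\<Sum>t\<in>UNIV \<times> {..<h}. const (y t) * (case t of (c, i) \<Rightarrow> Var c * f i))"
    unfolding W_def using span_finite_family by blast
  also have "\<dots> = (\<Sum>c\<in>UNIV. Var c * (\<Sum>i<h. const (y (c, i)) * f i))"
    unfolding sum_distrib_left sum.cartesian_product by (rule sum.cong) (auto simp: mult.left_commute)
  finally have "G = Var 0 * (\<Sum>i<h. const (y (0, i)) * f i) + Var 1 * (\<Sum>i<h. const (y (1, i)) * f i) + 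
      Var 2 * (\<Sum>i<h. const (y (2, i)) * f i)" by (simp only: sum_UNIV_3)
  moreover have "(\<Sum>i<h. const (y (c, i)) * f i) \<in> graded_part I \<alpha>" for c by (rule comb_mem) (simp add: fI)
  ultimately show ?thesis by blast
qed

end

subsection \<open>Even squares\<close>

text \<open>This writes a coefficient of L F as a functional of the kind used in
  \<open>constrained_forms\<close>. L will be multiplication by a variable or a left inverse of
  multiplication by \<open>curve ^ m\<close>.\<close>

lemma lookup_linear:
  fixes L :: "'k::field ternary \<Rightarrow> 'k ternary"
  assumes "\<And>F G. L (F + G) = L F + L G" "\<And>a F. L (const a * F) = const a * L F" and F: "homogeneous d F"
  shows "Poly_Mapping.lookup (L F) e\<^sub>0 = 
    (\<Sum>e\<in>{e. exp_degree e = d}. Poly_Mapping.lookup (L (Poly_Mapping.single e 1)) e\<^sub>0 * Poly_Mapping.lookup F e)"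
proof -
  have "L 0 = 0" using assms(2)[of 0 0] by simp
  then have "L (\<Sum>e\<in>S. f e) = (\<Sum>e\<in>S. L (f e))" for f and S :: "(3 \<Rightarrow>\<^sub>0 nat) set"
    by (induction S rule: infinite_finite_induct) (simp_all add: assms(1))
  then have "L F = (\<Sum>e\<in>{e. exp_degree e = d}. const (Poly_Mapping.lookup F e) * L (Poly_Mapping.single e 1))"
    by (subst homogeneous_sum_single[OF F]) (simp add: assms(2))
  then have "Poly_Mapping.lookup (L F) e\<^sub>0 = 
      (\<Sum>e\<in>{e. exp_degree e = d}. Poly_Mapping.lookup F e * Poly_Mapping.lookup (L (Poly_Mapping.single e 1)) e\<^sub>0)"
    by (simp only: lookup_sum lookup_const_mult)
  then show ?thesis by (simp add: mult.commute)
qed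

lemma keys_Var_multE:
  fixes F :: "('v, 'k::comm_ring_1) mpoly"
  assumes "e \<in> Poly_Mapping.keys (Var i * F)"
  obtains e' where "e = Poly_Mapping.single i 1 + e'" "e' \<in> Poly_Mapping.keys F"
proof -
  obtain f e' where "e = f + e'" "f \<in> Poly_Mapping.keys (Var i :: ('v, 'k) mpoly)" "e' \<in> Poly_Mapping.keys F"
    using assms keys_mult by blast
  then show thesis using that by (simp add: Var_def)
qed

text \<open>Here y B + z C is free of x but equals - x A, so it is zero; then z C is free of y but
  equals - y B. Thus a syzygy is determined by the coefficients of B at monomials containing x and
  of C at monomials containing x or y.\<close>

lemma koszul_trivial:
  fixes A B C :: "'k::field ternary"
  assumes eq: "Var 0 * A + Var 1 * B + Var 2 * C = 0"
    and B: "\<And>e. e \<in> Poly_Mapping.keys B \<Longrightarrow> Poly_Mapping.lookup e 0 = 0"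
    and C: "\<And>e. e \<in> Poly_Mapping.keys C \<Longrightarrow> Poly_Mapping.lookup e 0 = 0 \<and> Poly_Mapping.lookup e 1 = 0"
  shows "A = 0 \<and> B = 0 \<and> C = 0"
proof -
  have BC: "Var 1 * B + Var 2 * C = 0"
  proof (rule ccontr)
    assume "Var 1 * B + Var 2 * C \<noteq> 0"
    then obtain e where e: "e \<in> Poly_Mapping.keys (Var 1 * B + Var 2 * C)" using keys_eq_empty_iff by blast
    have "Var 1 * B + Var 2 * C = Var 0 * (- A)" using eq by (simp add: eq_neg_iff_add_eq_0 add_ac)
    then have pos: "Poly_Mapping.lookup e 0 > 0" using e keys_Var_mult[of e 0 "- A"] by simp
    have "e \<in> Poly_Mapping.keys (Var 1 * B) \<or> e \<in> Poly_Mapping.keys (Var 2 * C)" 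
      using subsetD[OF keys_add e] by simp
    then have "Poly_Mapping.lookup e 0 = 0"
    proof
      assume "e \<in> Poly_Mapping.keys (Var 1 * B)"
      then obtain e' where "e = Poly_Mapping.single 1 1 + e'" "e' \<in> Poly_Mapping.keys B" by (rule keys_Var_multE)
      then show ?thesis using B[of e'] by (simp add: lookup_add lookup_single when_def)
    next
      assume "e \<in> Poly_Mapping.keys (Var 2 * C)"
      then obtain e' where "e = Poly_Mapping.single 2 1 + e'" "e' \<in> Poly_Mapping.keys C" by (rule keys_Var_multE)
      then show ?thesis using C[of e'] by (simp add: lookup_add lookup_single when_def)
    qed
    with pos show False by simp
  qed
  have C0: "C = 0"
  proof (rule ccontr)
    assume "C \<noteq> 0"
    then obtain e where e: "e \<in> Poly_Mapping.keys C" using keys_eq_empty_iff by blast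
    then have "Poly_Mapping.single 2 1 + e \<in> Poly_Mapping.keys (Var 2 * C)"
      by (metis lookup_Var_mult_add in_keys_iff)
    moreover have "Var 2 * C = Var 1 * (- B)" using BC by (simp add: eq_neg_iff_add_eq_0 add_ac)
    ultimately have "Poly_Mapping.lookup (Poly_Mapping.single 2 1 + e) 1 > 0" 
      using keys_Var_mult[of "Poly_Mapping.single 2 1 + e" 1 "- B"] by simp
    then show False using C[OF e] by (simp add: lookup_add lookup_single when_def)
  qed
  then show ?thesis using BC eq by simp
qed

lemma card_exponents_x:
  assumes "2 \<le> q"
  shows "card {e :: 3 \<Rightarrow>\<^sub>0 nat. exp_degree e = q - 1 \<and> Poly_Mapping.lookup e 0 > 0} \<le> (q - 1) * q div 2"
proof -
  have "{e :: 3 \<Rightarrow>\<^sub>0 nat. exp_degree e = q - 1 \<and> Poly_Mapping.lookup e 0 > 0} \<subseteq> 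
      (\<lambda>e. Poly_Mapping.single 0 1 + e) ` {e. exp_degree e = q - 2}"
  proof
    fix e :: "3 \<Rightarrow>\<^sub>0 nat" assume e: "e \<in> {e. exp_degree e = q - 1 \<and> Poly_Mapping.lookup e 0 > 0}"
    show "e \<in> (\<lambda>e. Poly_Mapping.single 0 1 + e) ` {e. exp_degree e = q - 2}"
    proof (rule image_eqI)
      show "e = Poly_Mapping.single 0 1 + (e - Poly_Mapping.single 0 1)"
        by (rule poly_mapping_eqI) (use e in \<open>auto simp: lookup_add lookup_minus lookup_single when_def\<close>)
      show "e - Poly_Mapping.single 0 1 \<in> {e. exp_degree e = q - 2}"
        using exp_degree_minus_single[of e 0] e by simp
    qed
  qed
  from le_trans[OF card_mono[OF finite_imageI[OF finite_exponents_eq] this] card_image_le[OF finite_exponents_eq]]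
  have "card {e :: 3 \<Rightarrow>\<^sub>0 nat. exp_degree e = q - 1 \<and> Poly_Mapping.lookup e 0 > 0} \<le> card {e :: 3 \<Rightarrow>\<^sub>0 nat. exp_degree e = q - 2}" .
  also have "\<dots> = (q - 1) * q div 2"
  proof -
    obtain q' where "q = q' + 2" using assms le_Suc_ex by (metis add.commute)
    then show ?thesis by (simp add: card_exponents)
  qed
  finally show ?thesis .
qed

text \<open>Only the pure power of z is left out. Together with the monomials containing x this
  gives q (q - 1) / 2 + q (q + 1) / 2 - 1 = q^2 - 1 functionals.\<close>

lemma card_exponents_xy:
  assumes "1 \<le> q"
  shows "card {e :: 3 \<Rightarrow>\<^sub>0 nat. exp_degree e = q - 1 \<and> (Poly_Mapping.lookup e 0 > 0 \<or> Poly_Mapping.lookup e 1 > 0)} + 1 \<le> q * (q + 1) div 2"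
proof -
  let ?S = "{e :: 3 \<Rightarrow>\<^sub>0 nat. exp_degree e = q - 1 \<and> (Poly_Mapping.lookup e 0 > 0 \<or> Poly_Mapping.lookup e 1 > 0)}"
  have "?S \<subseteq> {e. exp_degree e = q - 1} - {exp3 0 0 (q - 1)}" by auto
  then have "card ?S \<le> card ({e. exp_degree e = q - 1} - {exp3 0 0 (q - 1)})"
    by (intro card_mono) (auto simp: finite_exponents_eq)
  also have "\<dots> = q * (q + 1) div 2 - 1" using assms by (simp add: card_exponents card_Diff_singleton)
  finally have "card ?S \<le> q * (q + 1) div 2 - 1" .
  moreover have "2 * 1 \<le> q * (q + 1)" using assms by (intro order_trans[OF _ mult_mono[of 1 q 2 "q + 1"]]) auto
  then have "1 \<le> q * (q + 1) div 2" by simp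
  ultimately show ?thesis by simp
qed

theorem general_rank_minimal_surjective:
  fixes q m n :: nat
  assumes q2: "2 \<le> q" and n: "n = 2 * q * (2 * q)" 
    and deg: "expected_degree n (uniform_mult m) = q * (2 * m + 1) - 1"
  shows "for_general_points n (\<lambda>p :: nat \<Rightarrow> 'k::alg_closed_field proj_plane.
    unhindered n (uniform_mult m) p \<longrightarrow> rank_minimal n (uniform_mult m) p)"
proof -
  obtain e :: "nat \<Rightarrow> 'k" where e: "inj e" 
    using infinite_countable_subset[OF infinite_UNIV_alg_closed[where 'k = 'k]] by blast
  interpret configuration q e by unfold_locales (use q2 e in auto)
  define \<alpha> where "\<alpha> = q * (2 * m + 1) - 1"
  have "\<forall>j. \<exists>B. 1 \<le> j \<longrightarrow> finite B \<and> (\<forall>\<epsilon>. \<epsilon> \<notin> B \<longrightarrow> (\<forall>G. glued j \<epsilon> G \<longrightarrow> (\<forall>a<2 * q. \<forall>c. G a c = 0)))"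
  proof
    fix j
    show "\<exists>B. 1 \<le> j \<longrightarrow> finite B \<and> (\<forall>\<epsilon>. \<epsilon> \<notin> B \<longrightarrow> (\<forall>G. glued j \<epsilon> G \<longrightarrow> (\<forall>a<2 * q. \<forall>c. G a c = 0)))"
    proof (cases "1 \<le> j")
      case True
      then show ?thesis using glued_generic_trivial[OF True] by simp
    qed simp
  qed
  from choice[OF this] obtain B where B': "\<forall>j. 1 \<le> j \<longrightarrow> finite (B j) \<and> 
      (\<forall>\<epsilon>. \<epsilon> \<notin> B j \<longrightarrow> (\<forall>G. glued j \<epsilon> G \<longrightarrow> (\<forall>a<2 * q. \<forall>c. G a c = 0)))" ..
  have B: "finite (B j)" if "1 \<le> j" for j using B' that by simp
  have B_triv: "G a c = 0" if "1 \<le> j" "\<epsilon> \<notin> B j" "glued j \<epsilon> G" "a < 2 * q" for j \<epsilon> G a c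
    using B' that by simp
  have "finite (bad \<union> (\<Union>j\<in>{1..m}. B j))" using B finite_bad by auto
  then obtain \<epsilon> where \<epsilon>: "\<epsilon> \<notin> bad \<union> (\<Union>j\<in>{1..m}. B j)" 
    using ex_new_if_finite[OF infinite_UNIV_alg_closed[where 'k = 'k]] by blast
  have factor: "\<exists>F'. \<forall>c. homogeneous (q - 1) (F' c) \<and> F c = curve ^ m * F' c" 
    if "\<forall>c. homogeneous \<alpha> (F c)" "\<forall>c. \<forall>i<n. vanishes m (config_point \<epsilon> i) (F c)" 
      "Var 0 * F 0 + Var 1 * F 1 + Var 2 * F 2 = 0" for F :: "3 \<Rightarrow> 'k ternary"
  proof (rule syzygy_factor[of \<epsilon> m m F])
    show "\<epsilon> \<notin> bad" using \<epsilon> by blast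
    show "G a c = 0" if "1 \<le> j" "j \<le> m" "glued j \<epsilon> G" "a < 2 * q" for j G a c
      by (rule B_triv[OF that(1) _ that(3,4)]) (use \<epsilon> that in auto)
  qed (use that in \<open>simp_all add: \<alpha>_def n\<close>)
  \<comment> \<open>The functionals should read coefficients of the cofactor of
    \<open>curve ^ m\<close>, but must be defined on all forms of degree \<alpha> since the points
    will vary. A linear left inverse of multiplication extends them.\<close>
  have "Vector_Spaces.linear scale_mpoly scale_mpoly (\<lambda>F. curve ^ m * F)"
    by unfold_locales (auto simp: distrib_left scale_mpoly_const mult.left_commute)
  moreover have "inj (\<lambda>F. curve ^ m * F)" using curve_neq_0 by (auto simp: inj_def)
  ultimately obtain g where g: "Vector_Spaces.linear scale_mpoly scale_mpoly g" "g \<circ> (\<lambda>F. curve ^ m * F) = id"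
    using vector_space_pair.linear_injective_left_inverse[of scale_mpoly scale_mpoly]
    by (metis mpoly_space.vector_space_axioms vector_space_pair.intro)
  interpret g: Vector_Spaces.linear scale_mpoly scale_mpoly g by (rule g(1))
  have g_lin: "g (F + G) = g F + g G" "g (const a * F) = const a * g F" for F G a
    using g.add[of F G] g.scale[of a F] by (simp_all add: scale_mpoly_const)
  have g_inv: "g (curve ^ m * F) = F" for F using fun_cong[OF g(2), of F] by simp
  define \<psi> where "\<psi> c0 e0 = (\<lambda>(c :: 3) e'. if c = c0 then Poly_Mapping.lookup (g (Poly_Mapping.single e' 1)) e0 else 0)" for c0 e0
  define E1 E2 where "E1 = {e :: 3 \<Rightarrow>\<^sub>0 nat. exp_degree e = q - 1 \<and> Poly_Mapping.lookup e 0 > 0}"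
    and "E2 = {e :: 3 \<Rightarrow>\<^sub>0 nat. exp_degree e = q - 1 \<and> (Poly_Mapping.lookup e 0 > 0 \<or> Poly_Mapping.lookup e 1 > 0)}"
  define \<Phi> where "\<Phi> = \<psi> 1 ` E1 \<union> \<psi> 2 ` E2"
  \<comment> \<open>The coefficients of x F_0 + y F_1 + z F_2. They turn the syzygy equation into
    linear constraints; being zero on every syzygy, they do not enter the count of \<Phi>.\<close>
  define \<xi> where "\<xi> e0 = (\<lambda>(c :: 3) e'. Poly_Mapping.lookup (Var c * Poly_Mapping.single e' (1 :: 'k)) e0)" for e0
  define \<Lambda> where "\<Lambda> = range \<xi>"
  have finE: "finite E1" "finite E2" 
    unfolding E1_def E2_def by (rule finite_subset[OF _ finite_exponents_eq[of "q - 1"]]; auto)+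
  then have fin: "finite \<Phi>" by (simp add: \<Phi>_def)
  have card: "card \<Phi> + 1 \<le> q * q"
  proof -
    have "card \<Phi> \<le> card E1 + card E2"
      unfolding \<Phi>_def by (rule order_trans[OF card_Un_le add_mono[OF card_image_le card_image_le]]) (rule finE)+
    also have "\<dots> + 1 \<le> (q - 1) * q div 2 + q * (q + 1) div 2"
      using card_exponents_x[OF q2] card_exponents_xy[of q] q by (simp add: E1_def E2_def)
    also have "\<dots> = q * q"
    proof -
      obtain q' where q': "q = Suc q'" using q by (cases q) auto
      have "even ((q - 1) * q)" "even (q * (q + 1))" by auto
      then obtain a b where a: "(q - 1) * q = 2 * a" and b: "q * (q + 1) = 2 * b" by (elim evenE)
      have "(q - 1) * q + q * (q + 1) = 2 * (q * q)" by (simp add: q')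
      then show ?thesis unfolding a b by simp
    qed
    finally show ?thesis by simp
  qed
  have \<psi>_sum: "(\<Sum>c\<in>UNIV. \<Sum>e'\<in>{e. exp_degree e = \<alpha>}. \<psi> c0 e0 c e' * Poly_Mapping.lookup (F c) e') = Poly_Mapping.lookup (g (F c0)) e0"
    if "\<forall>c. homogeneous \<alpha> (F c)" for F c0 e0
  proof -
    have "(\<Sum>c\<in>UNIV. \<Sum>e'\<in>{e. exp_degree e = \<alpha>}. \<psi> c0 e0 c e' * Poly_Mapping.lookup (F c) e') = 
      (\<Sum>c\<in>UNIV. if c = c0 then Poly_Mapping.lookup (g (F c0)) e0 else 0)"
      by (rule sum.cong) (use that in \<open>auto simp: \<psi>_def lookup_linear[OF g_lin, of \<alpha>]\<close>)
    then show ?thesis by simp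
  qed
  have \<xi>_sum: "(\<Sum>c\<in>UNIV. \<Sum>e'\<in>{e. exp_degree e = \<alpha>}. \<xi> e0 c e' * Poly_Mapping.lookup (F c) e') = 
      Poly_Mapping.lookup (Var 0 * F 0 + Var 1 * F 1 + Var 2 * F 2) e0"
    if F: "\<forall>c. homogeneous \<alpha> (F c)" for F :: "3 \<Rightarrow> 'k ternary" and e0
  proof -
    have "(\<Sum>e'\<in>{e. exp_degree e = \<alpha>}. Poly_Mapping.lookup (Var c * Poly_Mapping.single e' 1) e0 * Poly_Mapping.lookup (F c) e') = 
      Poly_Mapping.lookup (Var c * F c) e0" for c
      by (rule lookup_linear[symmetric]) (use F in \<open>auto simp: distrib_left mult.left_commute\<close>)
    then show ?thesis by (simp add: sum_UNIV_3 lookup_add \<xi>_def)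
  qed
  have nz: "nonzero_lifts n (config_point \<epsilon>)"
    unfolding nonzero_lifts_def config_point_def by (auto simp: node_def fun_eq_iff intro!: exI[of _ 2])
  have gen: "generic n (\<lambda>p :: nat \<Rightarrow> 'k proj_plane. \<forall>F. constrained_forms n (uniform_mult m) \<alpha> UNIV (\<Phi> \<union> \<Lambda>) (lifts p) F \<longrightarrow> (\<forall>c\<in>UNIV. F c = 0))"
  proof (rule generic_no_constrained_forms[OF nz])
    fix F assume F: "constrained_forms n (uniform_mult m) \<alpha> UNIV (\<Phi> \<union> \<Lambda>) (config_point \<epsilon>) F"
    then have hom: "\<forall>c. homogeneous \<alpha> (F c)" and van: "\<forall>c. \<forall>i<n. vanishes m (config_point \<epsilon> i) (F c)"
      by (auto simp: constrained_forms_def uniform_mult_def)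
    have cond: "\<forall>\<phi>\<in>\<Phi> \<union> \<Lambda>. (\<Sum>c\<in>UNIV. \<Sum>e\<in>{e. exp_degree e = \<alpha>}. \<phi> c e * Poly_Mapping.lookup (F c) e) = 0"
      using F by (simp add: constrained_forms_def)
    have "Poly_Mapping.lookup (Var 0 * F 0 + Var 1 * F 1 + Var 2 * F 2) e0 = 0" for e0
      using bspec[OF cond, of "\<xi> e0"] \<xi>_sum[OF hom] by (simp add: \<Lambda>_def)
    then have syz: "Var 0 * F 0 + Var 1 * F 1 + Var 2 * F 2 = 0" by (intro poly_mapping_eqI) simp
    from factor[OF hom van syz] obtain F' where 
      F': "\<And>c. homogeneous (q - 1) (F' c)" "\<And>c. F c = curve ^ m * F' c" by blast
    have "curve ^ m * (Var 0 * F' 0 + Var 1 * F' 1 + Var 2 * F' 2) = 0"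
      using syz unfolding F'(2) by (simp only: distrib_left mult.left_commute)
    then have syz': "Var 0 * F' 0 + Var 1 * F' 1 + Var 2 * F' 2 = 0" using curve_neq_0 by simp
    have zero: "Poly_Mapping.lookup (F' c0) e0 = 0" if "\<psi> c0 e0 \<in> \<Phi>" for c0 e0
    proof -
      have "Poly_Mapping.lookup (g (F c0)) e0 = 0"
        using bspec[OF cond, of "\<psi> c0 e0"] \<psi>_sum[OF hom] that by simp
      then show ?thesis by (simp add: F'(2) g_inv)
    qed
    have "F' 0 = 0 \<and> F' 1 = 0 \<and> F' 2 = 0"
    proof (rule koszul_trivial[OF syz'])
      fix e' assume e': "e' \<in> Poly_Mapping.keys (F' 1)"
      then have "exp_degree e' = q - 1" using F'(1) by (auto simp: homogeneous_def)
      moreover have "e' \<notin> E1" using zero[of 1 e'] e' by (auto simp: \<Phi>_def in_keys_iff)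
      ultimately show "Poly_Mapping.lookup e' 0 = 0" by (simp add: E1_def)
    next
      fix e' assume e': "e' \<in> Poly_Mapping.keys (F' 2)"
      then have "exp_degree e' = q - 1" using F'(1) by (auto simp: homogeneous_def)
      moreover have "e' \<notin> E2" using zero[of 2 e'] e' by (auto simp: \<Phi>_def in_keys_iff)
      ultimately show "Poly_Mapping.lookup e' 0 = 0 \<and> Poly_Mapping.lookup e' 1 = 0" by (simp add: E2_def)
    qed
    then have "\<forall>c. F' c = 0" unfolding forall_3 .
    then show "\<forall>c\<in>UNIV. F c = 0" using F'(2) by simp
  qed
  have GZ: "generic n (\<lambda>p :: nat \<Rightarrow> 'k proj_plane. \<forall>i<n. lifts p i 2 \<noteq> 0)" by (rule generic_all_coords) simp
  show ?thesis
  proof (rule for_general_points_if_generic, rule generic_mono[OF generic_conj[OF gen GZ]], rule impI)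
    fix p :: "nat \<Rightarrow> 'k proj_plane"
    assume G: "(\<forall>F. constrained_forms n (uniform_mult m) \<alpha> UNIV (\<Phi> \<union> \<Lambda>) (lifts p) F \<longrightarrow> (\<forall>c\<in>UNIV. F c = 0)) \<and> (\<forall>i<n. lifts p i 2 \<noteq> 0)"
      and unh: "unhindered n (uniform_mult m) p"
    have z: "\<forall>i<n. lifts p i 2 \<noteq> 0" using G by blast
    interpret saturated_ideal "fat_ideal n (uniform_mult m) p" by (rule saturated_fat_ideal[OF z])
    let ?h = "hilbert (fat_ideal n (uniform_mult m) p)"
    define s where "s = q * (2 * m + 1)"
    have s: "\<alpha> + 1 = s" "0 < s" using q by (simp_all add: \<alpha>_def s_def)
    have "2 * ?h \<alpha> = s * (s + 1) - n * (m * (m + 1))"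
      unfolding unhindered_hilbert[OF unh] conditions_uniform using s by (metis Suc_1 add_Suc_right plus_1_eq_Suc add.commute)
    moreover have "s * (s + 1) = n * (m * (m + 1)) + (q * q + s)" by (simp add: s_def n algebra_simps)
    ultimately have h: "2 * ?h \<alpha> = q * q + s" by simp
    have h': "?h (Suc \<alpha>) = ?h \<alpha> + s + 1" 
      using unhindered_growth[OF z unh, of \<alpha>] deg s by (simp add: \<alpha>_def)
    show "rank_minimal n (uniform_mult m) p"
    proof (rule rank_minimal_surjective[OF z unh])
      have "1 * 1 \<le> q * q" using q by (intro mult_mono) auto
      then show "expected_degree n (uniform_mult m) + 2 \<le> 2 * ?h (expected_degree n (uniform_mult m))"
        using h s unfolding deg \<alpha>_def[symmetric] by simp
      fix H assume H: "H \<in> graded_part (fat_ideal n (uniform_mult m) p) (Suc (expected_degree n (uniform_mult m)))"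
      show "\<exists>A\<in>graded_part (fat_ideal n (uniform_mult m) p) (expected_degree n (uniform_mult m)).
          \<exists>B\<in>graded_part (fat_ideal n (uniform_mult m) p) (expected_degree n (uniform_mult m)).
          \<exists>C\<in>graded_part (fat_ideal n (uniform_mult m) p) (expected_degree n (uniform_mult m)). 
            H = Var 0 * A + Var 1 * B + Var 2 * C"
        unfolding deg \<alpha>_def[symmetric]
      proof (rule surjective_if_few_syzygies[OF fin])
        \<comment> \<open>From \<open>h\<close> and \<open>h'\<close>, three times the dimension in
          degree \<alpha> minus the dimension in degree \<alpha> + 1 equals (q^2 + s) - s - 1 = q^2
          - 1.\<close>
        show "card \<Phi> + ?h (Suc \<alpha>) \<le> 3 * ?h \<alpha>" using card h h' by simp
        show "H \<in> graded_part (fat_ideal n (uniform_mult m) p) (Suc \<alpha>)" using H unfolding deg \<alpha>_def .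
        fix F :: "3 \<Rightarrow> 'k ternary"
        assume F: "\<And>c. F c \<in> graded_part (fat_ideal n (uniform_mult m) p) \<alpha>" 
          and syz: "Var 0 * F 0 + Var 1 * F 1 + Var 2 * F 2 = 0"
          and \<Phi>: "\<And>\<phi>. \<phi> \<in> \<Phi> \<Longrightarrow> (\<Sum>c\<in>UNIV. \<Sum>e\<in>{e. exp_degree e = \<alpha>}. \<phi> c e * Poly_Mapping.lookup (F c) e) = 0"
        have hom: "\<forall>c. homogeneous \<alpha> (F c)" using F graded_fat_ideal_iff by blast
        have "\<forall>\<phi>\<in>\<Lambda>. (\<Sum>c\<in>UNIV. \<Sum>e\<in>{e. exp_degree e = \<alpha>}. \<phi> c e * Poly_Mapping.lookup (F c) e) = 0"
          unfolding \<Lambda>_def using \<xi>_sum[OF hom] syz by simp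
        then have "constrained_forms n (uniform_mult m) \<alpha> UNIV (\<Phi> \<union> \<Lambda>) (lifts p) F"
          unfolding constrained_forms_def using F \<Phi> graded_fat_ideal_iff by blast
        then show "F = (\<lambda>_. 0)" using G by blast
      qed
    qed
  qed
qed

section \<open>The theorem\<close>

lemma sqrt_irrational:
  assumes "\<not> is_square (n :: nat)"
  shows "sqrt (real n) \<notin> \<rat>"
proof
  assume "sqrt (real n) \<in> \<rat>"
  then obtain a b :: nat where b: "b \<noteq> 0" and ab: "\<bar>sqrt (real n)\<bar> = real a / real b"
    by (rule Rats_abs_nat_div_natE)
  have "real n = (real a / real b)\<^sup>2" using ab by (metis abs_of_nonneg of_nat_0_le_iff real_sqrt_ge_0_iff real_sqrt_pow2)
  then have "real (n * b ^ 2) = real (a ^ 2)" using b by (simp add: power_divide)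
  then have "n * b ^ 2 = a ^ 2" by (simp only: of_nat_eq_iff)
  then have "b ^ 2 dvd a ^ 2" by (metis dvd_triv_right)
  then have "b dvd a" by (simp add: pow_divides_pow_iff)
  then obtain c where "a = b * c" by blast
  then have "n = c ^ 2" using \<open>n * b ^ 2 = a ^ 2\<close> b by (simp add: power_mult_distrib)
  then show False using assms by (auto simp: is_nth_power_def)
qed

text \<open>Let w be the excess of 2t+3 over \<theta> (2m+1), with \<theta> = sqrt n. Completing
  squares reduces the claim to 0 < w < 1 / \<theta> for some m larger than n, which density of
  fractional parts provides.\<close>

lemma few_forms_infinitely_often:
  assumes n: "n > 9" and sq: "\<not> is_square (n :: nat)"
  shows "\<exists>m t. N < m \<and> n * (m * (m + 1)) < (t + 1) * (t + 2) \<and> (t + 1) * (t + 2) \<le> n * (m * (m + 1)) + 2 * (m + 1)"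
proof -
  define \<theta> where "\<theta> = sqrt (real n)"
  define N' where "N' = max N n"
  have \<theta>2: "\<theta> * \<theta> = real n" by (simp add: \<theta>_def)
  have \<theta>: "3 < \<theta>" unfolding \<theta>_def by (rule real_less_rsqrt) (use n in simp)
  have irr: "\<theta> \<notin> \<rat>" unfolding \<theta>_def by (rule sqrt_irrational[OF sq])
  have irr': "real (N' + 1) * \<theta> \<notin> \<rat>"
  proof
    assume "real (N' + 1) * \<theta> \<in> \<rat>"
    then have "real (N' + 1) * \<theta> / real (N' + 1) \<in> \<rat>" by (intro Rats_divide Rats_of_nat)
    then show False using irr by simp
  qed
  define \<delta> where "\<delta> = 1 / (4 * \<theta>)"
  have \<delta>: "\<delta> > 0" using \<theta> by (simp add: \<delta>_def)
  \<comment> \<open>The target is chosen so that w lies within 2 \<delta> of 2 \<delta>, that is,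
    between 0 and 4 \<delta> = 1 / \<theta>.\<close>
  obtain h k :: int where k: "k > 0" and 
    hk: "\<bar>of_int k * (real (N' + 1) * \<theta>) - of_int h - (- ((\<theta> - 3) / 2 + \<delta>))\<bar> < \<delta>"
    using sequence_of_fractional_parts_is_dense[OF irr' \<delta>, of "- ((\<theta> - 3) / 2 + \<delta>)"] by metis
  define m where "m = (N' + 1) * nat k"
  have mk: "real m = of_int k * real (N' + 1)" using k by (simp add: m_def algebra_simps)
  have m: "N' < m" unfolding m_def using k by (cases "nat k") auto
  define w where "w = 2 * of_int h + 3 - \<theta> * (2 * real m + 1)"
  have eq: "of_int k * (real (N' + 1) * \<theta>) = \<theta> * real m" by (simp add: mk)
  define \<mu> where "\<mu> = \<theta> * real m"
  have w_eq: "w = 2 * of_int h + 3 - 2 * \<mu> - \<theta>" by (simp add: w_def \<mu>_def algebra_simps)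
  have "- \<delta> < \<mu> - of_int h + ((\<theta> - 3) / 2 + \<delta>)" "\<mu> - of_int h + ((\<theta> - 3) / 2 + \<delta>) < \<delta>"
    using hk unfolding eq \<mu>_def[symmetric] by (simp_all add: abs_less_iff)
  then have w: "0 < w" "w < 4 * \<delta>" unfolding w_eq by (simp_all add: field_simps)
  \<comment> \<open>Since \<theta> > 3, the bound 2 h + 3 > \<theta> makes h positive and hence a
    natural number; this is where n > 9 enters.\<close>
  have "\<theta> * 1 \<le> \<theta> * (2 * real m + 1)" using \<theta> by (intro mult_left_mono) auto
  then have "of_int h > (0 :: real)" using w(1) \<theta> unfolding w_def by linarith
  then have h: "h > 0" by simp
  define t where "t = nat h"
  have th: "of_int h = real t" using h by (simp add: t_def)
  define y where "y = 2 * real m + 1"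
  have x: "2 * real t + 3 = \<theta> * y + w" by (simp add: w_def th y_def)
  have y0: "y > 0" by (simp add: y_def)
  have x2: "(2 * real t + 3)\<^sup>2 = real n * y\<^sup>2 + w * (2 * \<theta> * y + w)"
    unfolding x using \<theta>2 by (simp add: power2_eq_square algebra_simps)
  have four: "4 * real ((t + 1) * (t + 2)) = (2 * real t + 3)\<^sup>2 - 1" "4 * real (n * (m * (m + 1))) = real n * (y\<^sup>2 - 1)"
    by (simp_all add: y_def power2_eq_square algebra_simps)
  have "0 < w * (2 * \<theta> * y + w)" using w(1) \<theta> y0 by (intro mult_pos_pos add_pos_pos) auto
  then have "4 * real (n * (m * (m + 1))) < 4 * real ((t + 1) * (t + 2))"
    unfolding four x2 using n by (simp add: right_diff_distrib)
  then have 1: "n * (m * (m + 1)) < (t + 1) * (t + 2)" by (simp only: mult_less_cancel_left_pos zero_less_numeral of_nat_less_iff)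
  have \<delta>\<theta>: "4 * \<delta> * \<theta> = 1" "4 * \<delta> < 1" using \<theta> by (simp_all add: \<delta>_def)
  have "w * (2 * \<theta> * y + w) \<le> 4 * \<delta> * (2 * \<theta> * y + 4 * \<delta>)"
    using w \<theta> y0 by (intro mult_mono add_mono add_nonneg_nonneg mult_nonneg_nonneg) auto
  also have "\<dots> = (4 * \<delta> * \<theta>) * (2 * y) + (4 * \<delta>) * (4 * \<delta>)" by (simp add: algebra_simps)
  also have "\<dots> \<le> 2 * y + 1"
    using \<delta>\<theta> \<delta> mult_mono[of "4 * \<delta>" 1 "4 * \<delta>" 1] by simp
  finally have "4 * real ((t + 1) * (t + 2)) \<le> 4 * real (n * (m * (m + 1)) + 2 * (m + 1))"
  proof -
    assume *: "w * (2 * \<theta> * y + w) \<le> 2 * y + 1"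
    have "4 * real (n * (m * (m + 1)) + 2 * (m + 1)) = real n * (y\<^sup>2 - 1) + 8 * (real m + 1)"
      using four(2) by simp
    \<comment> \<open>The terms n - 1 and 2 y + 1 = 4 m + 3 must fit below 8 (m + 1), and m > n
      leaves enough room.\<close>
    moreover have "real n < real m" using m by (simp add: N'_def)
    ultimately show ?thesis unfolding four(1) x2 using * by (simp add: y_def right_diff_distrib)
  qed
  then have 2: "(t + 1) * (t + 2) \<le> n * (m * (m + 1)) + 2 * (m + 1)" 
    by (simp only: mult_le_cancel_left_pos zero_less_numeral of_nat_le_iff)
  have "N < m" using m by (simp add: N'_def)
  with 1 2 show ?thesis by blast
qed

lemma few_forms_odd_square:
  assumes "n > 9" "is_square (n :: nat)" "odd n" and m: "real m \<ge> (real n - 9) / 8"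
  shows "\<exists>t. n * (m * (m + 1)) < (t + 1) * (t + 2) \<and> (t + 1) * (t + 2) \<le> n * (m * (m + 1)) + 2 * (m + 1)"
proof -
  obtain r where r: "n = r\<^sup>2" using assms(2) by (auto simp: is_nth_power_def)
  then have "odd r" using assms(3) by simp
  then obtain s where s: "r = 2 * s + 1" by (rule oddE)
  have n_eq: "n = 4 * (s * (s + 1)) + 1" by (simp add: r s power2_eq_square algebra_simps)
  then have "1 \<le> s" using assms(1) by (cases s) auto
  then obtain s' where s': "s = Suc s'" by (cases s) auto
  \<comment> \<open>This is the t with 2 t + 3 = (2 s + 1)(2 m + 1). The remaining difference is (n
    - 1) / 4 = s (s + 1), and comparing it with 2 (m + 1) gives the bound (n - 9) / 8.\<close>
  define t where "t = 2 * s * m + s' + m"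
  have eq: "(t + 1) * (t + 2) = n * (m * (m + 1)) + s * (s + 1)"
    by (simp add: t_def n_eq s' algebra_simps)
  have "real (s * (s + 1)) \<le> real (2 * (m + 1))" using m unfolding n_eq by simp
  then have "s * (s + 1) \<le> 2 * (m + 1)" by (simp only: of_nat_le_iff)
  moreover have "0 < s * (s + 1)" using s' by simp
  ultimately show ?thesis using eq by (intro exI[of _ t]) simp
qed

text \<open>With s = q (2m+1) one has s^2 = n m (m+1) + q^2. Degree s - 1 exceeds the conditions by
  q^2 + s, whereas in degree s - 2 the difference is q^2 - s, which is not positive exactly when q
  \<le> 2m+1.\<close>

lemma expected_degree_even_square:
  assumes n: "n = 2 * q * (2 * q)" and q: "1 \<le> q" "q \<le> 2 * m + 1"
  shows "expected_degree n (uniform_mult m) = q * (2 * m + 1) - 1"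
proof -
  define s where "s = q * (2 * m + 1)"
  have s: "s * s = n * (m * (m + 1)) + q * q" by (simp add: s_def n algebra_simps)
  have qs: "q * q \<le> s" unfolding s_def using q(2) by (rule mult_le_mono2)
  moreover have "0 < q * q" using q(1) by simp
  ultimately have s1: "1 \<le> s" by linarith
  have "expected_degree n (uniform_mult m) \<le> s - 1"
    unfolding expected_degree_iff conditions_uniform using s s1 by simp
  moreover have "\<not> expected_degree n (uniform_mult m) \<le> s - 2" if "2 \<le> s"
  proof -
    define s' where "s' = s - 2"
    then have s': "s = s' + 2" using that by simp
    have "(s - 2 + 1) * (s - 2 + 2) + s = s * s" by (simp add: s' algebra_simps)
    then show ?thesis unfolding expected_degree_iff conditions_uniform using s qs by simp
  qed
  ultimately show ?thesis unfolding s_def[symmetric] using s1 by (cases "2 \<le> s") auto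
qed

theorem mainTheorem1:
  fixes n :: nat
  assumes "n > 9"
  shows
    "(\<not> is_square n \<longrightarrow>
        infinite {m. m > 0 \<and>
          for_general_points n (\<lambda>p :: nat \<Rightarrow> 'k::alg_closed_field proj_plane.
            unhindered n (uniform_mult m) p \<and> unhindered n (raised_mult m) p \<longrightarrow>
            rank_minimal n (uniform_mult m) p)}) \<and>
     (is_square n \<and> odd n \<longrightarrow>
        (\<forall>m. real m \<ge> (real n - 9) / 8 \<longrightarrow>
          for_general_points n (\<lambda>p :: nat \<Rightarrow> 'k proj_plane.
            unhindered n (uniform_mult m) p \<and> unhindered n (raised_mult m) p \<longrightarrow>
            rank_minimal n (uniform_mult m) p))) \<and>
     (\<forall>r::nat. n = r^2 \<and> even n \<and> r > 0 \<longrightarrow>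
        (\<forall>m. real m \<ge> (real r - 2) / 4 \<longrightarrow>
          for_general_points n (\<lambda>p :: nat \<Rightarrow> 'k proj_plane.
            unhindered n (uniform_mult m) p \<longrightarrow>
            rank_minimal n (uniform_mult m) p)))"
proof (intro conjI impI allI)
  assume sq: "\<not> is_square n"
  let ?M = "{m. m > 0 \<and> for_general_points n (\<lambda>p :: nat \<Rightarrow> 'k proj_plane.
      unhindered n (uniform_mult m) p \<and> unhindered n (raised_mult m) p \<longrightarrow> rank_minimal n (uniform_mult m) p)}"
  have "\<exists>m>N. m \<in> ?M" for N
  proof -
    obtain m t where "N < m" and t: "n * (m * (m + 1)) < (t + 1) * (t + 2)" 
      "(t + 1) * (t + 2) \<le> n * (m * (m + 1)) + 2 * (m + 1)"
      using few_forms_infinitely_often[OF assms sq] by blast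
    then show ?thesis
      using general_rank_minimal_injective[OF _ t, where 'k = 'k] assms by (intro exI[of _ m]) simp
  qed
  then show "infinite ?M" by (simp add: infinite_nat_iff_unbounded)
next
  fix m assume "is_square n \<and> odd n" and m: "(real n - 9) / 8 \<le> real m"
  then obtain t where t: "n * (m * (m + 1)) < (t + 1) * (t + 2)" 
    "(t + 1) * (t + 2) \<le> n * (m * (m + 1)) + 2 * (m + 1)"
    using few_forms_odd_square[OF assms] by blast
  show "for_general_points n (\<lambda>p :: nat \<Rightarrow> 'k proj_plane.
      unhindered n (uniform_mult m) p \<and> unhindered n (raised_mult m) p \<longrightarrow> rank_minimal n (uniform_mult m) p)"
    by (rule general_rank_minimal_injective[OF _ t]) (use assms in simp)
next
  fix r m assume r: "n = r\<^sup>2 \<and> even n \<and> r > 0" and m: "(real r - 2) / 4 \<le> real m"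
  then have "even r" by auto
  then obtain q where q: "r = 2 * q" by (rule evenE)
  have n: "n = 2 * q * (2 * q)" using r by (simp add: q power2_eq_square)
  have "2 \<le> q"
  proof (rule ccontr)
    assume "\<not> 2 \<le> q"
    then have "q * q \<le> 1 * 1" by (intro mult_mono) auto
    then show False using assms n by simp
  qed
  have "real q \<le> real (2 * m + 1)" using m by (simp add: q)
  then have "q \<le> 2 * m + 1" by (simp only: of_nat_le_iff)
  with \<open>2 \<le> q\<close> show "for_general_points n (\<lambda>p :: nat \<Rightarrow> 'k proj_plane.
      unhindered n (uniform_mult m) p \<longrightarrow> rank_minimal n (uniform_mult m) p)"
    by (intro general_rank_minimal_surjective[OF _ n] expected_degree_even_square[OF n]) auto
qed

end
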